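(* There is a universal constant $C>0$ such that the following holds. Let $N_1,\dots,N_M$ be norms on $\mathbb{R}^n$, let $g$ be a standard $n$-dimensional Gaussian vector, and set $$\kappa=\mathbb{E}\max_{j\in\{1,\dots,M\}}N_j(g),\qquad \lambda=\max_{j\in\{1,\dots,M\}}\left(\mathbb{E}[N_j(g)^2]\right)^{1/2}.$$ Then for any nonempty $T\subseteq B_2^n$, $$\mathbb{E}\sup_{x\in T}\sum_{j=1}^M\varepsilon_jN_j(x)^2\le C\left(\lambda\sqrt{\log n}+\kappa\right)\cdot\sup_{x\in T}\left(\sum_{j=1}^MN_j(x)^2\right)^{1/2},$$ where $\varepsilon_1,\dots,\varepsilon_M$ are i.i.d. uniform $\pm1$ random variables.
   Context: $B_2^n=\{x\in\mathbb{R}^n:\|x\|\le1\}$ is the closed Euclidean unit ball. *)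

theory Defs
  imports "HOL-Probability.Probability" "Jordan_Normal_Form.Matrix"
begin

(* R^n is carrier_vec n :: real vec set, so that n is a term-level variable; a constant quantified
   outside n is then independent of the dimension, which a type-indexed real ^ 'n would not allow. *)

definition is_norm_on :: "nat \<Rightarrow> (real vec \<Rightarrow> real) \<Rightarrow> bool" where
  "is_norm_on n N \<longleftrightarrow>
     (\<forall>x\<in>carrier_vec n. 0 \<le> N x \<and> (N x = 0 \<longleftrightarrow> x = 0\<^sub>v n)) \<and>
     (\<forall>x\<in>carrier_vec n. \<forall>c. N (c \<cdot>\<^sub>v x) = \<bar>c\<bar> * N x) \<and>
     (\<forall>x\<in>carrier_vec n. \<forall>y\<in>carrier_vec n. N (x + y) \<le> N x + N y)"

definition unit_ball :: "nat \<Rightarrow> real vec set" where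
  "unit_ball n = {x \<in> carrier_vec n. sqrt (scalar_prod x x) \<le> 1}"

(* The law of n independent N(0,1) coordinates; for g drawn from it, vec n g is a standard
   Gaussian vector in R^n. *)
definition std_gaussian :: "nat \<Rightarrow> (nat \<Rightarrow> real) measure" where
  "std_gaussian n = PiM {..<n} (\<lambda>_. density lborel (\<lambda>t. ennreal (std_normal_density t)))"

definition kappa :: "nat \<Rightarrow> nat \<Rightarrow> (nat \<Rightarrow> real vec \<Rightarrow> real) \<Rightarrow> real" where
  "kappa n M N = (\<integral>g. Max ((\<lambda>j. N j (vec n g)) ` {1..M}) \<partial>std_gaussian n)"

definition lambda :: "nat \<Rightarrow> nat \<Rightarrow> (nat \<Rightarrow> real vec \<Rightarrow> real) \<Rightarrow> real" where
  "lambda n M N = Max ((\<lambda>j. sqrt (\<integral>g. (N j (vec n g))\<^sup>2 \<partial>std_gaussian n)) ` {1..M})"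

(* The joint law of independent uniform signs indexed by 1, ..., M; the 0 is only the value of
   the sign function outside this index set. *)
definition rademacher :: "nat \<Rightarrow> (nat \<Rightarrow> real) pmf" where
  "rademacher M = Pi_pmf {1..M} 0 (\<lambda>_. pmf_of_set {-1, 1})"

end

theory Submission
  imports Defs "HOL-Library.Function_Algebras"
begin

text \<open>
  Generic chaining with an interpolation step. A point \<open>x\<close> of \<open>T\<close> is encoded by a path of
  representatives at the scales \<open>s = 8\<^sup>-\<^sup>k\<close>, and \<open>N\<^sub>j(x)\<^sup>2\<close> is telescoped along the path.
  Representatives are produced by packing translates of sets of Gaussian measure at least \<open>1/2\<close>,
  as in the dual Sudakov inequality. The translates are not centred at \<open>x\<close> but at an almost
  shortest vector of a convex set of approximations of \<open>x\<close>; the parallelogram identity then makes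
  the squared displacements \<open>\<rho>\<^sup>2\<close> of consecutive centres telescope, so that the code length
  \<open>\<Sum> \<rho>\<^sup>2/s\<^sup>2\<close> is affordable although each \<open>\<rho>\<close> alone may be of order one.

  At scale \<open>s\<close> only the indices \<open>j\<close> with \<open>N\<^sub>j(x)\<close> above a multiple of \<open>\<kappa> s\<close> are resolved. For these
  the increments are controlled by the averages \<open>E N\<^sub>j(g)\<^sup>2\<close>, at a cost of order \<open>\<lambda>\<^sup>2\<close> for each
  of the \<open>log n\<close> scales above \<open>n\<^sup>-\<^sup>1\<^sup>/\<^sup>2\<close>. The indices that become visible from one scale to the next
  cost \<open>\<kappa>\<^sup>2\<close> in total, since their contributions to \<open>\<Sum> N\<^sub>j(x)\<^sup>2\<close> telescope. Below \<open>n\<^sup>-\<^sup>1\<^sup>/\<^sup>2\<close>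
  volumetric nets give a geometric series.
\<close>

subsection \<open>Gaussian packing\<close>

text \<open>The obstacle is the square root over log n. The increment of N_j^2 along a step x - y is
  about 2 N_j(x) N_j(x - y); for a Gaussian step of size s the sum over j of its squares has mean of
  order at most (\<lambda> S s)^2, with S the supremum on the right-hand side. This is why the noise
  set of x carries the weights N_j(x). A chaining that allows every scale the full code length 1/s^2
  pays \<lambda> S per scale and ends with \<lambda> log n. Here the union bound at scale s has the
  form a (squared increments) / s^2 + s^2 (code length) / a, with one a for all scales. The first
  terms add up to order a S^2 (\<lambda>^2 log n + \<kappa>^2). The telescoping of \<rho>^2 keeps
  the sum of s^2 times the code lengths below an absolute constant, so the second terms are O(1/a)
  however many scales there are. Choosing a once, after summation, produces S (\<lambda> sqrt(log n)
  + \<kappa>).\<close>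

lemma distr_PiM_componentwise:
  fixes M M' :: "'i \<Rightarrow> 'a measure"
  assumes "finite I" and M: "\<And>i. prob_space (M i)" and M': "\<And>i. prob_space (M' i)"
    and f: "\<And>i. f i \<in> measurable (M i) (M' i)" and distr: "\<And>i. distr (M i) (M' i) (f i) = M' i"
  shows "distr (PiM I M) (PiM I M') (\<lambda>x. \<lambda>i\<in>I. f i (x i)) = PiM I M'"
proof -
  interpret M: product_prob_space M I by (intro product_prob_spaceI M)
  interpret M': product_prob_space M' I by (intro product_prob_spaceI M')
  have meas[measurable]: "(\<lambda>x. \<lambda>i\<in>I. f i (x i)) \<in> measurable (PiM I M) (PiM I M')"
    using f by (auto intro!: measurable_restrict measurable_compose[OF measurable_component_singleton])
  show ?thesis
  proof (rule M'.PiM_eqI)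
    fix A assume A: "\<And>i. i \<in> I \<Longrightarrow> A i \<in> sets (M' i)"
    have "emeasure (distr (PiM I M) (PiM I M') (\<lambda>x. \<lambda>i\<in>I. f i (x i))) (Pi\<^sub>E I A)
        = emeasure (PiM I M) ((\<lambda>x. \<lambda>i\<in>I. f i (x i)) -` Pi\<^sub>E I A \<inter> space (PiM I M))"
      using A \<open>finite I\<close> by (intro emeasure_distr meas sets_PiM_I_finite) auto
    also have "(\<lambda>x. \<lambda>i\<in>I. f i (x i)) -` Pi\<^sub>E I A \<inter> space (PiM I M)
        = Pi\<^sub>E I (\<lambda>i. f i -` A i \<inter> space (M i))"
      by (auto simp: space_PiM PiE_def Pi_def)
    also have "emeasure (PiM I M) \<dots> = (\<Prod>i\<in>I. emeasure (M i) (f i -` A i \<inter> space (M i)))"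
      using A f \<open>finite I\<close> by (intro M.emeasure_PiM) (auto intro: measurable_sets)
    also have "\<dots> = (\<Prod>i\<in>I. emeasure (distr (M i) (M' i) (f i)) (A i))"
      using A f by (intro prod.cong refl emeasure_distr[symmetric]) auto
    finally show "emeasure (distr (PiM I M) (PiM I M') (\<lambda>x. \<lambda>i\<in>I. f i (x i))) (Pi\<^sub>E I A)
        = (\<Prod>i\<in>I. emeasure (M' i) (A i))"
      by (simp only: distr)
  qed (use \<open>finite I\<close> in simp_all)
qed

lemma density_PiM:
  assumes "finite I" and M: "\<And>i. prob_space (M i)"
    and f: "\<And>i. f i \<in> borel_measurable (M i)" and D: "\<And>i. prob_space (density (M i) (f i))"
  shows "density (PiM I M) (\<lambda>x. \<Prod>i\<in>I. f i (x i)) = PiM I (\<lambda>i. density (M i) (f i))"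
proof -
  interpret M: product_prob_space M I by (intro product_prob_spaceI M)
  interpret D: product_prob_space "\<lambda>i. density (M i) (f i)" I by (intro product_prob_spaceI D)
  have [measurable]: "(\<lambda>x. \<Prod>i\<in>I. f i (x i)) \<in> borel_measurable (PiM I M)"
    using f by (auto intro!: borel_measurable_prod_ennreal measurable_compose[OF measurable_component_singleton])
  show ?thesis
  proof (rule D.PiM_eqI)
    show "sets (density (PiM I M) (\<lambda>x. \<Prod>i\<in>I. f i (x i))) = sets (PiM I (\<lambda>i. density (M i) (f i)))"
      by (simp, intro sets_PiM_cong) auto
    fix A assume "\<And>i. i \<in> I \<Longrightarrow> A i \<in> sets (density (M i) (f i))"
    then have A: "\<And>i. i \<in> I \<Longrightarrow> A i \<in> sets (M i)" by simp
    have "emeasure (density (PiM I M) (\<lambda>x. \<Prod>i\<in>I. f i (x i))) (Pi\<^sub>E I A)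
        = (\<integral>\<^sup>+x. (\<Prod>i\<in>I. f i (x i)) * indicator (Pi\<^sub>E I A) x \<partial>PiM I M)"
      using A \<open>finite I\<close> by (intro emeasure_density) auto
    also have "\<dots> = (\<integral>\<^sup>+x. (\<Prod>i\<in>I. f i (x i) * indicator (A i) (x i)) \<partial>PiM I M)"
    proof (rule nn_integral_cong)
      fix x assume "x \<in> space (PiM I M)"
      then have "indicator (Pi\<^sub>E I A) x = (\<Prod>i\<in>I. indicator (A i) (x i) :: ennreal)"
        using \<open>finite I\<close> by (auto simp: indicator_def space_PiM PiE_def Pi_def prod_zero_iff)
      then show "(\<Prod>i\<in>I. f i (x i)) * indicator (Pi\<^sub>E I A) x = (\<Prod>i\<in>I. f i (x i) * indicator (A i) (x i))"
        by (simp add: prod.distrib)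
    qed
    also have "\<dots> = (\<Prod>i\<in>I. \<integral>\<^sup>+x. f i x * indicator (A i) x \<partial>M i)"
    proof -
      define g where "g i x = (if i \<in> I then f i x * indicator (A i) x else 0)" for i x
      have g: "g i \<in> borel_measurable (M i)" for i
        using A[of i] f[of i] by (cases "i \<in> I") (auto simp: g_def[abs_def])
      have "(\<integral>\<^sup>+x. (\<Prod>i\<in>I. g i (x i)) \<partial>PiM I M) = (\<Prod>i\<in>I. integral\<^sup>N (M i) (g i))"
        using \<open>finite I\<close> g by (rule M.product_nn_integral_prod)
      moreover have "integral\<^sup>N (M i) (g i) = (\<integral>\<^sup>+x. f i x * indicator (A i) x \<partial>M i)" if "i \<in> I" for i
        using that by (simp add: g_def[abs_def])
      ultimately show ?thesis by (simp add: g_def cong: prod.cong)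
    qed
    also have "\<dots> = (\<Prod>i\<in>I. emeasure (density (M i) (f i)) (A i))"
      using A f by (intro prod.cong refl emeasure_density[symmetric]) auto
    finally show "emeasure (density (PiM I M) (\<lambda>x. \<Prod>i\<in>I. f i (x i))) (Pi\<^sub>E I A)
        = (\<Prod>i\<in>I. emeasure (density (M i) (f i)) (A i))" .
  qed (use \<open>finite I\<close> in simp_all)
qed

definition gauss_measure :: "(nat \<Rightarrow> real) \<Rightarrow> real \<Rightarrow> nat \<Rightarrow> (nat \<Rightarrow> real) measure" where
  "gauss_measure m s n = PiM {..<n} (\<lambda>i. density lborel (normal_density (m i) s))"

lemma std_gaussian_eq: "std_gaussian n = gauss_measure 0 1 n"
  by (simp add: std_gaussian_def gauss_measure_def zero_fun_def)

lemma prob_space_gauss_measure: "s > 0 \<Longrightarrow> prob_space (gauss_measure m s n)"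
  unfolding gauss_measure_def by (intro prob_space_PiM prob_space_normal_density)

lemma sets_gauss_measure: "sets (gauss_measure m s n) = sets (std_gaussian n)"
  unfolding gauss_measure_def std_gaussian_def by (intro sets_PiM_cong) auto

lemma space_gauss_measure: "space (gauss_measure m s n) = extensional {..<n}"
  by (auto simp: gauss_measure_def space_PiM PiE_def)

lemma space_std_gaussian: "space (std_gaussian n) = extensional {..<n}"
  by (auto simp: std_gaussian_def space_PiM PiE_def)

text \<open>The condition on c covers translations and the reflection at once; both keep the
  standard deviation.\<close>

lemma distr_normal_affine:
  assumes "s > 0" "c\<^sup>2 = 1"
  shows "distr (density lborel (normal_density m s)) (density lborel (normal_density (b + c * m) s)) (\<lambda>t. b + c * t)
       = density lborel (normal_density (b + c * m) s)"
proof -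
  interpret prob_space "density lborel (normal_density m s)"
    using assms(1) by (rule prob_space_normal_density)
  have c: "\<bar>c\<bar> = 1" "c \<noteq> 0"
    using assms(2) by (auto simp: power2_eq_1_iff)
  have "distributed (density lborel (normal_density m s)) lborel (\<lambda>x. x) (normal_density m s)"
    by (auto simp: distributed_def distr_id2)
  from normal_density_affine[OF this assms(1) c(2), of b]
  have "distr (density lborel (normal_density m s)) lborel (\<lambda>t. b + c * t)
     = density lborel (normal_density (b + c * m) s)"
    by (simp add: distributed_def c)
  then show ?thesis
    by (metis (no_types, lifting) distr_cong sets_density)
qed

lemma gauss_measure_shift:
  assumes "s > 0"
  shows "distr (gauss_measure 0 s n) (gauss_measure (- h) s n) (\<lambda>x. \<lambda>i\<in>{..<n}. x i - h i)
       = gauss_measure (- h) s n"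
proof -
  have "distr (density lborel (normal_density 0 s)) (density lborel (normal_density (- h i) s)) (\<lambda>t. t - h i)
       = density lborel (normal_density (- h i) s)" for i
    using distr_normal_affine[OF assms, of 1 0 "- h i"] by simp
  then show ?thesis
    unfolding gauss_measure_def
    by (intro distr_PiM_componentwise[where f = "\<lambda>i t. t - h i", simplified] prob_space_normal_density assms)
       (auto simp: fun_Compl_def)
qed

lemma std_gaussian_reflect:
  "distr (std_gaussian n) (std_gaussian n) (\<lambda>x. \<lambda>i\<in>{..<n}. - x i) = std_gaussian n"
proof -
  have "distr (density lborel std_normal_density) (density lborel std_normal_density) uminus
       = density lborel std_normal_density"
    using distr_normal_affine[of 1 "-1" 0 0] by simp
  then show ?thesis
    unfolding std_gaussian_def
    by (intro distr_PiM_componentwise[where f = "\<lambda>i. uminus", simplified] prob_space_normal_density) auto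
qed

text \<open>Vectors are functions on \<open>nat\<close>, so that pointwise + and - are total and
  need no carrier condition; coordinates from n on are ignored.\<close>

definition nsq :: "nat \<Rightarrow> (nat \<Rightarrow> real) \<Rightarrow> real" where
  "nsq n x = (\<Sum>i<n. (x i)\<^sup>2)"

lemma nsq_nonneg [simp]: "0 \<le> nsq n x"
  by (simp add: nsq_def sum_nonneg)

text \<open>The density of \<open>N(-h, s\<^sup>2)\<close> with respect to \<open>N(0, 1)\<close> is at least
  \<open>s\<^sup>-\<^sup>1 exp (- h\<^sup>2/2s\<^sup>2 - th/s\<^sup>2)\<close> when \<open>s \<ge> 1\<close>; the linear term averages out over a symmetric set.\<close>

lemma gauss_measure_symmetric_lower:
  assumes s: "s \<ge> 1" and U: "U \<in> sets (std_gaussian n)"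
    and sym: "\<And>u. u \<in> U \<Longrightarrow> (\<lambda>i\<in>{..<n}. - u i) \<in> U"
  shows "exp (- nsq n h / (2 * s\<^sup>2)) / s ^ n * measure (std_gaussian n) U \<le> measure (gauss_measure (- h) s n) U"
proof -
  let ?\<gamma> = "std_gaussian n"
  have "s > 0" using s by simp
  interpret G: prob_space ?\<gamma>
    unfolding std_gaussian_eq by (rule prob_space_gauss_measure) simp
  interpret H: prob_space "gauss_measure (- h) s n"
    using \<open>s > 0\<close> by (rule prob_space_gauss_measure)
  define c where "c = exp (- nsq n h / (2 * s\<^sup>2)) / s ^ n"
  have "c > 0" using \<open>s > 0\<close> by (simp add: c_def)
  define \<rho> where "\<rho> i t = ennreal (normal_density (- h i) s t / std_normal_density t)" for i t
  have \<rho>_meas[measurable]: "\<rho> i \<in> borel_measurable borel" for i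
    unfolding \<rho>_def[abs_def] by measurable
  have dens1: "density (density lborel std_normal_density) (\<rho> i) = density lborel (normal_density (- h i) s)" for i
  proof -
    have "ennreal (std_normal_density t) * \<rho> i t = ennreal (normal_density (- h i) s t)" for t
      using normal_density_pos[of 1 0 t] normal_density_nonneg[of "- h i" s t]
      by (simp add: \<rho>_def ennreal_mult[symmetric] del: normal_density_nonneg)
    then show ?thesis
      by (subst density_density_eq) auto
  qed
  have dens: "gauss_measure (- h) s n = density ?\<gamma> (\<lambda>x. \<Prod>i<n. \<rho> i (x i))"
    unfolding std_gaussian_def gauss_measure_def
    by (subst density_PiM) (auto simp: dens1 fun_Compl_def \<rho>_def
          intro!: prob_space_normal_density \<open>s > 0\<close>)
  define L where "L x = (\<Sum>i<n. x i * h i) / s\<^sup>2" for x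
  have \<rho>_ge: "ennreal (exp (- (h i)\<^sup>2 / (2 * s\<^sup>2)) * exp (- (t * h i / s\<^sup>2)) / s) \<le> \<rho> i t" for i t
  proof -
    have eq: "normal_density (- h i) s t / std_normal_density t
        = exp (- (t + h i)\<^sup>2 / (2 * s\<^sup>2) + t\<^sup>2 / 2) / s"
    proof -
      define a b where "a = - (t + h i)\<^sup>2 / (2 * s\<^sup>2)" and "b = t\<^sup>2 / 2"
      have "- t\<^sup>2 / 2 = - b" by (simp add: b_def)
      then have "normal_density (- h i) s t / std_normal_density t
          = exp a / (sqrt (2 * pi) * s) / (exp (- b) / sqrt (2 * pi))"
        using \<open>s > 0\<close> by (simp add: normal_density_def real_sqrt_mult a_def)
      also have "\<dots> = exp (a + b) / s"
        using \<open>s > 0\<close> by (simp add: exp_add exp_minus field_simps)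
      finally show ?thesis by (simp add: a_def b_def)
    qed
    \<comment> \<open>Here s \<ge> 1 enters: widening the Gaussian only raises the quadratic part of
      the density ratio.\<close>
    have "t\<^sup>2 / (2 * s\<^sup>2) \<le> t\<^sup>2 / 2"
      using s by (intro divide_left_mono) (auto simp: power2_eq_square mult_mono' mult_ge1_I)
    moreover have "(t + h i)\<^sup>2 / (2 * s\<^sup>2) = t\<^sup>2 / (2 * s\<^sup>2) + t * h i / s\<^sup>2 + (h i)\<^sup>2 / (2 * s\<^sup>2)"
      using \<open>s > 0\<close> by (simp add: field_simps power2_eq_square)
    ultimately have "- (h i)\<^sup>2 / (2 * s\<^sup>2) + - (t * h i / s\<^sup>2) \<le> - (t + h i)\<^sup>2 / (2 * s\<^sup>2) + t\<^sup>2 / 2"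
      by simp
    then have "exp (- (h i)\<^sup>2 / (2 * s\<^sup>2) + - (t * h i / s\<^sup>2)) / s \<le> exp (- (t + h i)\<^sup>2 / (2 * s\<^sup>2) + t\<^sup>2 / 2) / s"
      using \<open>s > 0\<close> by (intro divide_right_mono) auto
    then show ?thesis
      unfolding \<rho>_def eq exp_add by (intro ennreal_leI) simp
  qed
  have prod_ge: "ennreal (c * exp (- L x)) \<le> (\<Prod>i<n. \<rho> i (x i))" for x
  proof -
    have "c * exp (- L x) = (\<Prod>i<n. exp (- (h i)\<^sup>2 / (2 * s\<^sup>2)) * exp (- (x i * h i / s\<^sup>2)) / s)"
      by (simp add: c_def L_def nsq_def prod.distrib prod_dividef exp_sum[symmetric] sum_negf sum_divide_distrib)
    then have "ennreal (c * exp (- L x)) = (\<Prod>i<n. ennreal (exp (- (h i)\<^sup>2 / (2 * s\<^sup>2)) * exp (- (x i * h i / s\<^sup>2)) / s))"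
      using \<open>s > 0\<close> by (simp only:, intro prod_ennreal[symmetric]) auto
    moreover have "(\<Prod>i<n. ennreal (exp (- (h i)\<^sup>2 / (2 * s\<^sup>2)) * exp (- (x i * h i / s\<^sup>2)) / s)) \<le> (\<Prod>i<n. \<rho> i (x i))"
      using \<rho>_ge by (induction n) (auto intro!: mult_mono)
    ultimately show ?thesis by simp
  qed
  have L_meas[measurable]: "L \<in> borel_measurable ?\<gamma>"
    unfolding L_def[abs_def] std_gaussian_def by measurable
  have U'[measurable]: "U \<in> sets ?\<gamma>" by fact
  have U_space: "U \<subseteq> extensional {..<n}"
    using sets.sets_into_space[OF U] by (simp add: space_std_gaussian)
  have reflect: "(\<lambda>x. \<lambda>i\<in>{..<n}. - x i) \<in> measurable ?\<gamma> ?\<gamma>"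
    unfolding std_gaussian_def by measurable
  have "(\<integral>\<^sup>+x. ennreal (exp (- L x)) * indicator U x \<partial>?\<gamma>)
      = (\<integral>\<^sup>+x. ennreal (exp (- L x)) * indicator U x \<partial>distr ?\<gamma> ?\<gamma> (\<lambda>x. \<lambda>i\<in>{..<n}. - x i))"
    by (simp only: std_gaussian_reflect)
  also have "\<dots> = (\<integral>\<^sup>+x. ennreal (exp (- L (\<lambda>i\<in>{..<n}. - x i))) * indicator U (\<lambda>i\<in>{..<n}. - x i) \<partial>?\<gamma>)"
    by (rule nn_integral_distr) (use reflect in auto)
  also have "\<dots> = (\<integral>\<^sup>+x. ennreal (exp (L x)) * indicator U x \<partial>?\<gamma>)"
  proof (rule nn_integral_cong)
    fix x assume "x \<in> space ?\<gamma>"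
    then have ext: "x \<in> extensional {..<n}" by (simp add: space_std_gaussian)
    have "(\<lambda>i\<in>{..<n}. - (\<lambda>i\<in>{..<n}. - x i) i) = x"
      using ext by (auto simp: extensional_def fun_eq_iff)
    then have "(\<lambda>i\<in>{..<n}. - x i) \<in> U \<longleftrightarrow> x \<in> U"
      using sym[of x] sym[of "\<lambda>i\<in>{..<n}. - x i"] by auto
    moreover have "L (\<lambda>i\<in>{..<n}. - x i) = - L x"
      by (simp add: L_def sum_negf)
    ultimately show "ennreal (exp (- L (\<lambda>i\<in>{..<n}. - x i))) * indicator U (\<lambda>i\<in>{..<n}. - x i)
        = ennreal (exp (L x)) * indicator U x"
      by (auto simp: indicator_def)
  qed
  finally have flip: "(\<integral>\<^sup>+x. ennreal (exp (- L x)) * indicator U x \<partial>?\<gamma>)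
      = (\<integral>\<^sup>+x. ennreal (exp (L x)) * indicator U x \<partial>?\<gamma>)" .
  \<comment> \<open>Averaging the integral with its reflection replaces exp (- L) by cosh L, which
    is at least 1.\<close>
  have "2 * emeasure ?\<gamma> U = (\<integral>\<^sup>+x. 2 * indicator U x \<partial>?\<gamma>)"
    by (simp add: nn_integral_cmult)
  also have "\<dots> \<le> (\<integral>\<^sup>+x. ennreal (exp (- L x)) * indicator U x + ennreal (exp (L x)) * indicator U x \<partial>?\<gamma>)"
  proof (rule nn_integral_mono)
    fix x
    have "2 \<le> exp (- L x) + exp (L x)"
      using exp_ge_add_one_self[of "L x"] exp_ge_add_one_self[of "- L x"] by linarith
    then have "ennreal 2 \<le> ennreal (exp (- L x)) + ennreal (exp (L x))"
      using ennreal_leI by (fastforce simp only: ennreal_plus[symmetric] exp_ge_zero)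
    then show "2 * indicator U x \<le> ennreal (exp (- L x)) * indicator U x + ennreal (exp (L x)) * indicator U x"
      by (auto simp: indicator_def)
  qed
  also have "\<dots> = 2 * (\<integral>\<^sup>+x. ennreal (exp (- L x)) * indicator U x \<partial>?\<gamma>)"
    by (subst nn_integral_add) (auto simp: flip mult_2)
  finally have "emeasure ?\<gamma> U \<le> (\<integral>\<^sup>+x. ennreal (exp (- L x)) * indicator U x \<partial>?\<gamma>)"
    by (simp add: ennreal_mult_le_mult_iff)
  then have "ennreal c * emeasure ?\<gamma> U \<le> ennreal c * (\<integral>\<^sup>+x. ennreal (exp (- L x)) * indicator U x \<partial>?\<gamma>)"
    by (rule mult_left_mono) simp
  also have "\<dots> = (\<integral>\<^sup>+x. ennreal (c * exp (- L x)) * indicator U x \<partial>?\<gamma>)"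
    using \<open>c > 0\<close> by (subst nn_integral_cmult[symmetric]) (auto simp: ennreal_mult mult.assoc)
  also have "\<dots> \<le> (\<integral>\<^sup>+x. (\<Prod>i<n. \<rho> i (x i)) * indicator U x \<partial>?\<gamma>)"
    by (intro nn_integral_mono mult_right_mono prod_ge) auto
  also have "\<dots> = emeasure (gauss_measure (- h) s n) U"
  proof -
    have "(\<lambda>x. \<Prod>i<n. \<rho> i (x i)) \<in> borel_measurable ?\<gamma>"
      unfolding std_gaussian_def by measurable
    then show ?thesis
      unfolding dens using U by (rule emeasure_density[symmetric])
  qed
  finally have "ennreal (c * measure ?\<gamma> U) \<le> ennreal (measure (gauss_measure (- h) s n) U)"
    using \<open>c > 0\<close> by (simp add: G.emeasure_eq_measure H.emeasure_eq_measure ennreal_mult)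
  then show ?thesis
    by (simp add: c_def ennreal_le_iff)
qed

text \<open>For \<open>s = 1\<close> this is the dual Sudakov bound; a larger \<open>s\<close>, the standard deviation of an auxiliary
  Gaussian vector, turns it into a volumetric bound.\<close>

lemma gaussian_packing:
  assumes s: "s \<ge> 1" and V: "finite V"
    and U: "\<And>v. v \<in> V \<Longrightarrow> U v \<inter> extensional {..<n} \<in> sets (std_gaussian n)"
    and prob: "\<And>v. v \<in> V \<Longrightarrow> 1/2 \<le> measure (std_gaussian n) (U v \<inter> extensional {..<n})"
    and sym: "\<And>v u. v \<in> V \<Longrightarrow> u \<in> U v \<Longrightarrow> - u \<in> U v"
    and restr: "\<And>v u. v \<in> V \<Longrightarrow> restrict u {..<n} \<in> U v \<longleftrightarrow> u \<in> U v"
    and disj: "\<And>v w g. v \<in> V \<Longrightarrow> w \<in> V \<Longrightarrow> v \<noteq> w \<Longrightarrow> g - h v \<in> U v \<Longrightarrow> g - h w \<in> U w \<Longrightarrow> False"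
  shows "(\<Sum>v\<in>V. exp (- nsq n (h v) / (2 * s\<^sup>2)) / 2) \<le> s ^ n"
proof -
  let ?\<nu> = "gauss_measure 0 s n"
  have "s > 0" using s by simp
  interpret P: prob_space ?\<nu> using \<open>s > 0\<close> by (rule prob_space_gauss_measure)
  define E where "E v = {g \<in> extensional {..<n}. g - h v \<in> U v}" for v
  have E: "E v \<in> sets ?\<nu> \<and> exp (- nsq n (h v) / (2 * s\<^sup>2)) / 2 \<le> measure ?\<nu> (E v) * s ^ n" if v: "v \<in> V" for v
  proof -
    let ?f = "\<lambda>x. \<lambda>i\<in>{..<n}. x i - h v i" and ?U = "U v \<inter> extensional {..<n}"
    have f: "?f \<in> measurable ?\<nu> (gauss_measure (- h v) s n)"
      unfolding gauss_measure_def by measurable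
    have U_sets: "?U \<in> sets (gauss_measure (- h v) s n)"
      using U[OF v] by (simp only: sets_gauss_measure)
    \<comment> \<open>The pointwise difference x - h v leaves the extensional functions;
      \<open>restr\<close> makes membership in U v insensitive to this.\<close>
    have "?f x \<in> ?U \<longleftrightarrow> x - h v \<in> U v" for x
      using restr[OF v, of "x - h v"] by (auto simp: fun_diff_def restrict_def extensional_def)
    then have E_eq: "E v = ?f -` ?U \<inter> space ?\<nu>"
      by (auto simp: E_def space_gauss_measure)
    have "measure ?\<nu> (E v) = measure (distr ?\<nu> (gauss_measure (- h v) s n) ?f) ?U"
      unfolding E_eq using f U_sets by (rule measure_distr[symmetric])
    also have "\<dots> = measure (gauss_measure (- h v) s n) ?U"
      by (simp only: gauss_measure_shift[OF \<open>s > 0\<close>])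
    also have "\<dots> \<ge> exp (- nsq n (h v) / (2 * s\<^sup>2)) / s ^ n * measure (std_gaussian n) ?U"
    proof (rule gauss_measure_symmetric_lower[OF s U[OF v]])
      fix u assume "u \<in> ?U"
      then have "- u \<in> U v" using sym[OF v] by auto
      then have "restrict (- u) {..<n} \<in> ?U" using restr[OF v] by auto
      then show "(\<lambda>i\<in>{..<n}. - u i) \<in> ?U" by (simp add: restrict_def cong: if_cong)
    qed
    also have "exp (- nsq n (h v) / (2 * s\<^sup>2)) / s ^ n * measure (std_gaussian n) ?U
        \<ge> exp (- nsq n (h v) / (2 * s\<^sup>2)) / s ^ n * (1/2)"
      using \<open>s > 0\<close> by (intro mult_left_mono prob v) auto
    finally have "exp (- nsq n (h v) / (2 * s\<^sup>2)) / s ^ n * (1/2) \<le> measure ?\<nu> (E v)" .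
    moreover have "E v \<in> sets ?\<nu>"
      unfolding E_eq using f U_sets by (rule measurable_sets)
    ultimately show ?thesis
      using \<open>s > 0\<close> by (simp add: field_simps)
  qed
  have "(\<Sum>v\<in>V. exp (- nsq n (h v) / (2 * s\<^sup>2)) / 2) \<le> (\<Sum>v\<in>V. measure ?\<nu> (E v) * s ^ n)"
    using E by (intro sum_mono) auto
  also have "\<dots> = measure ?\<nu> (\<Union>v\<in>V. E v) * s ^ n"
  proof -
    have "disjoint_family_on E V"
      using disj by (auto simp: disjoint_family_on_def E_def)
    then have "measure ?\<nu> (\<Union>v\<in>V. E v) = (\<Sum>v\<in>V. measure ?\<nu> (E v))"
      using E V by (intro P.finite_measure_finite_Union) auto
    then show ?thesis by (simp add: sum_distrib_right)
  qed
  also have "\<dots> \<le> 1 * s ^ n"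
    using \<open>s > 0\<close> by (intro mult_right_mono P.prob_le_1) auto
  finally show ?thesis by simp
qed

subsection \<open>Representatives and codes\<close>

lemma L2_set_le_scaled:
  assumes "finite B" "A \<subseteq> B" "\<And>j. j \<in> A \<Longrightarrow> 0 \<le> f j" "\<And>j. j \<in> A \<Longrightarrow> f j \<le> c * g j" "0 \<le> c" "L2_set g B \<le> b"
  shows "L2_set f A \<le> c * b"
proof -
  have "L2_set f A \<le> L2_set (\<lambda>j. c * g j) A"
    using assms by (intro L2_set_mono) auto
  also have "\<dots> = c * L2_set g A"
    using \<open>0 \<le> c\<close> by (simp add: L2_set_right_distrib)
  also have "\<dots> \<le> c * L2_set g B"
    unfolding L2_set_def using assms by (intro mult_left_mono real_sqrt_le_mono sum_mono2) auto
  also have "\<dots> \<le> c * b"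
    using assms by (intro mult_left_mono)
  finally show ?thesis .
qed

text \<open>Elements are inserted in order of increasing f, so a rejected x conflicts with some
  selected v that has f v \<le> f x. With f the squared distance to the previous centre, replacing a
  point by its representative never lengthens the code.\<close>

lemma exists_greedy_dominating_subset:
  fixes f :: "'a \<Rightarrow> real"
  assumes "finite P" and "\<And>x. x \<in> P \<Longrightarrow> t x x"
  shows "\<exists>V\<subseteq>P. (\<forall>v\<in>V. \<forall>w\<in>V. v \<noteq> w \<longrightarrow> \<not> (t v w \<and> t w v)) \<and> (\<forall>x\<in>P. \<exists>v\<in>V. t x v \<and> t v x \<and> f v \<le> f x)"
  using assms
proof (induction P rule: finite_ranking_induct[where f = f])
  case (insert x P)
  then obtain V where V: "V \<subseteq> P" "\<forall>v\<in>V. \<forall>w\<in>V. v \<noteq> w \<longrightarrow> \<not> (t v w \<and> t w v)"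
    "\<forall>x\<in>P. \<exists>v\<in>V. t x v \<and> t v x \<and> f v \<le> f x"
    by blast
  show ?case
  proof (cases "\<exists>v\<in>V. t x v \<and> t v x")
    case True
    then obtain v where v: "v \<in> V" "t x v" "t v x" by blast
    then have "f v \<le> f x" using V(1) insert.hyps by auto
    then show ?thesis using V v by (intro exI[of _ V]) auto
  next
    case False
    then show ?thesis using V insert.prems by (intro exI[of _ "insert x V"]) auto
  qed
qed simp

lemma nsq_midpoint:
  "nsq n (x - y) = 2 * nsq n x + 2 * nsq n y - 4 * nsq n (\<lambda>i. (x i + y i) / 2)"
  unfolding nsq_def sum_distrib_left sum.distrib[symmetric] sum_subtractf[symmetric]
  by (intro sum.cong refl) (simp add: power2_eq_square field_simps)

text \<open>\<kappa>, \<Lambda> and S are positive upper bounds, so degenerate values such as S = 0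
  are reached only in a limit. The noise set of x in \<open>noise_prob\<close> collects vectors u
  whose norms are O(\<kappa>) and for which the products N_j(u) N_j(x), the first-order size of the
  change of N_j^2 at x, are O(\<Lambda> S) in l2.\<close>

locale norm_family =
  fixes n :: nat and J :: "nat set" and N :: "nat \<Rightarrow> (nat \<Rightarrow> real) \<Rightarrow> real"
    and \<kappa> \<Lambda> S :: real and T :: "(nat \<Rightarrow> real) set"
  assumes n_pos: "n \<ge> 1" and fin_J: "finite J"
    and \<kappa>_pos: "\<kappa> > 0" and \<Lambda>_pos: "\<Lambda> > 0" and S_pos: "S > 0"
    and N_nonneg: "j \<in> J \<Longrightarrow> 0 \<le> N j x"
    and N_add: "j \<in> J \<Longrightarrow> N j (x + y) \<le> N j x + N j y"
    and N_scale: "j \<in> J \<Longrightarrow> N j (\<lambda>i. c * x i) = \<bar>c\<bar> * N j x"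
    and N_restrict: "j \<in> J \<Longrightarrow> N j (restrict x {..<n}) = N j x"
    and N_meas: "j \<in> J \<Longrightarrow> N j \<in> borel_measurable (std_gaussian n)"
    and T_ball: "x \<in> T \<Longrightarrow> nsq n x \<le> 1"
    and T_S: "x \<in> T \<Longrightarrow> L2_set (\<lambda>j. N j x) J \<le> S"
    and noise_prob: "x \<in> T \<Longrightarrow> 1/2 \<le> measure (std_gaussian n)
      ({u. (\<forall>j\<in>J. N j u \<le> 4 * \<kappa>) \<and> L2_set (\<lambda>j. N j u * N j x) J \<le> 2 * \<Lambda> * S} \<inter> extensional {..<n})"
begin

text \<open>Membership of u in y + s U, where U is the noise set of x. The shape depends on x while
  the centre y remains free.\<close>

definition in_noise :: "real \<Rightarrow> (nat \<Rightarrow> real) \<Rightarrow> (nat \<Rightarrow> real) \<Rightarrow> (nat \<Rightarrow> real) \<Rightarrow> bool" where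
  "in_noise s x y u \<longleftrightarrow> (\<forall>j\<in>J. N j (u - y) \<le> 4 * \<kappa> * s) \<and> L2_set (\<lambda>j. N j (u - y) * N j x) J \<le> 2 * \<Lambda> * S * s"

text \<open>The constants make two implications work: closeness at scale \<open>s\<close> implies
  \<open>feasible s x \<subseteq> feasible (64 s) y\<close>, and a common noise point at scale \<open>s\<close> implies closeness
  at scale \<open>s / 8\<close>.\<close>

definition feasible :: "real \<Rightarrow> (nat \<Rightarrow> real) \<Rightarrow> (nat \<Rightarrow> real) set" where
  "feasible s x = {y. (\<forall>j\<in>J. N j (y - x) \<le> 2 * \<kappa> * s) \<and>
     L2_set (\<lambda>j. N j (y - x) * N j x) {j\<in>J. 12 * \<kappa> * s \<le> N j x} \<le> 4 * \<Lambda> * S * s}"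

text \<open>The constants are read off at scale s/8 from the path x, y, u, y', x' of
  \<open>close_of_common_noise\<close>: 96 = 8 (2 + 4 + 4 + 2) and 192 = 8 * 2 (4 + 2 + 2 + 4), the
  extra 2 paying for an exchange of weights. The threshold 768 = 12 * 64 is that of
  \<open>feasible\<close> at scale 64 s. Taking \<open>max\<close> makes the relation
  symmetric.\<close>

definition close :: "real \<Rightarrow> (nat \<Rightarrow> real) \<Rightarrow> (nat \<Rightarrow> real) \<Rightarrow> bool" where
  "close s x y \<longleftrightarrow> (\<forall>j\<in>J. N j (x - y) \<le> 96 * \<kappa> * s) \<and>
     L2_set (\<lambda>j. N j (x - y) * max (N j x) (N j y)) {j\<in>J. 768 * \<kappa> * s \<le> max (N j x) (N j y)} \<le> 192 * \<Lambda> * S * s"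

definition min_nsq :: "real \<Rightarrow> (nat \<Rightarrow> real) \<Rightarrow> real" where
  "min_nsq s x = Inf (nsq n ` feasible s x)"

text \<open>The infimum is only approximated, which avoids any compactness argument. The slack is
  s^2 at scale 64 s, hence of the same order as the other errors in
  \<open>nsq_near_min_diff_le\<close>.\<close>

definition near_min :: "real \<Rightarrow> (nat \<Rightarrow> real) \<Rightarrow> (nat \<Rightarrow> real)" where
  "near_min s x = (SOME y. y \<in> feasible s x \<and> nsq n y \<le> min_nsq s x + (s / 64)\<^sup>2)"

text \<open>The summand of \<open>gaussian_packing\<close> for noise of size s, seen from the
  previous centre p. Minus its logarithm, \<rho>^2 / (2 s^2) + ln 2 with \<rho> the displacement of
  the centre, is the code length of one step.\<close>

definition step_weight :: "real \<Rightarrow> (nat \<Rightarrow> real) \<Rightarrow> (nat \<Rightarrow> real) \<Rightarrow> real" where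
  "step_weight s p v = exp (- nsq n (near_min s v - p) / (2 * s\<^sup>2)) / 2"

lemma N_minus: "j \<in> J \<Longrightarrow> N j (- x) = N j x"
  using N_scale[of j "-1" x] by (simp add: fun_Compl_def)

lemma N_zero [simp]: "j \<in> J \<Longrightarrow> N j 0 = 0"
  using N_scale[of j 0 0] by (simp add: zero_fun_def)

lemma N_diff_commute: "j \<in> J \<Longrightarrow> N j (x - y) = N j (y - x)"
  using N_minus[of j "x - y"] by simp

lemma N_triangle: "j \<in> J \<Longrightarrow> N j (x - z) \<le> N j (x - y) + N j (y - z)"
  using N_add[of j "x - y" "y - z"] by simp

lemma N_diff: "j \<in> J \<Longrightarrow> N j x \<le> N j (x - y) + N j y"
  using N_add[of j "x - y" y] by simp

lemma N_abs_diff: "j \<in> J \<Longrightarrow> \<bar>N j x - N j y\<bar> \<le> N j (x - y)"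
  using N_diff[of j x y] N_diff[of j y x] N_diff_commute[of j x y] by auto

text \<open>The substitution u = p + \<sigma> g reduces this to \<open>gaussian_packing\<close>.
  Since p is arbitrary, only the distances from the previous centre count, not those from the
  origin.\<close>

lemma noise_symmetric_packing:
  assumes s: "s \<ge> 1" and \<sigma>: "\<sigma> > 0" and V: "finite V" and c: "\<And>v. v \<in> V \<Longrightarrow> c v \<in> T"
    and disj: "\<And>v w u. v \<in> V \<Longrightarrow> w \<in> V \<Longrightarrow> v \<noteq> w \<Longrightarrow> in_noise \<sigma> (c v) (y v) u \<Longrightarrow> in_noise \<sigma> (c w) (y w) u \<Longrightarrow> False"
  shows "(\<Sum>v\<in>V. exp (- nsq n (y v - p) / (2 * (s * \<sigma>)\<^sup>2)) / 2) \<le> s ^ n"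
proof -
  define U where "U v = {u. (\<forall>j\<in>J. N j u \<le> 4 * \<kappa>) \<and> L2_set (\<lambda>j. N j u * N j (c v)) J \<le> 2 * \<Lambda> * S}" for v
  define h where "h v = (\<lambda>i. (y v i - p i) / \<sigma>)" for v
  have nsq_h: "nsq n (h v) = nsq n (y v - p) / \<sigma>\<^sup>2" for v
    by (simp add: nsq_def h_def power_divide sum_divide_distrib)
  have "(\<Sum>v\<in>V. exp (- nsq n (h v) / (2 * s\<^sup>2)) / 2) \<le> s ^ n"
  proof (rule gaussian_packing[where U = U, OF s V])
    fix v assume v: "v \<in> V"
    have [measurable]: "N j \<in> borel_measurable (std_gaussian n)" if "j \<in> J" for j
      using N_meas that .
    have "U v \<inter> extensional {..<n} = {u \<in> space (std_gaussian n).
        (\<forall>j\<in>J. N j u \<le> 4 * \<kappa>) \<and> L2_set (\<lambda>j. N j u * N j (c v)) J \<le> 2 * \<Lambda> * S}"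
      by (auto simp: U_def space_std_gaussian)
    also have "\<dots> \<in> sets (std_gaussian n)"
      unfolding L2_set_def using fin_J by measurable
    finally show "U v \<inter> extensional {..<n} \<in> sets (std_gaussian n)" .
    show "1/2 \<le> measure (std_gaussian n) (U v \<inter> extensional {..<n})"
      unfolding U_def using noise_prob[OF c[OF v]] .
    show "- u \<in> U v" if "u \<in> U v" for u
      using that by (simp add: U_def N_minus cong: L2_set_cong_simp)
    show "restrict u {..<n} \<in> U v \<longleftrightarrow> u \<in> U v" for u
      by (simp add: U_def N_restrict cong: L2_set_cong_simp)
  next
    fix v w g assume vw: "v \<in> V" "w \<in> V" "v \<noteq> w" and g: "g - h v \<in> U v" "g - h w \<in> U w"
    have in_noise: "in_noise \<sigma> (c z) (y z) (\<lambda>i. p i + \<sigma> * g i)" if "g - h z \<in> U z" for z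
    proof -
      have eq: "(\<lambda>i. p i + \<sigma> * g i) - y z = (\<lambda>i. \<sigma> * (g - h z) i)"
        using \<sigma> by (auto simp: h_def field_simps)
      have "N j ((\<lambda>i. p i + \<sigma> * g i) - y z) = \<sigma> * N j (g - h z)" if "j \<in> J" for j
        unfolding eq N_scale[OF that] using \<sigma> by (simp add: fun_diff_def)
      then show ?thesis
        using that \<sigma> by (simp add: in_noise_def U_def mult.assoc L2_set_right_distrib[symmetric] mult.commute[of _ \<sigma>] cong: L2_set_cong_simp)
    qed
    show False using disj[OF vw in_noise in_noise] g by blast
  qed
  then show ?thesis
    using \<sigma> s by (simp add: nsq_h power_mult_distrib mult_ac)
qed

text \<open>If N_j(x) exceeded 8 \<kappa>, the unit noise sets around -x, 0 and x would be disjoint,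
  and packing would give 1 + 2 exp (- 1/2) \<le> 2. This is false because exp (- 1/2) \<ge>
  9/16.\<close>

lemma N_le_\<kappa>:
  assumes "x \<in> T" "j \<in> J"
  shows "N j x \<le> 8 * \<kappa>"
proof (rule ccontr)
  assume gt: "\<not> N j x \<le> 8 * \<kappa>"
  let ?V = "{-1, 0, 1 :: int}"
  have "(\<Sum>v\<in>?V. exp (- nsq n ((\<lambda>i. real_of_int v * x i) - 0) / (2 * (1 * 1)\<^sup>2)) / 2) \<le> 1 ^ n"
  proof (rule noise_symmetric_packing[where c = "\<lambda>_. x"])
    fix v w :: int and u assume vw: "v \<in> ?V" "w \<in> ?V" "v \<noteq> w"
      and u: "in_noise 1 x (\<lambda>i. real_of_int v * x i) u" "in_noise 1 x (\<lambda>i. real_of_int w * x i) u"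
    have "N j (\<lambda>i. (real_of_int v - real_of_int w) * x i) = N j ((\<lambda>i. real_of_int v * x i) - (\<lambda>i. real_of_int w * x i))"
      by (simp add: left_diff_distrib fun_diff_def)
    also have "\<dots> \<le> N j ((\<lambda>i. real_of_int v * x i) - u) + N j (u - (\<lambda>i. real_of_int w * x i))"
      using assms(2) by (rule N_triangle)
    also have "\<dots> \<le> 4 * \<kappa> * 1 + 4 * \<kappa> * 1"
      using u assms(2) N_diff_commute[OF assms(2), of u "\<lambda>i. real_of_int v * x i"]
      unfolding in_noise_def by (intro add_mono) auto
    finally have "\<bar>real_of_int v - real_of_int w\<bar> * N j x \<le> 8 * \<kappa>"
      using N_scale[OF assms(2)] by simp
    moreover have "1 * N j x \<le> \<bar>real_of_int v - real_of_int w\<bar> * N j x"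
      using vw N_nonneg[OF assms(2)] by (intro mult_right_mono) auto
    ultimately show False using gt by linarith
  qed (use assms in auto)
  then have "1 + 2 * exp (- nsq n x / 2) \<le> 2"
    by (simp add: nsq_def)
  moreover have "exp (- nsq n x / 2) \<ge> exp (- 1 / 2)"
    using T_ball[OF assms(1)] by simp
  moreover have "exp (- 1 / 2 :: real) \<ge> (3 / 4)\<^sup>2"
  proof -
    have "exp (- 1 / 4 :: real) \<ge> 3 / 4"
      using exp_ge_add_one_self[of "- 1 / 4 :: real"] by simp
    then have "(3 / 4)\<^sup>2 \<le> (exp (- 1 / 4 :: real))\<^sup>2"
      by (intro power_mono) auto
    then show ?thesis by (simp add: exp_double[symmetric])
  qed
  ultimately show False unfolding power2_eq_square by linarith
qed

lemma close_sym: "close s x y \<Longrightarrow> close s y x"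
  by (simp add: close_def max.commute N_diff_commute[of _ x y] cong: L2_set_cong_simp conj_cong)

lemma close_mono:
  assumes "close s x y" "0 < s" "s \<le> s'"
  shows "close s' x y"
proof -
  have k: "c * \<kappa> * s \<le> c * \<kappa> * s'" if "c > 0" for c
    using assms \<kappa>_pos that by (intro mult_left_mono) auto
  have "L2_set (\<lambda>j. N j (x - y) * max (N j x) (N j y)) {j\<in>J. 768 * \<kappa> * s' \<le> max (N j x) (N j y)} \<le> 1 * (192 * \<Lambda> * S * s)"
    using assms(1) fin_J k[of 768] unfolding close_def
    by (intro L2_set_le_scaled[where c = 1 and b = "192 * \<Lambda> * S * s" and g = "\<lambda>j. N j (x - y) * max (N j x) (N j y)"
          and B = "{j\<in>J. 768 * \<kappa> * s \<le> max (N j x) (N j y)}"])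
       (auto intro!: mult_nonneg_nonneg N_nonneg simp: le_max_iff_disj simp del: max.bounded_iff)
  also have "\<dots> \<le> 192 * \<Lambda> * S * s'"
    using assms \<Lambda>_pos S_pos by (simp add: mult_left_mono)
  finally show ?thesis
    using assms k[of 96] by (fastforce simp: close_def)
qed

text \<open>An index visible for x' at scale 64 s has N_j(x') \<ge> 768 \<kappa> s, while N_j(x) and
  N_j(x') differ by at most 96 \<kappa> s. So it is visible for x at scale s, and the two weights
  agree up to a factor 2. The l2 bounds add up to 2 * 4 + 192 = 200, below 4 * 64 = 256.\<close>

lemma feasible_subset:
  assumes close: "close s x x'" and s: "s > 0"
  shows "feasible s x \<subseteq> feasible (64 * s) x'"
proof
  fix y assume y: "y \<in> feasible s x"
  have ks: "\<kappa> * s > 0" using \<kappa>_pos s by simp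
  have y1: "N j (y - x) \<le> 2 * (\<kappa> * s)" and x1: "N j (x - x') \<le> 96 * (\<kappa> * s)" if "j \<in> J" for j
    using y close that by (auto simp: feasible_def close_def mult.assoc)
  let ?A = "{j\<in>J. 12 * \<kappa> * (64 * s) \<le> N j x'}"
  have A: "12 * (\<kappa> * s) \<le> N j x \<and> N j x' \<le> 2 * N j x" if "j \<in> ?A" for j
    using that x1[of j] N_abs_diff[of j x x'] ks by auto
  have "L2_set (\<lambda>j. N j (y - x') * N j x') ?A
      \<le> L2_set (\<lambda>j. N j (y - x) * N j x' + N j (x - x') * N j x') ?A"
    by (intro L2_set_mono)
       (auto intro!: mult_nonneg_nonneg N_nonneg mult_right_mono N_triangle simp flip: distrib_right)
  also have "\<dots> \<le> L2_set (\<lambda>j. N j (y - x) * N j x') ?A + L2_set (\<lambda>j. N j (x - x') * N j x') ?A"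
    by (rule L2_set_triangle_ineq)
  also have "L2_set (\<lambda>j. N j (y - x) * N j x') ?A \<le> 2 * (4 * \<Lambda> * S * s)"
  proof (rule L2_set_le_scaled[where g = "\<lambda>j. N j (y - x) * N j x"])
    show "?A \<subseteq> {j\<in>J. 12 * \<kappa> * s \<le> N j x}"
      using A by (auto simp: mult.assoc)
    show "N j (y - x) * N j x' \<le> 2 * (N j (y - x) * N j x)" if "j \<in> ?A" for j
      using A[OF that] mult_left_mono[of "N j x'" "2 * N j x" "N j (y - x)"] that by (auto simp: N_nonneg)
  qed (use fin_J y in \<open>auto simp: feasible_def intro!: mult_nonneg_nonneg N_nonneg\<close>)
  also have "L2_set (\<lambda>j. N j (x - x') * N j x') ?A \<le> 1 * (192 * \<Lambda> * S * s)"
    by (rule L2_set_le_scaled[where g = "\<lambda>j. N j (x - x') * max (N j x) (N j x')"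
           and B = "{j\<in>J. 768 * \<kappa> * s \<le> max (N j x) (N j x')}"])
       (use fin_J close in \<open>auto simp: close_def le_max_iff_disj intro!: mult_nonneg_nonneg mult_left_mono N_nonneg\<close>)
  finally have "L2_set (\<lambda>j. N j (y - x') * N j x') ?A \<le> 200 * (\<Lambda> * S * s)"
    by (simp add: mult_ac)
  also have "\<dots> \<le> 4 * \<Lambda> * S * (64 * s)"
    using \<Lambda>_pos S_pos s by simp
  finally have "L2_set (\<lambda>j. N j (y - x') * N j x') ?A \<le> 4 * \<Lambda> * S * (64 * s)" .
  moreover have "N j (y - x') \<le> 2 * \<kappa> * (64 * s)" if "j \<in> J" for j
    using y1[OF that] x1[OF that] N_triangle[OF that, of y x' x] ks by simp
  ultimately show "y \<in> feasible (64 * s) x'" by (simp add: feasible_def)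
qed

text \<open>The triangle inequality runs through x, y, u, y', x'. Above the threshold 96 \<kappa> s
  the values N_j(x) and N_j(x') are comparable, because they differ by at most 12 \<kappa> s; so
  each leg may be measured with the weight in which it is controlled.\<close>

lemma close_of_common_noise:
  assumes y: "y \<in> feasible s x" and y': "y' \<in> feasible s x'" and s: "s > 0"
    and u: "in_noise s x y u" and u': "in_noise s x' y' u"
  shows "close (s / 8) x x'"
proof -
  have ks: "\<kappa> * s > 0" using \<kappa>_pos s by simp
  have b: "N j (y - x) \<le> 2 * (\<kappa> * s)" "N j (u - y) \<le> 4 * (\<kappa> * s)"
    "N j (u - y') \<le> 4 * (\<kappa> * s)" "N j (y' - x') \<le> 2 * (\<kappa> * s)" if "j \<in> J" for j
    using y y' u u' that by (auto simp: feasible_def in_noise_def mult.assoc)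
  have tri: "N j (x - x') \<le> N j (y - x) + N j (u - y) + N j (u - y') + N j (y' - x')" if "j \<in> J" for j
    using N_triangle[OF that, of x x' y] N_triangle[OF that, of y x' u] N_triangle[OF that, of u x' y']
      N_diff_commute[OF that, of x y] N_diff_commute[OF that, of y u] by simp
  have close: "N j (x - x') \<le> 12 * (\<kappa> * s)" if "j \<in> J" for j
    using tri[OF that] b[OF that] by simp
  let ?A = "{j\<in>J. 768 * \<kappa> * (s / 8) \<le> max (N j x) (N j x')}"
  let ?M = "\<lambda>j. max (N j x) (N j x')"
  have A: "j \<in> J \<and> 12 * (\<kappa> * s) \<le> N j x \<and> 12 * (\<kappa> * s) \<le> N j x' \<and> ?M j \<le> 2 * N j x \<and> ?M j \<le> 2 * N j x'"
    if "j \<in> ?A" for j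
    using that close[of j] N_abs_diff[of j x x'] ks by (auto simp: max_def split: if_splits)
  have sub: "?A \<subseteq> {j\<in>J. 12 * \<kappa> * s \<le> N j x}" "?A \<subseteq> {j\<in>J. 12 * \<kappa> * s \<le> N j x'}"
    using A by (auto simp: mult.assoc)
  have M0: "0 \<le> ?M j" if "j \<in> J" for j
    using N_nonneg[OF that] by (simp add: le_max_iff_disj)
  have scale: "N j z * ?M j \<le> 2 * (N j z * N j x)" "N j z * ?M j \<le> 2 * (N j z * N j x')" if "j \<in> ?A" for j z
    using A[OF that] mult_left_mono[of "?M j" "2 * N j x" "N j z"] mult_left_mono[of "?M j" "2 * N j x'" "N j z"]
    by (auto simp: N_nonneg)
  have "L2_set (\<lambda>j. N j (x - x') * ?M j) ?A
     \<le> L2_set (\<lambda>j. (N j (y - x) * ?M j + N j (u - y) * ?M j) + (N j (u - y') * ?M j + N j (y' - x') * ?M j)) ?A"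
  proof (intro L2_set_mono)
    fix j assume "j \<in> ?A"
    then have j: "j \<in> J" by simp
    show "N j (x - x') * ?M j \<le> (N j (y - x) * ?M j + N j (u - y) * ?M j) + (N j (u - y') * ?M j + N j (y' - x') * ?M j)"
      using mult_right_mono[OF tri[OF j] M0[OF j]] by (simp add: distrib_right)
  qed (auto intro!: mult_nonneg_nonneg N_nonneg M0)
  also have "\<dots> \<le> (L2_set (\<lambda>j. N j (y - x) * ?M j) ?A + L2_set (\<lambda>j. N j (u - y) * ?M j) ?A)
      + (L2_set (\<lambda>j. N j (u - y') * ?M j) ?A + L2_set (\<lambda>j. N j (y' - x') * ?M j) ?A)"
    by (intro order_trans[OF L2_set_triangle_ineq] add_mono L2_set_triangle_ineq)
  also have "L2_set (\<lambda>j. N j (y - x) * ?M j) ?A \<le> 2 * (4 * \<Lambda> * S * s)"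
    by (rule L2_set_le_scaled[where g = "\<lambda>j. N j (y - x) * N j x", OF _ sub(1) _ scale(1)])
       (use y fin_J in \<open>auto simp: feasible_def intro!: mult_nonneg_nonneg N_nonneg M0\<close>)
  also have "L2_set (\<lambda>j. N j (y' - x') * ?M j) ?A \<le> 2 * (4 * \<Lambda> * S * s)"
    by (rule L2_set_le_scaled[where g = "\<lambda>j. N j (y' - x') * N j x'", OF _ sub(2) _ scale(2)])
       (use y' fin_J in \<open>auto simp: feasible_def intro!: mult_nonneg_nonneg N_nonneg M0\<close>)
  also have "L2_set (\<lambda>j. N j (u - y) * ?M j) ?A \<le> 2 * (2 * \<Lambda> * S * s)"
    by (rule L2_set_le_scaled[where g = "\<lambda>j. N j (u - y) * N j x" and B = J, OF _ _ _ scale(1)])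
       (use u fin_J in \<open>auto simp: in_noise_def intro!: mult_nonneg_nonneg N_nonneg M0\<close>)
  also have "L2_set (\<lambda>j. N j (u - y') * ?M j) ?A \<le> 2 * (2 * \<Lambda> * S * s)"
    by (rule L2_set_le_scaled[where g = "\<lambda>j. N j (u - y') * N j x'" and B = J, OF _ _ _ scale(2)])
       (use u' fin_J in \<open>auto simp: in_noise_def intro!: mult_nonneg_nonneg N_nonneg M0\<close>)
  finally have "L2_set (\<lambda>j. N j (x - x') * ?M j) ?A \<le> 192 * \<Lambda> * S * (s / 8)"
    by simp
  then show ?thesis
    using close by (simp add: close_def mult.assoc)
qed

lemma self_in_feasible: "s > 0 \<Longrightarrow> x \<in> feasible s x"
  using \<kappa>_pos \<Lambda>_pos S_pos fin_J by (auto simp: feasible_def L2_set_def)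

lemma feasible_midpoint:
  assumes "y \<in> feasible s x" "z \<in> feasible s x"
  shows "(\<lambda>i. (y i + z i) / 2) \<in> feasible s x"
proof -
  have mid: "N j ((\<lambda>i. (y i + z i) / 2) - x) \<le> (N j (y - x) + N j (z - x)) / 2" if "j \<in> J" for j
  proof -
    have "(\<lambda>i. (y i + z i) / 2) - x = (\<lambda>i. (1/2) * ((y - x) + (z - x)) i)"
      by (auto simp: field_simps)
    then have "N j ((\<lambda>i. (y i + z i) / 2) - x) = (1/2) * N j ((y - x) + (z - x))"
      by (simp only: N_scale[OF that] abs_divide abs_one abs_numeral)
    also have "\<dots> \<le> (1/2) * (N j (y - x) + N j (z - x))"
      using that by (intro mult_left_mono N_add) auto
    finally show ?thesis by simp
  qed
  let ?A = "{j\<in>J. 12 * \<kappa> * s \<le> N j x}"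
  have "L2_set (\<lambda>j. N j ((\<lambda>i. (y i + z i) / 2) - x) * N j x) ?A
     \<le> L2_set (\<lambda>j. (1/2) * (N j (y - x) * N j x) + (1/2) * (N j (z - x) * N j x)) ?A"
  proof (intro L2_set_mono)
    fix j assume "j \<in> ?A"
    then have j: "j \<in> J" by simp
    show "N j ((\<lambda>i. (y i + z i) / 2) - x) * N j x \<le> (1/2) * (N j (y - x) * N j x) + (1/2) * (N j (z - x) * N j x)"
      using mult_right_mono[OF mid[OF j] N_nonneg[OF j, of x]] by (simp add: algebra_simps)
  qed (auto intro!: mult_nonneg_nonneg N_nonneg)
  also have "\<dots> \<le> L2_set (\<lambda>j. (1/2) * (N j (y - x) * N j x)) ?A + L2_set (\<lambda>j. (1/2) * (N j (z - x) * N j x)) ?A"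
    by (rule L2_set_triangle_ineq)
  also have "\<dots> = (1/2) * L2_set (\<lambda>j. N j (y - x) * N j x) ?A + (1/2) * L2_set (\<lambda>j. N j (z - x) * N j x) ?A"
    by (simp only: L2_set_right_distrib[of "1/2"])
  also have "\<dots> \<le> 4 * \<Lambda> * S * s"
    using assms by (simp add: feasible_def)
  finally show ?thesis
    using assms mid by (fastforce simp: feasible_def)
qed

lemma min_nsq_le: "y \<in> feasible s x \<Longrightarrow> min_nsq s x \<le> nsq n y"
  unfolding min_nsq_def by (intro cInf_lower bdd_belowI[of _ 0]) auto

lemma near_min_spec:
  assumes "s > 0"
  shows "near_min s x \<in> feasible s x \<and> nsq n (near_min s x) \<le> min_nsq s x + (s / 64)\<^sup>2"
proof -
  have "nsq n ` feasible s x \<noteq> {}" using self_in_feasible[OF assms] by auto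
  moreover have "Inf (nsq n ` feasible s x) < min_nsq s x + (s / 64)\<^sup>2"
    using assms by (simp add: min_nsq_def)
  ultimately have "\<exists>w\<in>nsq n ` feasible s x. w < min_nsq s x + (s / 64)\<^sup>2"
    by (rule cInf_lessD)
  then obtain y where "y \<in> feasible s x" "nsq n y < min_nsq s x + (s / 64)\<^sup>2"
    by auto
  then show ?thesis
    unfolding near_min_def by (intro someI[where x = y and P = "\<lambda>y. y \<in> feasible s x \<and> nsq n y \<le> min_nsq s x + (s / 64)\<^sup>2"]) simp
qed

lemma min_nsq_nonneg: "s > 0 \<Longrightarrow> 0 \<le> min_nsq s x"
  unfolding min_nsq_def using self_in_feasible[of s x] by (intro cInf_greatest) auto

lemma min_nsq_le_1: "s > 0 \<Longrightarrow> x \<in> T \<Longrightarrow> min_nsq s x \<le> 1"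
  using min_nsq_le[OF self_in_feasible] T_ball[of x] by (meson order_trans)

text \<open>By \<open>N_le_\<kappa>\<close>, from scale 4 on the origin itself approximates every
  point. This is where the telescoping sum of displacements starts.\<close>

lemma min_nsq_eq_0:
  assumes "s \<ge> 4" "x \<in> T"
  shows "min_nsq s x = 0"
proof -
  have "8 * \<kappa> \<le> 2 * \<kappa> * s" "8 * \<kappa> < 12 * \<kappa> * s"
    using assms(1) \<kappa>_pos mult_left_mono[of 4 s \<kappa>] by auto
  then have "N j x \<le> 2 * \<kappa> * s \<and> N j x < 12 * \<kappa> * s" if "j \<in> J" for j
    using N_le_\<kappa>[OF assms(2) that] by simp
  moreover from this have empty: "{j\<in>J. 12 * \<kappa> * s \<le> N j x} = {}"
    by (auto simp: not_le)
  ultimately have "0 \<in> feasible s x"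
    using assms(1) \<Lambda>_pos S_pos unfolding feasible_def mem_Collect_eq empty by (simp add: N_minus)
  then have "min_nsq s x \<le> nsq n 0" by (rule min_nsq_le)
  then show ?thesis
    using min_nsq_nonneg[of s x] assms(1) by (simp add: nsq_def)
qed

lemma min_nsq_mono:
  assumes "close s x x'" "s > 0"
  shows "min_nsq (64 * s) x' \<le> min_nsq s x"
  unfolding min_nsq_def using feasible_subset[OF assms] self_in_feasible[OF assms(2)]
  by (intro cInf_superset_mono image_mono bdd_belowI[of _ 0]) auto

text \<open>Midpoint convexity of the squared Euclidean norm on the nested sets
  \<open>feasible s x \<subseteq> feasible (64 s) x' \<subseteq> feasible (4096 s) x\<close>; summed over scales the bound telescopes.\<close>

lemma nsq_near_min_diff_le:
  assumes close: "close s x x'" and s: "s > 0"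
  shows "nsq n (near_min s x - near_min (64 * s) x') \<le> 2 * (min_nsq s x - min_nsq (4096 * s) x) + 5 * s\<^sup>2"
proof -
  let ?y = "near_min s x" and ?z = "near_min (64 * s) x'"
  have y: "?y \<in> feasible s x" "nsq n ?y \<le> min_nsq s x + (s / 64)\<^sup>2"
    using near_min_spec[OF s] by auto
  have z: "?z \<in> feasible (64 * s) x'" "nsq n ?z \<le> min_nsq (64 * s) x' + s\<^sup>2"
    using near_min_spec[of "64 * s" x'] s by auto
  have "(\<lambda>i. (?y i + ?z i) / 2) \<in> feasible (64 * s) x'"
    using feasible_subset[OF close s] y z by (intro feasible_midpoint) auto
  then have "min_nsq (64 * s) x' \<le> nsq n (\<lambda>i. (?y i + ?z i) / 2)"
    by (rule min_nsq_le)
  then have le: "nsq n (?y - ?z) \<le> 2 * (min_nsq s x + (s / 64)\<^sup>2) + 2 * (min_nsq (64 * s) x' + s\<^sup>2) - 4 * min_nsq (64 * s) x'"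
  proof -
    have "2 * p + 2 * q - 4 * r \<le> 2 * a + 2 * b - 4 * c" if "c \<le> r" "p \<le> a" "q \<le> b" for p q r a b c :: real
      using that by linarith
    from this[OF \<open>min_nsq (64 * s) x' \<le> _\<close> y(2) z(2)] show ?thesis
      unfolding nsq_midpoint .
  qed
  \<comment> \<open>This eliminates x', which changes with the scale: only values of
    \<open>min_nsq\<close> at one fixed point x can telescope.\<close>
  have mono: "min_nsq (4096 * s) x \<le> min_nsq (64 * s) x'"
    using min_nsq_mono[of "64 * s" x' x] close_sym[OF close_mono[OF close, of "64 * s"]] s by simp
  have "p \<le> 2 * (a - c) + 5 * q"
    if "p \<le> 2 * (a + q / 4096) + 2 * (b + q) - 4 * b" "c \<le> b" "0 \<le> q" for p q a b c :: real
    using that by argo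
  from this[OF _ mono zero_le_power2, of _ "min_nsq s x" s] le show ?thesis
    by (simp only: power_divide) simp
qed

lemma in_noise_self: "s > 0 \<Longrightarrow> in_noise s x y y"
  using \<kappa>_pos \<Lambda>_pos S_pos by (auto simp: in_noise_def L2_set_def)

text \<open>Two points conflict when their noise sets meet. Selected points do not conflict, so
  packing bounds the sum of their weights; every other point conflicts with its representative, and
  a common noise point makes the two close. The greedy order gives the comparison of
  weights.\<close>

lemma exists_code_step:
  assumes P: "finite P" "P \<subseteq> T" and s: "s > 0"
  shows "\<exists>r. (\<forall>x\<in>P. r x \<in> P \<and> close (s / 8) x (r x) \<and> step_weight s p x \<le> step_weight s p (r x)) \<and> (\<Sum>v\<in>r ` P. step_weight s p v) \<le> 1"
proof -
  define t where "t x v \<longleftrightarrow> (\<exists>u. in_noise s x (near_min s x) u \<and> in_noise s v (near_min s v) u)" for x v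
  have t_sym: "t x v \<longleftrightarrow> t v x" for x v by (auto simp: t_def)
  have "\<exists>V\<subseteq>P. (\<forall>v\<in>V. \<forall>w\<in>V. v \<noteq> w \<longrightarrow> \<not> (t v w \<and> t w v)) \<and>
      (\<forall>x\<in>P. \<exists>v\<in>V. t x v \<and> t v x \<and> nsq n (near_min s v - p) \<le> nsq n (near_min s x - p))"
    using P in_noise_self[OF s] by (intro exists_greedy_dominating_subset) (auto simp: t_def)
  then obtain V where V: "V \<subseteq> P" and disj: "\<forall>v\<in>V. \<forall>w\<in>V. v \<noteq> w \<longrightarrow> \<not> t v w"
    and dom: "\<forall>x\<in>P. \<exists>v\<in>V. t x v \<and> nsq n (near_min s v - p) \<le> nsq n (near_min s x - p)"
    using t_sym by meson
  have fV: "finite V" using P V finite_subset by blast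
  have "\<exists>r. \<forall>x\<in>P. r x \<in> V \<and> t x (r x) \<and> nsq n (near_min s (r x) - p) \<le> nsq n (near_min s x - p)"
    using dom unfolding Bex_def by (rule bchoice)
  then obtain r where r: "\<forall>x\<in>P. r x \<in> V \<and> t x (r x) \<and> nsq n (near_min s (r x) - p) \<le> nsq n (near_min s x - p)" ..
  have "(\<Sum>v\<in>V. exp (- nsq n (near_min s v - p) / (2 * (1 * s)\<^sup>2)) / 2) \<le> 1 ^ n"
  proof (rule noise_symmetric_packing[where c = "\<lambda>v. v" and y = "near_min s" and p = p])
    show "v \<in> T" if "v \<in> V" for v
      using that V P by blast
    fix v w u assume "v \<in> V" "w \<in> V" "v \<noteq> w" "in_noise s v (near_min s v) u" "in_noise s w (near_min s w) u"
    then show False using disj unfolding t_def by blast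
  qed (use s fV in auto)
  then have "(\<Sum>v\<in>V. step_weight s p v) \<le> 1" by (simp add: step_weight_def)
  moreover have "(\<Sum>v\<in>r ` P. step_weight s p v) \<le> (\<Sum>v\<in>V. step_weight s p v)"
    using r fV by (intro sum_mono2) (auto simp: step_weight_def)
  moreover have "close (s / 8) x (r x)" if x: "x \<in> P" for x
  proof -
    obtain u where "in_noise s x (near_min s x) u" "in_noise s (r x) (near_min s (r x)) u"
      using bspec[OF r x] unfolding t_def by blast
    then show ?thesis
      using s near_min_spec[OF s] by (intro close_of_common_noise[of "near_min s x" s x "near_min s (r x)" "r x" u]) auto
  qed
  moreover have "step_weight s p x \<le> step_weight s p (r x)" if "x \<in> P" for x
    using bspec[OF r that] s by (auto simp: step_weight_def intro!: divide_right_mono)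
  ultimately show ?thesis using r V by (intro exI[of _ r]) auto
qed

end

section \<open>Volumetric nets, codes and their lengths\<close>

context norm_family
begin

lemma close_refl: "s > 0 \<Longrightarrow> close s x x"
  using \<kappa>_pos \<Lambda>_pos S_pos by (auto simp: close_def L2_set_def)

lemma min_nsq_diff_nonneg: "s > 0 \<Longrightarrow> min_nsq (4096 * s) x \<le> min_nsq s x"
  using min_nsq_mono[OF close_refl, of s x] min_nsq_mono[OF close_refl, of "64 * s" x] by simp

text \<open>A family with disjoint noise sets of size \<tau> has bounded cardinality, since points
  of the ball all have weight at least exp (- 1 / (2 (s \<tau>)^2)) / 2; hence one of largest
  cardinality exists. The noise set of any further x in T meets that of some v, which puts x within
  4 \<kappa> \<tau> + 4 \<kappa> \<tau> of v.\<close>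

lemma exists_net:
  assumes s: "s \<ge> 1" and \<tau>: "\<tau> > 0"
  shows "\<exists>V. finite V \<and> V \<subseteq> T \<and> real (card V) * exp (- 1 / (2 * (s * \<tau>)\<^sup>2)) \<le> 2 * s ^ n
    \<and> (\<forall>x\<in>T. \<exists>v\<in>V. \<forall>j\<in>J. N j (x - v) \<le> 8 * \<kappa> * \<tau>)"
proof -
  define sep where "sep V \<longleftrightarrow> finite V \<and> V \<subseteq> T \<and> (\<forall>v\<in>V. \<forall>w\<in>V. v \<noteq> w \<longrightarrow> \<not> (\<exists>u. in_noise \<tau> v v u \<and> in_noise \<tau> w w u))" for V
  have bound: "real (card V) * exp (- 1 / (2 * (s * \<tau>)\<^sup>2)) \<le> 2 * s ^ n" if "sep V" for V
  proof -
    have "(\<Sum>v\<in>V. exp (- nsq n (v - 0) / (2 * (s * \<tau>)\<^sup>2)) / 2) \<le> s ^ n"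
    proof (rule noise_symmetric_packing[where c = "\<lambda>v. v" and y = "\<lambda>v. v" and p = 0])
      fix v w u assume "v \<in> V" "w \<in> V" "v \<noteq> w" "in_noise \<tau> v v u" "in_noise \<tau> w w u"
      then show False using that unfolding sep_def by blast
    qed (use that s \<tau> in \<open>auto simp: sep_def\<close>)
    moreover have "(\<Sum>v\<in>V. exp (- 1 / (2 * (s * \<tau>)\<^sup>2)) / 2) \<le> (\<Sum>v\<in>V. exp (- nsq n (v - 0) / (2 * (s * \<tau>)\<^sup>2)) / 2)"
    proof (rule sum_mono)
      fix v assume "v \<in> V"
      then have "nsq n v \<le> 1" using that T_ball by (auto simp: sep_def)
      then have "nsq n v / (2 * (s * \<tau>)\<^sup>2) \<le> 1 / (2 * (s * \<tau>)\<^sup>2)"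
        by (intro divide_right_mono) auto
      then show "exp (- 1 / (2 * (s * \<tau>)\<^sup>2)) / 2 \<le> exp (- nsq n (v - 0) / (2 * (s * \<tau>)\<^sup>2)) / 2"
        by simp
    qed
    ultimately show ?thesis by simp
  qed
  define e where "e = exp (- 1 / (2 * (s * \<tau>)\<^sup>2))"
  have "sep {}" by (simp add: sep_def)
  moreover have "\<forall>V. sep V \<longrightarrow> card V < nat \<lceil>2 * s ^ n / e\<rceil> + 1"
  proof (intro allI impI)
    fix V assume "sep V"
    then have "real (card V) \<le> 2 * s ^ n / e"
      using bound by (simp add: e_def field_simps)
    then show "card V < nat \<lceil>2 * s ^ n / e\<rceil> + 1" by linarith
  qed
  ultimately have "\<exists>V. sep V \<and> (\<forall>V'. sep V' \<longrightarrow> card V' \<le> card V)"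
    by (rule ex_has_greatest_nat)
  then obtain V where V: "sep V" and maxV: "\<And>V'. sep V' \<Longrightarrow> card V' \<le> card V"
    by blast
  have "\<exists>v\<in>V. \<forall>j\<in>J. N j (x - v) \<le> 8 * \<kappa> * \<tau>" if x: "x \<in> T" for x
  proof (cases "x \<in> V")
    case True
    then show ?thesis using \<kappa>_pos \<tau> by (intro bexI[of _ x]) auto
  next
    case False
    then have not_sep: "\<not> sep (insert x V)"
    proof -
      have "finite V" using V by (simp add: sep_def)
      then show ?thesis using maxV[of "insert x V"] False by auto
    qed
    have "\<exists>v\<in>V. \<exists>u. in_noise \<tau> v v u \<and> in_noise \<tau> x x u"
    proof (rule ccontr)
      assume "\<not> (\<exists>v\<in>V. \<exists>u. in_noise \<tau> v v u \<and> in_noise \<tau> x x u)"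
      then have "sep (insert x V)"
        using V x unfolding sep_def by blast
      then show False using not_sep by blast
    qed
    then obtain v u where v: "v \<in> V" and u: "in_noise \<tau> v v u" "in_noise \<tau> x x u"
      by blast
    have "N j (x - v) \<le> 8 * \<kappa> * \<tau>" if j: "j \<in> J" for j
    proof -
      have "N j (u - v) \<le> 4 * \<kappa> * \<tau>" "N j (u - x) \<le> 4 * \<kappa> * \<tau>"
        using u j by (auto simp: in_noise_def)
      then show ?thesis
        using N_triangle[OF j, of x v u] N_diff_commute[OF j, of x u] by simp
    qed
    then show ?thesis using v by blast
  qed
  then show ?thesis using V bound[OF V] by (intro exI[of _ V]) (auto simp: sep_def)
qed

text \<open>One fixed selection per cell: all members of a cell must use the same one, otherwise the
  extensions of a path need not have total weight at most 1.\<close>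

definition representative :: "(nat \<Rightarrow> real) set \<Rightarrow> real \<Rightarrow> (nat \<Rightarrow> real) \<Rightarrow> (nat \<Rightarrow> real) \<Rightarrow> (nat \<Rightarrow> real)" where
  "representative P s p = (SOME r. (\<forall>x\<in>P. r x \<in> P \<and> close (s / 8) x (r x) \<and> step_weight s p x \<le> step_weight s p (r x)) \<and> (\<Sum>v\<in>r ` P. step_weight s p v) \<le> 1)"

lemma representative_spec:
  assumes "finite P" "P \<subseteq> T" "s > 0"
  shows "\<And>x. x \<in> P \<Longrightarrow> representative P s p x \<in> P" "\<And>x. x \<in> P \<Longrightarrow> close (s / 8) x (representative P s p x)"
    "\<And>x. x \<in> P \<Longrightarrow> step_weight s p x \<le> step_weight s p (representative P s p x)" "(\<Sum>v\<in>representative P s p ` P. step_weight s p v) \<le> 1"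
  using someI_ex[OF exists_code_step[OF assms, of p]] unfolding representative_def[symmetric] by auto

definition level :: "nat \<Rightarrow> real" where "level k = (1 / 8) ^ k"

text \<open>A path lists the representatives of a point, finest scale first. The representative at the next
  scale is chosen within the cell of points sharing the path so far, which makes the weights of the
  paths subprobabilities and \<open>- ln (path_weight k L)\<close> a code length.\<close>

primrec code_path :: "(nat \<Rightarrow> real) set \<Rightarrow> nat \<Rightarrow> (nat \<Rightarrow> real) \<Rightarrow> (nat \<Rightarrow> real) list" where
  "code_path P 0 x = [SOME x. x \<in> P]"
| "code_path P (Suc k) x = representative {y\<in>P. code_path P k y = code_path P k x} (level k) (near_min (64 * level k) (hd (code_path P k x))) x # code_path P k x"

text \<open>The weight is a function of the path alone, the previous centre being recovered from
  \<open>hd (tl L)\<close>, so that it can be summed over the set of paths.\<close>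

primrec path_weight :: "nat \<Rightarrow> (nat \<Rightarrow> real) list \<Rightarrow> real" where
  "path_weight 0 L = 1"
| "path_weight (Suc k) L = path_weight k (tl L) * step_weight (level k) (near_min (64 * level k) (hd (tl L))) (hd L)"

lemma level_pos [simp]: "level k > 0" by (simp add: level_def)

lemma level_Suc: "level (Suc k) = level k / 8" by (simp add: level_def)

lemma step_weight_pos: "step_weight s p v > 0" by (simp add: step_weight_def)

lemma path_weight_pos: "path_weight k L > 0"
  by (induction k arbitrary: L) (auto simp: step_weight_pos)

lemma hd_code_path_in:
  assumes "finite P" "P \<subseteq> T" "x \<in> P"
  shows "hd (code_path P k x) \<in> P"
proof (cases k)
  case 0
  then show ?thesis using assms someI[of "\<lambda>x. x \<in> P" x] by simp
next
  case (Suc l)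
  then show ?thesis
    using assms representative_spec(1)[of "{y\<in>P. code_path P l y = code_path P l x}" "level l" x] by auto
qed

text \<open>At scale 1 all points of T are close: their norms are at most 8 \<kappa>, so no index
  reaches the threshold 768 \<kappa>, and the root of the tree may be arbitrary. Afterwards,
  closeness at s/8 is closeness at the next level.\<close>

lemma close_code_path:
  assumes "finite P" "P \<subseteq> T" "x \<in> P"
  shows "close (level k) x (hd (code_path P k x))"
proof (cases k)
  case 0
  let ?z = "hd (code_path P 0 x)"
  have z: "?z \<in> T" "x \<in> T" using hd_code_path_in[OF assms, of 0] assms by auto
  have b: "N j x \<le> 8 * \<kappa>" "N j ?z \<le> 8 * \<kappa>" if "j \<in> J" for j
    using N_le_\<kappa> z that by auto
  have "N j (x - ?z) \<le> 96 * \<kappa>" if "j \<in> J" for j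
    using b[OF that] N_add[OF that, of x "- ?z"] N_minus[OF that, of ?z] \<kappa>_pos by simp
  moreover have empty: "{j\<in>J. 768 * \<kappa> * level 0 \<le> max (N j x) (N j ?z)} = {}"
    using b \<kappa>_pos by (force simp: level_def le_max_iff_disj)
  ultimately show ?thesis
    using \<Lambda>_pos S_pos unfolding close_def 0 empty by (simp add: level_def)
next
  case (Suc l)
  then show ?thesis
    using assms representative_spec(2)[of "{y\<in>P. code_path P l y = code_path P l x}" "level l" x] by (auto simp: level_Suc)
qed

text \<open>Kraft's inequality for the tree of paths: within each cell the step weights of the
  distinct extensions sum to at most 1, so lengthening the paths does not increase the
  total.\<close>

lemma sum_path_weight_le_1:
  assumes P: "finite P" "P \<subseteq> T"
  shows "(\<Sum>L\<in>code_path P k ` P. path_weight k L) \<le> 1"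
proof (induction k)
  case 0
  have "code_path P 0 ` P \<subseteq> {[SOME x. x \<in> P]}" by auto
  then have "card (code_path P 0 ` P) \<le> 1" using card_mono[of "{[SOME x. x \<in> P]}"] by fastforce
  then show ?case by simp
next
  case (Suc k)
  define cell where "cell L = {y\<in>P. code_path P k y = L}" for L
  define ctr where "ctr L = near_min (64 * level k) (hd L)" for L :: "(nat \<Rightarrow> real) list"
  define A where "A L = (\<lambda>v. v # L) ` (representative (cell L) (level k) (ctr L) ` cell L)" for L
  have "code_path P (Suc k) ` P = (\<Union>L\<in>code_path P k ` P. A L)"
  proof (intro subset_antisym subsetI)
    fix Q assume "Q \<in> code_path P (Suc k) ` P"
    then obtain x where x: "x \<in> P" "Q = code_path P (Suc k) x" by blast
    then have "Q = representative (cell (code_path P k x)) (level k) (ctr (code_path P k x)) x # code_path P k x" "x \<in> cell (code_path P k x)"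
      by (simp_all add: cell_def ctr_def)
    then show "Q \<in> (\<Union>L\<in>code_path P k ` P. A L)"
      using x(1) unfolding A_def by blast
  next
    fix Q assume "Q \<in> (\<Union>L\<in>code_path P k ` P. A L)"
    then obtain L x where "x \<in> cell L" "Q = representative (cell L) (level k) (ctr L) x # L"
      unfolding A_def by blast
    then have "Q = code_path P (Suc k) x" "x \<in> P"
      by (auto simp: cell_def ctr_def)
    then show "Q \<in> code_path P (Suc k) ` P" by blast
  qed
  then have "(\<Sum>L\<in>code_path P (Suc k) ` P. path_weight (Suc k) L) = (\<Sum>L\<in>code_path P k ` P. \<Sum>Q\<in>A L. path_weight (Suc k) Q)"
    using P(1) by (simp only:, subst sum.UNION_disjoint) (auto simp: A_def cell_def)
  also have "\<dots> \<le> (\<Sum>L\<in>code_path P k ` P. path_weight k L)"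
  proof (rule sum_mono)
    fix L
    have cell: "finite (cell L)" "cell L \<subseteq> T" using P by (auto simp: cell_def)
    have "(\<Sum>Q\<in>A L. path_weight (Suc k) Q) = path_weight k L * (\<Sum>v\<in>representative (cell L) (level k) (ctr L) ` cell L. step_weight (level k) (ctr L) v)"
      unfolding A_def by (subst sum.reindex) (auto simp: ctr_def sum_distrib_left inj_on_def)
    also have "\<dots> \<le> path_weight k L * 1"
      using representative_spec(4)[OF cell level_pos] path_weight_pos[of k L] by (intro mult_left_mono) auto
    finally show "(\<Sum>Q\<in>A L. path_weight (Suc k) Q) \<le> path_weight k L" by simp
  qed
  also note Suc
  finally show ?case .
qed

text \<open>Each representative has at least the step weight of x itself, so the code length is
  bounded by displacements between the approximate minimiser of x and that of the previous
  representative. \<open>nsq_near_min_diff_le\<close> then leaves only quantities at x. The 4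
  absorbs 5/2 + ln 2.\<close>

lemma minus_ln_path_weight:
  assumes P: "finite P" "P \<subseteq> T" "x \<in> P"
  shows "- ln (path_weight k (code_path P k x)) \<le> (\<Sum>i<k. 4 + (min_nsq (level i) x - min_nsq (4096 * level i) x) / (level i)\<^sup>2)"
proof (induction k)
  case (Suc k)
  define cell where "cell = {y\<in>P. code_path P k y = code_path P k x}"
  define p where "p = near_min (64 * level k) (hd (code_path P k x))"
  let ?s = "level k"
  have cell: "finite cell" "cell \<subseteq> T" "x \<in> cell" using P by (auto simp: cell_def)
  have eq: "path_weight (Suc k) (code_path P (Suc k) x) = path_weight k (code_path P k x) * step_weight ?s p (representative cell ?s p x)"
    by (simp only: code_path.simps path_weight.simps list.sel cell_def p_def)
  have "- ln (path_weight (Suc k) (code_path P (Suc k) x)) = - ln (path_weight k (code_path P k x)) - ln (step_weight ?s p (representative cell ?s p x))"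
    unfolding eq using path_weight_pos[of k "code_path P k x"] step_weight_pos[of ?s p "representative cell ?s p x"] by (subst ln_mult) auto
  moreover have "ln (step_weight ?s p x) \<le> ln (step_weight ?s p (representative cell ?s p x))"
    using representative_spec(3)[OF cell(1,2) level_pos cell(3)] step_weight_pos by (subst ln_le_cancel_iff) auto
  moreover have "- ln (step_weight ?s p x) = nsq n (near_min ?s x - p) / (2 * ?s\<^sup>2) + ln 2"
    by (simp add: step_weight_def ln_div)
  moreover have "nsq n (near_min ?s x - p) / (2 * ?s\<^sup>2)
      \<le> (2 * (min_nsq ?s x - min_nsq (4096 * ?s) x) + 5 * ?s\<^sup>2) / (2 * ?s\<^sup>2)"
    unfolding p_def using close_code_path[OF P, of k] by (intro divide_right_mono nsq_near_min_diff_le) auto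
  moreover have "(2 * (min_nsq ?s x - min_nsq (4096 * ?s) x) + 5 * ?s\<^sup>2) / (2 * ?s\<^sup>2)
      = (min_nsq ?s x - min_nsq (4096 * ?s) x) / ?s\<^sup>2 + 5 / 2"
  proof -
    have "level k \<noteq> 0" using level_pos[of k] by linarith
    then show ?thesis by (simp add: field_simps)
  qed
  moreover have "ln (2::real) \<le> 1"
    using ln_le_minus_one[of "2::real"] by simp
  ultimately have "- ln (path_weight (Suc k) (code_path P (Suc k) x)) \<le> - ln (path_weight k (code_path P k x)) + (4 + (min_nsq ?s x - min_nsq (4096 * ?s) x) / ?s\<^sup>2)"
    by linarith
  then show ?case using Suc by simp
qed simp

text \<open>The factor 4096 = 8^4 is a shift by four levels, so the sum telescopes to four values of
  \<open>min_nsq\<close>, each at most 1. The four subtracted values at the coarse end vanish,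
  because 4096 * 8^(-3) = 8 is above 4.\<close>

lemma sum_min_nsq_diff_le:
  assumes "x \<in> T"
  shows "(\<Sum>i<k. min_nsq (level i) x - min_nsq (4096 * level i) x) \<le> 4"
proof -
  have shift: "4096 * level (k + 4) = level k" for k
    by (simp add: level_def power_add field_simps)
  have "(\<Sum>i<k+4. min_nsq (level i) x - min_nsq (4096 * level i) x) = min_nsq (level k) x + min_nsq (level (k+1)) x + min_nsq (level (k+2)) x + min_nsq (level (k+3)) x" for k
  proof (induction k)
    case 0
    have "min_nsq (4096 * level i) x = 0" if "i < 4" for i
    proof (rule min_nsq_eq_0[OF _ assms])
      have "(1 / 8 :: real) ^ 3 \<le> (1 / 8) ^ i"
        using that by (intro power_decreasing) auto
      then show "4 \<le> 4096 * level i" by (simp add: level_def power3_eq_cube)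
    qed
    then show ?case by (simp add: eval_nat_numeral)
  next
    case (Suc k)
    then show ?case using shift[of k] by (simp add: add.commute eval_nat_numeral)
  qed
  moreover have "(\<Sum>i<k. min_nsq (level i) x - min_nsq (4096 * level i) x) \<le> (\<Sum>i<k+4. min_nsq (level i) x - min_nsq (4096 * level i) x)"
    by (intro sum_mono2) (auto simp: min_nsq_diff_nonneg)
  ultimately show ?thesis
    using min_nsq_le_1[OF _ assms, of "level k"] min_nsq_le_1[OF _ assms, of "level (k+1)"] min_nsq_le_1[OF _ assms, of "level (k+2)"]
      min_nsq_le_1[OF _ assms, of "level (k+3)"] by simp
qed

end

text \<open>The code length at scale k includes every coarser step i \<le> k. As s^2 decays
  geometrically, charging step i again at all finer scales at most doubles its cost.\<close>

lemma sum_geometric_tail_le: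
  fixes c :: "nat \<Rightarrow> real"
  assumes "\<And>i. 0 \<le> c i" "0 \<le> q" "q \<le> 1 / 2"
  shows "(\<Sum>k<K. q ^ k * (\<Sum>i\<le>k. c i)) \<le> 2 * (\<Sum>i<K. q ^ i * c i)"
proof -
  define A where "A k = (\<Sum>i<k. c i)" for k
  have A: "0 \<le> A k" for k
    unfolding A_def by (intro sum_nonneg assms)
  \<comment> \<open>The added term 2 q^K A K reserves enough for charging the steps seen so far at
    all later scales; without it the induction does not close.\<close>
  have "(\<Sum>k<K. q ^ k * (\<Sum>i\<le>k. c i)) + 2 * q ^ K * A K \<le> 2 * (\<Sum>i<K. q ^ i * c i)"
  proof (induction K)
    case (Suc K)
    have "2 * q ^ Suc K * A (Suc K) \<le> q ^ K * A (Suc K)"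
      using assms A[of "Suc K"] mult_right_mono[of "2 * q" 1 "q ^ K"]
      by (intro mult_right_mono) auto
    then have "q ^ K * A (Suc K) + 2 * q ^ Suc K * A (Suc K) \<le> 2 * q ^ K * A K + 2 * (q ^ K * c K)"
      by (simp add: A_def algebra_simps)
    then show ?case using Suc by (simp add: A_def flip: lessThan_Suc_atMost)
  qed (simp add: A_def)
  moreover have "0 \<le> 2 * q ^ K * A K"
    using assms A by simp
  ultimately show ?thesis by linarith
qed

subsection \<open>Chaining\<close>

lemma finite_set_pmf_rademacher: "finite (set_pmf (rademacher M))"
  unfolding rademacher_def by (subst set_Pi_pmf) (auto intro!: finite_PiE_dflt)

lemma integrable_rademacher [simp]:
  fixes f :: "(nat \<Rightarrow> real) \<Rightarrow> real"
  shows "integrable (measure_pmf (rademacher M)) f"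
  by (intro integrable_measure_pmf_finite finite_set_pmf_rademacher)

lemma cosh_le_exp_square: "cosh (x::real) \<le> exp (x\<^sup>2 / 2)"
proof -
  have nonneg: "cosh x \<le> exp (x\<^sup>2 / 2)" if "x \<ge> 0" for x :: real
  proof -
    have tanh_le: "tanh y \<le> y" if "y \<ge> 0" for y :: real
    proof -
      have D: "((\<lambda>y. y - tanh y) has_real_derivative tanh y ^ 2) (at y)" for y :: real
        by (auto intro!: derivative_eq_intros)
      then have "0 - tanh 0 \<le> y - tanh y"
        using that D by (intro DERIV_nonneg_imp_nondecreasing[of 0 y "\<lambda>y. y - tanh y"]) (metis zero_le_power2)+
      then show ?thesis by simp
    qed
    have D: "((\<lambda>y. y\<^sup>2 / 2 - ln (cosh y)) has_real_derivative (y - tanh y)) (at y)" for y :: real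
      by (auto intro!: derivative_eq_intros simp: tanh_def)
    have "0\<^sup>2 / 2 - ln (cosh 0) \<le> x\<^sup>2 / 2 - ln (cosh x)"
    proof (rule DERIV_nonneg_imp_nondecreasing[of 0 x "\<lambda>y. y\<^sup>2 / 2 - ln (cosh y)"])
      show "\<exists>d. ((\<lambda>y. y\<^sup>2 / 2 - ln (cosh y)) has_real_derivative d) (at z) \<and> 0 \<le> d" if "0 \<le> z" for z
        using D[of z] tanh_le[OF that] by (intro exI[of _ "z - tanh z"]) auto
    qed (use that in simp)
    then have "ln (cosh x) \<le> x\<^sup>2 / 2" by simp
    then show ?thesis
      by (metis cosh_real_pos exp_le_cancel_iff exp_ln)
  qed
  show ?thesis
    using nonneg[of x] nonneg[of "- x"] by (cases "x \<ge> 0") auto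
qed
lemma rademacher_exp_sum_le:
  "measure_pmf.expectation (rademacher M) (\<lambda>\<epsilon>. exp (\<Sum>j=1..M. \<epsilon> j * d j)) \<le> exp ((\<Sum>j=1..M. (d j)\<^sup>2) / 2)"
proof -
  have "measure_pmf.expectation (rademacher M) (\<lambda>\<epsilon>. exp (\<Sum>j=1..M. \<epsilon> j * d j))
      = measure_pmf.expectation (rademacher M) (\<lambda>\<epsilon>. \<Prod>j=1..M. exp (\<epsilon> j * d j))"
    by (simp add: exp_sum)
  also have "\<dots> = (\<Prod>j=1..M. measure_pmf.expectation (pmf_of_set {-1, 1}) (\<lambda>e. exp (e * d j)))"
    unfolding rademacher_def
    by (rule expectation_prod_Pi_pmf) (auto intro!: integrable_measure_pmf_finite)
  also have "\<dots> = (\<Prod>j=1..M. cosh (d j))"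
    by (intro prod.cong refl) (simp add: integral_pmf_of_set cosh_def field_simps)
  also have "\<dots> \<le> (\<Prod>j=1..M. exp ((d j)\<^sup>2 / 2))"
    by (intro prod_mono) (simp add: cosh_le_exp_square)
  also have "\<dots> = exp ((\<Sum>j=1..M. (d j)\<^sup>2) / 2)"
    by (simp add: exp_sum[symmetric] sum_divide_distrib)
  finally show ?thesis .
qed

text \<open>Y is the largest excess over the bound, and E exp (t Y) is at most the sum of the w v,
  hence at most 1. Then exp z \<ge> 1 + z gives E Y \<le> 0. Since Y does not depend on v, bounds of
  this kind can be added over scales for each sign pattern and each point before any supremum is
  taken.\<close>

lemma rademacher_weighted_union_bound:
  fixes d :: "'a \<Rightarrow> nat \<Rightarrow> real"
  assumes V: "finite V" "V \<noteq> {}" and w: "\<And>v. v \<in> V \<Longrightarrow> w v > 0" "(\<Sum>v\<in>V. w v) \<le> 1" and t: "t > 0"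
  shows "\<exists>Y. measure_pmf.expectation (rademacher M) Y \<le> 0 \<and>
    (\<forall>\<epsilon>. \<forall>v\<in>V. (\<Sum>j=1..M. \<epsilon> j * d v j) \<le> t / 2 * (\<Sum>j=1..M. (d v j)\<^sup>2) + - ln (w v) / t + Y \<epsilon>)"
proof -
  let ?E = "measure_pmf.expectation (rademacher M)"
  define X where "X \<epsilon> v = (\<Sum>j=1..M. \<epsilon> j * d v j) - t / 2 * (\<Sum>j=1..M. (d v j)\<^sup>2) + ln (w v) / t" for \<epsilon> v
  define Y where "Y \<epsilon> = Max (X \<epsilon> ` V)" for \<epsilon>
  have "(\<Sum>j=1..M. \<epsilon> j * d v j) \<le> t / 2 * (\<Sum>j=1..M. (d v j)\<^sup>2) + - ln (w v) / t + Y \<epsilon>" if "v \<in> V" for \<epsilon> v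
  proof -
    have "X \<epsilon> v \<le> Y \<epsilon>" unfolding Y_def using V that by (intro Max_ge) auto
    then show ?thesis by (simp add: X_def)
  qed
  moreover have "?E Y \<le> 0"
  proof -
    have "t * Y \<epsilon> \<le> (\<Sum>v\<in>V. exp (t * X \<epsilon> v)) - 1" for \<epsilon>
    proof -
      have "Y \<epsilon> \<in> X \<epsilon> ` V" unfolding Y_def using V by (intro Max_in) auto
      then obtain v where v: "v \<in> V" "Y \<epsilon> = X \<epsilon> v" by blast
      have "exp (t * Y \<epsilon>) \<le> (\<Sum>v\<in>V. exp (t * X \<epsilon> v))"
        unfolding v(2) using V v(1) by (intro member_le_sum) auto
      then show ?thesis using exp_ge_add_one_self[of "t * Y \<epsilon>"] by linarith
    qed
    then have "?E (\<lambda>\<epsilon>. t * Y \<epsilon>) \<le> ?E (\<lambda>\<epsilon>. (\<Sum>v\<in>V. exp (t * X \<epsilon> v)) - 1)"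
      by (intro integral_mono) auto
    then have "t * ?E Y \<le> (\<Sum>v\<in>V. ?E (\<lambda>\<epsilon>. exp (t * X \<epsilon> v))) - 1"
      by (simp add: Bochner_Integration.integral_diff Bochner_Integration.integral_sum)
    also have "(\<Sum>v\<in>V. ?E (\<lambda>\<epsilon>. exp (t * X \<epsilon> v))) \<le> (\<Sum>v\<in>V. w v)"
    proof (rule sum_mono)
      fix v assume v: "v \<in> V"
      define D where "D = (\<Sum>j=1..M. (d v j)\<^sup>2)"
      have "exp (t * X \<epsilon> v) = exp (\<Sum>j=1..M. \<epsilon> j * (t * d v j)) * (w v * exp (- (t\<^sup>2 * D / 2)))" for \<epsilon>
      proof -
        have "t * X \<epsilon> v = (\<Sum>j=1..M. \<epsilon> j * (t * d v j)) + (ln (w v) + - (t\<^sup>2 * D / 2))"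
          using t by (simp add: X_def D_def algebra_simps sum_distrib_left power2_eq_square)
        then show ?thesis
          using w(1)[OF v] by (simp only: exp_add exp_ln)
      qed
      then have "?E (\<lambda>\<epsilon>. exp (t * X \<epsilon> v)) = ?E (\<lambda>\<epsilon>. exp (\<Sum>j=1..M. \<epsilon> j * (t * d v j))) * (w v * exp (- (t\<^sup>2 * D / 2)))"
        by simp
      also have "\<dots> \<le> exp ((\<Sum>j=1..M. (t * d v j)\<^sup>2) / 2) * (w v * exp (- (t\<^sup>2 * D / 2)))"
        using w(1)[OF v] by (intro mult_right_mono rademacher_exp_sum_le) auto
      also have "(\<Sum>j=1..M. (t * d v j)\<^sup>2) / 2 = t\<^sup>2 * D / 2"
        by (simp add: D_def power_mult_distrib sum_distrib_left)
      also have "exp (t\<^sup>2 * D / 2) * (w v * exp (- (t\<^sup>2 * D / 2))) = w v"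
        by (simp add: exp_minus)
      finally show "?E (\<lambda>\<epsilon>. exp (t * X \<epsilon> v)) \<le> w v" .
    qed
    also note w(2)
    finally show ?thesis using t by (simp add: mult_le_0_iff)
  qed
  ultimately show ?thesis by blast
qed

lemma sum_linear_over_power2: "(\<Sum>i<min_nsq. (2 * real i + 5) / 2 ^ i) = 14 - (4 * real min_nsq + 14) / 2 ^ min_nsq"
proof (induction min_nsq)
  case (Suc min_nsq)
  show ?case unfolding sum.lessThan_Suc Suc.IH by (simp add: field_simps)
qed simp

lemma sum_geometric_le_2:
  assumes "0 \<le> q" "q \<le> 1 / (2::real)"
  shows "(\<Sum>i<min_nsq. q ^ i) \<le> 2"
proof -
  have "(\<Sum>i<min_nsq. q ^ i) = (1 - q ^ min_nsq) / (1 - q)"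
    using assms by (subst sum_gp_strict) auto
  also have "\<dots> \<le> 1 / (1 / 2)"
    using assms by (intro frac_le) auto
  finally show ?thesis by simp
qed

lemma square_of_sum3_le: "(a + b + c)\<^sup>2 \<le> 3 * (a\<^sup>2 + b\<^sup>2 + (c::real)\<^sup>2)"
proof -
  have "0 \<le> (a - b)\<^sup>2 + (b - c)\<^sup>2 + (a - c)\<^sup>2" by simp
  then show ?thesis by (simp add: power2_eq_square algebra_simps)
qed

lemma square_of_sum2_le: "(a + b)\<^sup>2 \<le> 2 * (a\<^sup>2 + (b::real)\<^sup>2)"
proof -
  have "0 \<le> (a - b)\<^sup>2" by simp
  then show ?thesis by (simp add: power2_eq_square algebra_simps)
qed

section \<open>Truncated squares and the total code cost\<close>

context norm_family
begin

lemma level_nonneg [simp]: "0 \<le> level k" and level_nonzero [simp]: "level k \<noteq> 0"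
  using level_pos[of k] by linarith+

text \<open>A soft threshold: it is 1-Lipschitz in N_j(x)^2 and vanishes on the indices that
  \<open>close\<close> leaves uncontrolled. A hard cut-off would jump when only one of two close
  points lies above the threshold.\<close>

definition truncated :: "real \<Rightarrow> (nat \<Rightarrow> real) \<Rightarrow> nat \<Rightarrow> real" where
  "truncated s x j = max ((N j x)\<^sup>2 - (768 * \<kappa> * s)\<^sup>2) 0"

text \<open>A difference of squares is at most 2 N_j(x - y) times the larger norm, which is what
  \<open>close\<close> bounds in l2; hence 384 = 2 * 192.\<close>

lemma sum_truncated_diff_le:
  assumes close: "close s x y" and s: "s > 0"
  shows "(\<Sum>j\<in>J. (truncated s x j - truncated s y j)\<^sup>2) \<le> (384 * \<Lambda> * S * s)\<^sup>2"
proof -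
  define \<theta> where "\<theta> = 768 * \<kappa> * s"
  have \<theta>: "\<theta> > 0" using \<kappa>_pos s by (simp add: \<theta>_def)
  define A where "A = {j\<in>J. \<theta> \<le> max (N j x) (N j y)}"
  have "(\<Sum>j\<in>J. (truncated s x j - truncated s y j)\<^sup>2) = (\<Sum>j\<in>A. (truncated s x j - truncated s y j)\<^sup>2)"
  proof (rule sum.mono_neutral_right[OF fin_J])
    show "A \<subseteq> J" by (auto simp: A_def)
    show "\<forall>j\<in>J - A. (truncated s x j - truncated s y j)\<^sup>2 = 0"
    proof
      fix j assume "j \<in> J - A"
      then have "N j x \<le> \<theta>" "N j y \<le> \<theta>" "0 \<le> N j x" "0 \<le> N j y"
        by (auto simp: A_def N_nonneg)
      then have "(N j x)\<^sup>2 \<le> \<theta>\<^sup>2" "(N j y)\<^sup>2 \<le> \<theta>\<^sup>2"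
        by (simp_all add: power_mono)
      then show "(truncated s x j - truncated s y j)\<^sup>2 = 0"
        by (simp add: truncated_def \<theta>_def)
    qed
  qed
  also have "\<dots> \<le> (\<Sum>j\<in>A. 4 * (N j (x - y) * max (N j x) (N j y))\<^sup>2)"
  proof (rule sum_mono)
    fix j assume "j \<in> A"
    then have j: "j \<in> J" by (simp add: A_def)
    have "\<bar>truncated s x j - truncated s y j\<bar> \<le> \<bar>(N j x)\<^sup>2 - (N j y)\<^sup>2\<bar>"
      by (simp add: truncated_def)
    also have "\<dots> = \<bar>N j x - N j y\<bar> * (N j x + N j y)"
      using N_nonneg[OF j, of x] N_nonneg[OF j, of y]
      by (simp add: power2_eq_square square_diff_square_factored abs_mult)
    also have "\<dots> \<le> N j (x - y) * (2 * max (N j x) (N j y))"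
      using N_nonneg[OF j, of x] N_nonneg[OF j, of y] N_nonneg[OF j, of "x - y"]
      by (intro mult_mono N_abs_diff j) auto
    finally have "\<bar>truncated s x j - truncated s y j\<bar>\<^sup>2 \<le> (N j (x - y) * (2 * max (N j x) (N j y)))\<^sup>2"
      by (intro power_mono) auto
    then show "(truncated s x j - truncated s y j)\<^sup>2 \<le> 4 * (N j (x - y) * max (N j x) (N j y))\<^sup>2"
      by (simp add: power_mult_distrib)
  qed
  also have "\<dots> = 4 * (L2_set (\<lambda>j. N j (x - y) * max (N j x) (N j y)) A)\<^sup>2"
    by (simp add: L2_set_def sum_nonneg sum_distrib_left)
  also have "\<dots> \<le> 4 * (192 * \<Lambda> * S * s)\<^sup>2"
    using close by (intro mult_left_mono power_mono) (auto simp: close_def A_def \<theta>_def)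
  also have "\<dots> = (384 * \<Lambda> * S * s)\<^sup>2"
    by (simp add: power2_eq_square)
  finally show ?thesis .
qed

lemma truncated_bounds:
  "0 \<le> (N j x)\<^sup>2 - truncated s x j" "(N j x)\<^sup>2 - truncated s x j \<le> (768 * \<kappa> * s)\<^sup>2" "0 \<le> truncated s x j"
  by (auto simp: truncated_def)

lemma truncated_Suc_diff:
  "0 \<le> truncated (level (Suc k)) x j - truncated (level k) x j"
  "truncated (level (Suc k)) x j - truncated (level k) x j \<le> (768 * \<kappa> * level k)\<^sup>2"
proof -
  have "(768 * \<kappa> * level (Suc k))\<^sup>2 \<le> (768 * \<kappa> * level k)\<^sup>2"
    using \<kappa>_pos level_pos[of k] by (intro power_mono) (auto simp: level_Suc)
  then show "0 \<le> truncated (level (Suc k)) x j - truncated (level k) x j"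
    "truncated (level (Suc k)) x j - truncated (level k) x j \<le> (768 * \<kappa> * level k)\<^sup>2"
    using zero_le_power2[of "768 * \<kappa> * level (Suc k)"] unfolding truncated_def by linarith+
qed

lemma sum_N_square_le: "x \<in> T \<Longrightarrow> (\<Sum>j\<in>J. (N j x)\<^sup>2) \<le> S\<^sup>2"
  using power_mono[OF T_S, of x 2] by (simp add: L2_set_def sum_nonneg)

lemma sum_truncated_increment_le:
  assumes "x \<in> T"
  shows "(\<Sum>k<K. \<Sum>j\<in>J. truncated (level (Suc k)) x j - truncated (level k) x j) \<le> S\<^sup>2"
proof -
  have "(\<Sum>k<K. \<Sum>j\<in>J. truncated (level (Suc k)) x j - truncated (level k) x j)
      = (\<Sum>j\<in>J. truncated (level K) x j - truncated (level 0) x j)"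
    by (subst sum.swap) (simp only: sum_lessThan_telescope[of "\<lambda>k. truncated (level k) x _"])
  also have "\<dots> \<le> (\<Sum>j\<in>J. (N j x)\<^sup>2)"
    by (intro sum_mono) (use truncated_bounds in \<open>smt (verit)\<close>)
  finally show ?thesis using sum_N_square_le[OF assms] by linarith
qed

lemma level_power2: "(level k)\<^sup>2 = (1 / 64) ^ k"
  by (simp add: level_def power2_eq_square flip: power_mult_distrib)

text \<open>The factor s^2 cancels the denominators of the code length, leaving a geometric series
  and the telescoping displacements: 24 = 2 (4 * 2 + 4). The bound is uniform in the number K of
  scales.\<close>

lemma code_path_cost_sum_le:
  assumes P: "finite P" "P \<subseteq> T" "x \<in> P"
  shows "(\<Sum>k<K. (level k)\<^sup>2 * - ln (path_weight (Suc k) (code_path P (Suc k) x))) \<le> 24"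
proof -
  define c where "c i = 4 + (min_nsq (level i) x - min_nsq (4096 * level i) x) / (level i)\<^sup>2" for i
  have c: "0 \<le> c i" for i
    using min_nsq_diff_nonneg[OF level_pos, of i x] by (simp add: c_def)
  have "(\<Sum>k<K. (level k)\<^sup>2 * - ln (path_weight (Suc k) (code_path P (Suc k) x))) \<le> (\<Sum>k<K. (1 / 64) ^ k * (\<Sum>i\<le>k. c i))"
  proof (rule sum_mono)
    fix k
    show "(level k)\<^sup>2 * - ln (path_weight (Suc k) (code_path P (Suc k) x)) \<le> (1 / 64) ^ k * (\<Sum>i\<le>k. c i)"
      using minus_ln_path_weight[OF P, of "Suc k"] unfolding level_power2 lessThan_Suc_atMost c_def
      by (intro mult_left_mono) auto
  qed
  also have "\<dots> \<le> 2 * (\<Sum>i<K. (1 / 64) ^ i * c i)"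
    by (rule sum_geometric_tail_le) (use c in auto)
  also have "(\<Sum>i<K. (1 / 64) ^ i * c i) = (\<Sum>i<K. 4 * (1 / 64) ^ i + (min_nsq (level i) x - min_nsq (4096 * level i) x))"
  proof (intro sum.cong refl)
    fix i
    have "(level i)\<^sup>2 \<noteq> 0" using level_pos[of i] by simp
    then show "(1 / 64) ^ i * c i = 4 * (1 / 64) ^ i + (min_nsq (level i) x - min_nsq (4096 * level i) x)"
      unfolding c_def level_power2[symmetric] by (simp add: distrib_left)
  qed
  also have "\<dots> = 4 * (\<Sum>i<K. (1 / 64) ^ i) + (\<Sum>i<K. min_nsq (level i) x - min_nsq (4096 * level i) x)"
    by (simp only: sum.distrib sum_distrib_left)
  also have "\<dots> \<le> 4 * 2 + 4"
    using P by (intro add_mono mult_left_mono sum_geometric_le_2 sum_min_nsq_diff_le) auto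
  finally show ?thesis by simp
qed

end

text \<open>The number a is shared by all union bounds: t = a / s^2 at a coarse scale s, t = a n at
  the transition to the nets, and t = a n 2^i along the nets. It is fixed only in
  \<open>rademacher_Sup_le\<close>.\<close>

locale rademacher_norm_family = norm_family n "{1..M}" N \<kappa> \<Lambda> S T
  for n M :: nat and N :: "nat \<Rightarrow> (nat \<Rightarrow> real) \<Rightarrow> real" and \<kappa> \<Lambda> S :: real and T :: "(nat \<Rightarrow> real) set" +
  fixes a :: real
  assumes a_pos: "a > 0"
begin

declare One_nat_def [simp del]

abbreviation E :: "((nat \<Rightarrow> real) \<Rightarrow> real) \<Rightarrow> real" where
  "E \<equiv> measure_pmf.expectation (rademacher M)"

text \<open>A path of length k + 1 determines the representatives at both levels, so the union bound
  runs over such paths. The increment splits into the representation errors at the two levels and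
  the effect of lowering the threshold at x itself.\<close>

lemma chain_step:
  assumes P: "finite P" "P \<subseteq> T" "P \<noteq> {}"
  shows "\<exists>Y. E Y \<le> 0 \<and> (\<forall>\<epsilon>. \<forall>x\<in>P.
    (\<Sum>j=1..M. \<epsilon> j * truncated (level (Suc k)) (hd (code_path P (Suc k) x)) j)
      - (\<Sum>j=1..M. \<epsilon> j * truncated (level k) (hd (code_path P k x)) j)
    \<le> a * (224640 * (\<Lambda> * S)\<^sup>2 + 884736 * \<kappa>\<^sup>2 * (\<Sum>j=1..M. truncated (level (Suc k)) x j - truncated (level k) x j))
      + ((level k)\<^sup>2 * - ln (path_weight (Suc k) (code_path P (Suc k) x))) / a + Y \<epsilon>)"
proof -
  let ?s = "level k" and ?s' = "level (Suc k)"
  define d where "d L j = truncated ?s' (hd L) j - truncated ?s (hd (tl L)) j" for L j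
  define t where "t = a / ?s\<^sup>2"
  have t: "t > 0" using a_pos level_pos[of k] by (simp add: t_def)
  have "\<exists>Y. E Y \<le> 0 \<and> (\<forall>\<epsilon>. \<forall>L\<in>code_path P (Suc k) ` P. (\<Sum>j=1..M. \<epsilon> j * d L j)
      \<le> t / 2 * (\<Sum>j=1..M. (d L j)\<^sup>2) + - ln (path_weight (Suc k) L) / t + Y \<epsilon>)"
  proof (rule rademacher_weighted_union_bound[OF _ _ _ _ t])
    show "0 < path_weight (Suc k) L" for L by (rule path_weight_pos)
    show "sum (path_weight (Suc k)) (code_path P (Suc k) ` P) \<le> 1" by (rule sum_path_weight_le_1[OF P(1,2)])
  qed (use P in simp_all)
  then obtain Y where Y: "E Y \<le> 0" and YL: "\<And>\<epsilon> L. L \<in> code_path P (Suc k) ` P \<Longrightarrow>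
      (\<Sum>j=1..M. \<epsilon> j * d L j) \<le> t / 2 * (\<Sum>j=1..M. (d L j)\<^sup>2) + - ln (path_weight (Suc k) L) / t + Y \<epsilon>"
    by blast
  have "(\<Sum>j=1..M. \<epsilon> j * truncated ?s' (hd (code_path P (Suc k) x)) j) - (\<Sum>j=1..M. \<epsilon> j * truncated ?s (hd (code_path P k x)) j)
    \<le> a * (224640 * (\<Lambda> * S)\<^sup>2 + 884736 * \<kappa>\<^sup>2 * (\<Sum>j=1..M. truncated ?s' x j - truncated ?s x j))
      + (?s\<^sup>2 * - ln (path_weight (Suc k) (code_path P (Suc k) x))) / a + Y \<epsilon>" if x: "x \<in> P" for \<epsilon> x
  proof -
    let ?L = "code_path P (Suc k) x"
    define y z where "y = hd ?L" and "z = hd (code_path P k x)"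
    have dL: "d ?L j = truncated ?s' y j - truncated ?s z j" for j
      by (simp add: d_def y_def z_def)
    define \<eta> where "\<eta> j = truncated ?s' x j - truncated ?s x j" for j
    have "(\<Sum>j=1..M. (d ?L j)\<^sup>2)
        \<le> (\<Sum>j=1..M. 3 * ((truncated ?s' x j - truncated ?s' y j)\<^sup>2 + (truncated ?s x j - truncated ?s z j)\<^sup>2 + (768 * \<kappa> * ?s)\<^sup>2 * \<eta> j))"
    proof (rule sum_mono)
      fix j
      have "d ?L j = - (truncated ?s' x j - truncated ?s' y j) + (truncated ?s x j - truncated ?s z j) + \<eta> j"
        by (simp add: dL \<eta>_def del: code_path.simps)
      then have *: "(d ?L j)\<^sup>2 \<le> 3 * ((truncated ?s' x j - truncated ?s' y j)\<^sup>2 + (truncated ?s x j - truncated ?s z j)\<^sup>2 + (\<eta> j)\<^sup>2)"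
        using square_of_sum3_le[of "- (truncated ?s' x j - truncated ?s' y j)" "truncated ?s x j - truncated ?s z j" "\<eta> j"]
        by (simp only: power2_minus)
      \<comment> \<open>Bounding only one factor of the square by its maximum supplies the s^2 that
        cancels against t, and leaves \<eta> to the first power, which telescopes over the
        scales.\<close>
      have **: "(\<eta> j)\<^sup>2 \<le> (768 * \<kappa> * ?s)\<^sup>2 * \<eta> j"
        using truncated_Suc_diff[of k x j] unfolding \<eta>_def power2_eq_square[of "truncated ?s' x j - truncated ?s x j"]
        by (intro mult_right_mono) auto
      show "(d ?L j)\<^sup>2 \<le> 3 * ((truncated ?s' x j - truncated ?s' y j)\<^sup>2 + (truncated ?s x j - truncated ?s z j)\<^sup>2 + (768 * \<kappa> * ?s)\<^sup>2 * \<eta> j)"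
        by (rule order_trans[OF * mult_left_mono[OF add_left_mono[OF **]]]) simp
    qed
    also have "\<dots> = 3 * ((\<Sum>j=1..M. (truncated ?s' x j - truncated ?s' y j)\<^sup>2) + (\<Sum>j=1..M. (truncated ?s x j - truncated ?s z j)\<^sup>2)
        + (768 * \<kappa> * ?s)\<^sup>2 * (\<Sum>j=1..M. \<eta> j))"
      by (simp only: sum.distrib sum_distrib_left[symmetric])
    also have "\<dots> \<le> 3 * ((384 * \<Lambda> * S * ?s')\<^sup>2 + (384 * \<Lambda> * S * ?s)\<^sup>2 + (768 * \<kappa> * ?s)\<^sup>2 * (\<Sum>j=1..M. \<eta> j))"
      unfolding y_def z_def
      by (intro mult_left_mono add_mono sum_truncated_diff_le order_refl level_pos close_code_path[OF P(1,2) x]) simp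
    \<comment> \<open>449280 = 3 * 384^2 * (1 + 1/64) and 1769472 = 3 * 768^2; multiplication by t/2
      halves both.\<close>
    also have "\<dots> = (449280 * (\<Lambda> * S)\<^sup>2 + 1769472 * \<kappa>\<^sup>2 * (\<Sum>j=1..M. \<eta> j)) * ?s\<^sup>2"
      by (simp add: level_Suc power2_eq_square algebra_simps)
    finally have "t / 2 * (\<Sum>j=1..M. (d ?L j)\<^sup>2)
        \<le> t / 2 * ((449280 * (\<Lambda> * S)\<^sup>2 + 1769472 * \<kappa>\<^sup>2 * (\<Sum>j=1..M. \<eta> j)) * ?s\<^sup>2)"
      using t by (intro mult_left_mono) auto
    also have "\<dots> = a * (224640 * (\<Lambda> * S)\<^sup>2 + 884736 * \<kappa>\<^sup>2 * (\<Sum>j=1..M. \<eta> j))"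
      using level_pos[of k] by (simp add: t_def algebra_simps)
    finally have "t / 2 * (\<Sum>j=1..M. (d ?L j)\<^sup>2) \<le> a * (224640 * (\<Lambda> * S)\<^sup>2 + 884736 * \<kappa>\<^sup>2 * (\<Sum>j=1..M. \<eta> j))" .
    moreover have "- ln (path_weight (Suc k) ?L) / t = (?s\<^sup>2 * - ln (path_weight (Suc k) ?L)) / a"
      by (simp add: t_def field_simps del: path_weight.simps code_path.simps)
    moreover have "(\<Sum>j=1..M. \<epsilon> j * d ?L j) = (\<Sum>j=1..M. \<epsilon> j * truncated ?s' y j) - (\<Sum>j=1..M. \<epsilon> j * truncated ?s z j)"
      by (simp only: dL right_diff_distrib sum_subtractf)
    moreover have "(\<Sum>j=1..M. \<epsilon> j * d ?L j) \<le> t / 2 * (\<Sum>j=1..M. (d ?L j)\<^sup>2) + - ln (path_weight (Suc k) ?L) / t + Y \<epsilon>"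
      using x by (intro YL) blast
    ultimately show ?thesis
      unfolding \<eta>_def[symmetric] y_def[symmetric] z_def[symmetric] by linarith
  qed
  then show ?thesis using Y by (intro exI[of _ Y]) blast
qed

lemma chain_sum:
  assumes P: "finite P" "P \<subseteq> T" "P \<noteq> {}"
  shows "\<exists>Y. E Y \<le> 0 \<and> (\<forall>\<epsilon>. \<forall>x\<in>P.
    (\<Sum>j=1..M. \<epsilon> j * truncated (level K) (hd (code_path P K x)) j)
    \<le> a * 10^6 * S\<^sup>2 * (\<Lambda>\<^sup>2 * K + \<kappa>\<^sup>2) + 24 / a + Y \<epsilon>)"
proof -
  define \<Delta> where "\<Delta> k x = (\<Sum>j=1..M. truncated (level (Suc k)) x j - truncated (level k) x j)" for k x
  define B where "B k x = a * (224640 * (\<Lambda> * S)\<^sup>2 + 884736 * \<kappa>\<^sup>2 * \<Delta> k x)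
      + ((level k)\<^sup>2 * - ln (path_weight (Suc k) (code_path P (Suc k) x))) / a" for k x
  define X where "X k \<epsilon> x = (\<Sum>j=1..M. \<epsilon> j * truncated (level k) (hd (code_path P k x)) j)" for k \<epsilon> x
  have "\<forall>k. \<exists>Y. E Y \<le> 0 \<and> (\<forall>\<epsilon>. \<forall>x\<in>P. X (Suc k) \<epsilon> x - X k \<epsilon> x \<le> B k x + Y \<epsilon>)"
    using chain_step[OF P] unfolding X_def B_def \<Delta>_def by blast
  then have "\<exists>Y. \<forall>k. E (Y k) \<le> 0 \<and> (\<forall>\<epsilon>. \<forall>x\<in>P. X (Suc k) \<epsilon> x - X k \<epsilon> x \<le> B k x + Y k \<epsilon>)"
    by (rule choice)
  then obtain Y where Y: "\<And>k. E (Y k) \<le> 0"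
    and step: "\<And>k \<epsilon> x. x \<in> P \<Longrightarrow> X (Suc k) \<epsilon> x - X k \<epsilon> x \<le> B k x + Y k \<epsilon>"
    by blast
  have "X K \<epsilon> x \<le> a * 10^6 * S\<^sup>2 * (\<Lambda>\<^sup>2 * K + \<kappa>\<^sup>2) + 24 / a + (\<Sum>k<K. Y k \<epsilon>)" if x: "x \<in> P" for \<epsilon> x
  proof -
    have x0: "hd (code_path P 0 x) \<in> T"
      using hd_code_path_in[OF P(1,2) x, of 0] P(2) by blast
    \<comment> \<open>At scale 1 the threshold 768 \<kappa> exceeds every norm, so the chain starts
      from the zero process.\<close>
    have "truncated (level 0) (hd (code_path P 0 x)) j = 0" if "j \<in> {1..M}" for j
    proof -
      have "(N j (hd (code_path P 0 x)))\<^sup>2 \<le> (768 * \<kappa> * level 0)\<^sup>2"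
        using N_le_\<kappa>[OF x0 that] \<kappa>_pos N_nonneg[OF that] by (intro power_mono) (auto simp: level_def)
      then show ?thesis by (simp add: truncated_def del: code_path.simps)
    qed
    then have "X 0 \<epsilon> x = 0" by (simp add: X_def del: code_path.simps)
    then have "X K \<epsilon> x = (\<Sum>k<K. X (Suc k) \<epsilon> x - X k \<epsilon> x)"
      using sum_lessThan_telescope[of "\<lambda>k. X k \<epsilon> x" K] by simp
    also have "\<dots> \<le> (\<Sum>k<K. B k x + Y k \<epsilon>)"
      by (intro sum_mono step x)
    also have "\<dots> = (\<Sum>k<K. B k x) + (\<Sum>k<K. Y k \<epsilon>)"
      by (rule sum.distrib)
    also have "(\<Sum>k<K. B k x) = a * (224640 * (\<Lambda> * S)\<^sup>2 * K + 884736 * \<kappa>\<^sup>2 * (\<Sum>k<K. \<Delta> k x))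
        + (\<Sum>k<K. (level k)\<^sup>2 * - ln (path_weight (Suc k) (code_path P (Suc k) x))) / a"
      unfolding B_def
      by (simp add: sum.distrib sum_distrib_left[symmetric] sum_divide_distrib[symmetric] sum_negf
            sum_subtractf algebra_simps del: path_weight.simps code_path.simps)
         (simp add: sum_distrib_left sum_distrib_right mult_ac)
    also have "\<dots> \<le> a * (224640 * (\<Lambda> * S)\<^sup>2 * K + 884736 * \<kappa>\<^sup>2 * S\<^sup>2) + 24 / a"
      using a_pos P x sum_truncated_increment_le[of x K] code_path_cost_sum_le[OF P(1,2) x, of K]
      unfolding \<Delta>_def by (intro add_mono mult_left_mono divide_right_mono) auto
    also have "224640 * (\<Lambda> * S)\<^sup>2 * K + 884736 * \<kappa>\<^sup>2 * S\<^sup>2 \<le> 10^6 * S\<^sup>2 * (\<Lambda>\<^sup>2 * K + \<kappa>\<^sup>2)"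
    proof -
      have "0 \<le> 775360 * ((\<Lambda> * S)\<^sup>2 * K) + 115264 * (\<kappa> * S)\<^sup>2" by simp
      then show ?thesis by (simp add: power_mult_distrib algebra_simps)
    qed
    finally show ?thesis using a_pos by (simp add: mult.assoc)
  qed
  moreover have "E (\<lambda>\<epsilon>. \<Sum>k<K. Y k \<epsilon>) \<le> 0"
    using Y by (simp add: Bochner_Integration.integral_sum sum_nonpos)
  ultimately show ?thesis
    unfolding X_def by (intro exI[of _ "\<lambda>\<epsilon>. \<Sum>k<K. Y k \<epsilon>"]) blast
qed

text \<open>This restores the full N_j(x)^2 once s \<le> n^(-1/2). Uniform weights suffice, because
  ln (card P) = O(n) is affordable with t = a n. The part removed by truncation and the
  representation error both have sum of squares O(s^2), and n s^2 \<le> 1.\<close>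

lemma final_step:
  assumes P: "finite P" "P \<subseteq> T" "P \<noteq> {}" and K: "real n * (level K)\<^sup>2 \<le> 1" and card: "ln (real (card P)) \<le> 2 * real n"
  shows "\<exists>Y. E Y \<le> 0 \<and> (\<forall>\<epsilon>. \<forall>x\<in>P.
    (\<Sum>j=1..M. \<epsilon> j * ((N j x)\<^sup>2 - truncated (level K) (hd (code_path P K x)) j))
    \<le> a * 10^6 * S\<^sup>2 * (\<Lambda>\<^sup>2 + \<kappa>\<^sup>2) + 2 / a + Y \<epsilon>)"
proof -
  let ?s = "level K"
  define d where "d x j = (N j x)\<^sup>2 - truncated ?s (hd (code_path P K x)) j" for x j
  define t where "t = a * real n"
  have t: "t > 0" using a_pos n_pos by (simp add: t_def)
  have cP: "card P > 0" using P by (simp add: card_gt_0_iff)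
  have "\<exists>Y. E Y \<le> 0 \<and> (\<forall>\<epsilon>. \<forall>x\<in>P. (\<Sum>j=1..M. \<epsilon> j * d x j)
      \<le> t / 2 * (\<Sum>j=1..M. (d x j)\<^sup>2) + - ln (1 / card P) / t + Y \<epsilon>)"
    using P t cP by (intro rademacher_weighted_union_bound) auto
  then obtain Y where Y: "E Y \<le> 0" and Yx: "\<And>\<epsilon> x. x \<in> P \<Longrightarrow>
      (\<Sum>j=1..M. \<epsilon> j * d x j) \<le> t / 2 * (\<Sum>j=1..M. (d x j)\<^sup>2) + - ln (1 / card P) / t + Y \<epsilon>"
    by blast
  have "(\<Sum>j=1..M. \<epsilon> j * d x j) \<le> a * 10^6 * S\<^sup>2 * (\<Lambda>\<^sup>2 + \<kappa>\<^sup>2) + 2 / a + Y \<epsilon>" if x: "x \<in> P" for \<epsilon> x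
  proof -
    define z where "z = hd (code_path P K x)"
    have xT: "x \<in> T" using x P by blast
    have "(\<Sum>j=1..M. (d x j)\<^sup>2)
        \<le> (\<Sum>j=1..M. 2 * ((768 * \<kappa> * ?s)\<^sup>2 * (N j x)\<^sup>2 + (truncated ?s x j - truncated ?s z j)\<^sup>2))"
    proof (rule sum_mono)
      fix j
      have "d x j = ((N j x)\<^sup>2 - truncated ?s x j) + (truncated ?s x j - truncated ?s z j)"
        by (simp add: d_def z_def)
      then have *: "(d x j)\<^sup>2 \<le> 2 * (((N j x)\<^sup>2 - truncated ?s x j)\<^sup>2 + (truncated ?s x j - truncated ?s z j)\<^sup>2)"
        using square_of_sum2_le by presburger
      have **: "((N j x)\<^sup>2 - truncated ?s x j)\<^sup>2 \<le> (768 * \<kappa> * ?s)\<^sup>2 * (N j x)\<^sup>2"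
        using truncated_bounds[where j = j and x = x and s = ?s] unfolding power2_eq_square[of "(N j x)\<^sup>2 - truncated ?s x j"]
        by (intro mult_mono) auto
      show "(d x j)\<^sup>2 \<le> 2 * ((768 * \<kappa> * ?s)\<^sup>2 * (N j x)\<^sup>2 + (truncated ?s x j - truncated ?s z j)\<^sup>2)"
        by (rule order_trans[OF * mult_left_mono[OF add_right_mono[OF **]]]) simp
    qed
    also have "\<dots> = 2 * ((768 * \<kappa> * ?s)\<^sup>2 * (\<Sum>j=1..M. (N j x)\<^sup>2) + (\<Sum>j=1..M. (truncated ?s x j - truncated ?s z j)\<^sup>2))"
      by (simp only: sum.distrib sum_distrib_left[symmetric])
    also have "\<dots> \<le> 2 * ((768 * \<kappa> * ?s)\<^sup>2 * S\<^sup>2 + (384 * \<Lambda> * S * ?s)\<^sup>2)"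
      using close_code_path[OF P(1,2) x] sum_N_square_le[OF xT] unfolding z_def
      by (intro mult_left_mono add_mono sum_truncated_diff_le) auto
    also have "\<dots> = 2 * (589824 * \<kappa>\<^sup>2 + 147456 * \<Lambda>\<^sup>2) * S\<^sup>2 * ?s\<^sup>2"
      by (simp add: power2_eq_square algebra_simps)
    finally have "t / 2 * (\<Sum>j=1..M. (d x j)\<^sup>2) \<le> t / 2 * (2 * (589824 * \<kappa>\<^sup>2 + 147456 * \<Lambda>\<^sup>2) * S\<^sup>2 * ?s\<^sup>2)"
      using t by (intro mult_left_mono) auto
    also have "\<dots> = (a * (589824 * \<kappa>\<^sup>2 + 147456 * \<Lambda>\<^sup>2) * S\<^sup>2) * (real n * ?s\<^sup>2)"
      by (simp add: t_def)
    also have "\<dots> \<le> (a * (589824 * \<kappa>\<^sup>2 + 147456 * \<Lambda>\<^sup>2) * S\<^sup>2) * 1"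
      using a_pos by (intro mult_left_mono K) auto
    also have "\<dots> \<le> (a * (10^6 * (\<Lambda>\<^sup>2 + \<kappa>\<^sup>2)) * S\<^sup>2) * 1"
      using a_pos by (intro mult_right_mono mult_left_mono) (auto simp: distrib_left intro!: add_mono)
    finally have "t / 2 * (\<Sum>j=1..M. (d x j)\<^sup>2) \<le> a * 10^6 * S\<^sup>2 * (\<Lambda>\<^sup>2 + \<kappa>\<^sup>2)"
      by (simp add: mult_ac)
    moreover have "- ln (1 / card P) / t \<le> 2 / a"
      using card cP a_pos n_pos by (simp add: ln_div t_def field_simps)
    ultimately show ?thesis using Yx[OF x, of \<epsilon>] by linarith
  qed
  then show ?thesis using Y unfolding d_def by (intro exI[of _ Y]) blast
qed

text \<open>A union bound over neighbouring net points with uniform weights. The squared increments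
  are of order \<kappa>^2 S^2 4^(-i) / n and the code length of order n (i + 1), so t = a n 2^i
  makes both contributions summable in i; the uniform bound by \<kappa> is enough here, without
  \<Lambda>.\<close>

lemma tail_step:
  assumes V: "finite V" "V \<subseteq> T" "finite V'" "V' \<subseteq> T"
    and card: "ln (real (card V)) \<le> real n * (real i + 2)" "ln (real (card V')) \<le> real n * (real i + 3)"
    and in_noise: "(u, v) \<in> Q" "Q \<subseteq> V \<times> V'"
      "\<And>u v j. (u, v) \<in> Q \<Longrightarrow> j \<in> {1..M} \<Longrightarrow> N j (u - v) \<le> 12 * \<kappa> * ((1 / 2) ^ i / sqrt (real n))"
  shows "\<exists>Y. E Y \<le> 0 \<and> (\<forall>\<epsilon>. \<forall>(u, v)\<in>Q. (\<Sum>j=1..M. \<epsilon> j * (N j v)\<^sup>2) - (\<Sum>j=1..M. \<epsilon> j * (N j u)\<^sup>2)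
    \<le> 288 * a * \<kappa>\<^sup>2 * S\<^sup>2 * (1 / 2) ^ i + (2 * real i + 5) / 2 ^ i / a + Y \<epsilon>)"
proof -
  define d where "d p j = (N j (snd p))\<^sup>2 - (N j (fst p))\<^sup>2" for p j
  define t where "t = a * real n * 2 ^ i"
  have t: "t > 0" using a_pos n_pos by (simp add: t_def)
  have fQ: "finite Q" "Q \<noteq> {}"
    using in_noise V finite_subset[of Q "V \<times> V'"] by auto
  have cV: "card V > 0" "card V' > 0"
    using in_noise V by (auto simp: card_gt_0_iff)
  have "(\<Sum>p\<in>Q. 1 / (real (card V) * real (card V'))) \<le> 1"
  proof -
    have "card Q \<le> card (V \<times> V')" using in_noise V by (intro card_mono) auto
    then have "real (card Q) \<le> real (card V) * real (card V')"
      by (simp add: card_cartesian_product flip: of_nat_mult)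
    then show ?thesis using cV by (simp add: divide_le_eq)
  qed
  then have "\<exists>Y. E Y \<le> 0 \<and> (\<forall>\<epsilon>. \<forall>p\<in>Q. (\<Sum>j=1..M. \<epsilon> j * d p j)
      \<le> t / 2 * (\<Sum>j=1..M. (d p j)\<^sup>2) + - ln (1 / (real (card V) * real (card V'))) / t + Y \<epsilon>)"
    using fQ t cV by (intro rademacher_weighted_union_bound) auto
  then obtain Y where Y: "E Y \<le> 0" and Yp: "\<And>\<epsilon> p. p \<in> Q \<Longrightarrow>
      (\<Sum>j=1..M. \<epsilon> j * d p j) \<le> t / 2 * (\<Sum>j=1..M. (d p j)\<^sup>2) + - ln (1 / (real (card V) * real (card V'))) / t + Y \<epsilon>"
    by blast
  have "(\<Sum>j=1..M. \<epsilon> j * (N j v)\<^sup>2) - (\<Sum>j=1..M. \<epsilon> j * (N j u)\<^sup>2)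
    \<le> 288 * a * \<kappa>\<^sup>2 * S\<^sup>2 * (1 / 2) ^ i + (2 * real i + 5) / 2 ^ i / a + Y \<epsilon>" if uv: "(u, v) \<in> Q" for \<epsilon> u v
  proof -
    define \<tau> where "\<tau> = (1 / 2) ^ i / sqrt (real n)"
    have \<tau>: "\<tau> > 0" "\<tau>\<^sup>2 * (real n * 2 ^ i) = (1 / 2) ^ i"
      using n_pos by (auto simp: \<tau>_def power_divide power_mult[symmetric] power2_eq_square field_simps)
    have uvT: "u \<in> T" "v \<in> T" using uv in_noise V by auto
    have "(\<Sum>j=1..M. (d (u, v) j)\<^sup>2) \<le> (\<Sum>j=1..M. (12 * \<kappa> * \<tau>)\<^sup>2 * (2 * ((N j u)\<^sup>2 + (N j v)\<^sup>2)))"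
    proof (rule sum_mono)
      fix j assume j: "j \<in> {1..M}"
      have "\<bar>N j v - N j u\<bar> \<le> 12 * \<kappa> * \<tau>"
        using N_abs_diff[OF j, of v u] N_diff_commute[OF j, of v u] in_noise(3)[OF uv j] by (simp add: \<tau>_def)
      then have "(N j v - N j u)\<^sup>2 \<le> (12 * \<kappa> * \<tau>)\<^sup>2"
        by (metis abs_ge_zero power2_abs power_mono)
      then have "(N j v - N j u)\<^sup>2 * (N j u + N j v)\<^sup>2 \<le> (12 * \<kappa> * \<tau>)\<^sup>2 * (2 * ((N j u)\<^sup>2 + (N j v)\<^sup>2))"
        by (intro mult_mono square_of_sum2_le) auto
      moreover have "d (u, v) j = (N j v - N j u) * (N j u + N j v)"
        by (simp add: d_def power2_eq_square algebra_simps)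
      ultimately show "(d (u, v) j)\<^sup>2 \<le> (12 * \<kappa> * \<tau>)\<^sup>2 * (2 * ((N j u)\<^sup>2 + (N j v)\<^sup>2))"
        by (simp add: power_mult_distrib)
    qed
    also have "\<dots> = (12 * \<kappa> * \<tau>)\<^sup>2 * (2 * ((\<Sum>j=1..M. (N j u)\<^sup>2) + (\<Sum>j=1..M. (N j v)\<^sup>2)))"
      by (simp only: sum.distrib sum_distrib_left[symmetric])
    also have "\<dots> \<le> (12 * \<kappa> * \<tau>)\<^sup>2 * (2 * (S\<^sup>2 + S\<^sup>2))"
      using uvT by (intro mult_left_mono add_mono sum_N_square_le) auto
    finally have "t / 2 * (\<Sum>j=1..M. (d (u, v) j)\<^sup>2) \<le> t / 2 * ((12 * \<kappa> * \<tau>)\<^sup>2 * (2 * (S\<^sup>2 + S\<^sup>2)))"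
      using t by (intro mult_left_mono) auto
    also have "\<dots> = 288 * a * \<kappa>\<^sup>2 * S\<^sup>2 * (\<tau>\<^sup>2 * (real n * 2 ^ i))"
      by (simp add: t_def power_mult_distrib)
    also have "\<dots> = 288 * a * \<kappa>\<^sup>2 * S\<^sup>2 * (1 / 2) ^ i"
      by (simp only: \<tau>)
    finally have "t / 2 * (\<Sum>j=1..M. (d (u, v) j)\<^sup>2) \<le> 288 * a * \<kappa>\<^sup>2 * S\<^sup>2 * (1 / 2) ^ i" .
    moreover have "- ln (1 / (real (card V) * real (card V'))) / t \<le> (2 * real i + 5) / 2 ^ i / a"
    proof -
      have "- ln (1 / (real (card V) * real (card V'))) = ln (card V) + ln (card V')"
        using cV by (simp add: ln_div ln_mult)
      also have "\<dots> \<le> real n * (2 * real i + 5)"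
        using card by (simp add: algebra_simps)
      finally have "- ln (1 / (real (card V) * real (card V'))) / t \<le> real n * (2 * real i + 5) / t"
        using t by (intro divide_right_mono) auto
      also have "\<dots> = (2 * real i + 5) / 2 ^ i / a"
        using n_pos a_pos by (simp add: t_def field_simps)
      finally show ?thesis .
    qed
    moreover have "(\<Sum>j=1..M. \<epsilon> j * d (u, v) j) = (\<Sum>j=1..M. \<epsilon> j * (N j v)\<^sup>2) - (\<Sum>j=1..M. \<epsilon> j * (N j u)\<^sup>2)"
      by (simp add: d_def right_diff_distrib sum_subtractf)
    ultimately show ?thesis using Yp[OF uv, of \<epsilon>] by linarith
  qed
  then show ?thesis using Y by (intro exI[of _ Y]) blast
qed

end

context norm_family
begin

text \<open>The auxiliary standard deviation 2^i makes s \<tau> = n^(-1/2) for every i: the Gaussian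
  factor costs n/2 in the logarithm, and the volume factor s^n costs i n ln 2.\<close>

lemma exists_scaled_net:
  assumes "T \<noteq> {}"
  shows "\<exists>V. finite V \<and> V \<subseteq> T \<and> ln (real (card V)) \<le> real n * (real i + 2)
    \<and> (\<forall>x\<in>T. \<exists>v\<in>V. \<forall>j\<in>J. N j (x - v) \<le> 8 * \<kappa> * ((1 / 2) ^ i / sqrt (real n)))"
proof -
  let ?\<tau> = "(1 / 2) ^ i / sqrt (real n)"
  have "?\<tau> > 0" using n_pos by simp
  then obtain V where V: "finite V" "V \<subseteq> T"
      "real (card V) * exp (- 1 / (2 * (2 ^ i * ?\<tau>)\<^sup>2)) \<le> 2 * (2 ^ i) ^ n"
      "\<forall>x\<in>T. \<exists>v\<in>V. \<forall>j\<in>J. N j (x - v) \<le> 8 * \<kappa> * ?\<tau>"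
    using exists_net[of "2 ^ i" ?\<tau>] by auto
  have card: "card V > 0"
    using V(1,4) assms by (auto simp: card_gt_0_iff)
  have scale: "2 ^ i * ?\<tau> = 1 / sqrt (real n)"
    by (simp add: power_one_over)
  have "real (card V) * exp (- real n / 2) \<le> 2 * (2 ^ i) ^ n"
    using V(3) unfolding scale by (simp add: power_divide)
  then have "ln (real (card V) * exp (- real n / 2)) \<le> ln (2 * (2 ^ i) ^ n)"
    using card by (subst ln_le_cancel_iff) auto
  then have "ln (real (card V)) \<le> ln 2 + real n * (real i * ln 2) + real n / 2"
    using card by (simp add: ln_mult ln_realpow)
  also have "\<dots> \<le> 1 + real n * (real i * 1) + real n / 2"
    using ln_le_minus_one[of "2::real"] by (intro add_mono mult_left_mono) auto
  also have "\<dots> \<le> real n * (real i + 2)"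
    using n_pos by (simp add: algebra_simps)
  finally show ?thesis using V by blast
qed

end

context rademacher_norm_family
begin

lemma tail_sum:
  assumes T: "T \<noteq> {}" and V: "\<And>i. finite (V i)" "\<And>i. V i \<subseteq> T"
    and card: "\<And>i. ln (real (card (V i))) \<le> real n * (real i + 2)"
    and \<pi>: "\<And>i x. x \<in> T \<Longrightarrow> \<pi> i x \<in> V i"
      "\<And>i x j. x \<in> T \<Longrightarrow> j \<in> {1..M} \<Longrightarrow> N j (x - \<pi> i x) \<le> 8 * \<kappa> * ((1 / 2) ^ i / sqrt (real n))"
  shows "\<exists>Y. E Y \<le> 0 \<and> (\<forall>\<epsilon>. \<forall>x\<in>T.
    (\<Sum>j=1..M. \<epsilon> j * (N j (\<pi> L x))\<^sup>2) - (\<Sum>j=1..M. \<epsilon> j * (N j (\<pi> 0 x))\<^sup>2)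
    \<le> 576 * a * \<kappa>\<^sup>2 * S\<^sup>2 + 14 / a + Y \<epsilon>)"
proof -
  define Q where "Q i = {(u, v) \<in> V i \<times> V (Suc i). \<forall>j\<in>{1..M}. N j (u - v) \<le> 12 * \<kappa> * ((1 / 2) ^ i / sqrt (real n))}" for i
  have Q: "(\<pi> i x, \<pi> (Suc i) x) \<in> Q i" if x: "x \<in> T" for i x
  proof -
    \<comment> \<open>12 = 8 + 4, the distances of x from the nets i and i + 1.\<close>
    have "N j (\<pi> i x - \<pi> (Suc i) x) \<le> 12 * \<kappa> * ((1 / 2) ^ i / sqrt (real n))" if j: "j \<in> {1..M}" for j
      using N_triangle[OF j, of "\<pi> i x" "\<pi> (Suc i) x" x] N_diff_commute[OF j, of "\<pi> i x" x]
        \<pi>(2)[OF x j, of i] \<pi>(2)[OF x j, of "Suc i"] by simp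
    then show ?thesis using \<pi>(1)[OF x] by (auto simp: Q_def)
  qed
  define B where "B i = 288 * a * \<kappa>\<^sup>2 * S\<^sup>2 * (1 / 2) ^ i + (2 * real i + 5) / 2 ^ i / a" for i :: nat
  define X where "X i \<epsilon> x = (\<Sum>j=1..M. \<epsilon> j * (N j (\<pi> i x))\<^sup>2)" for i \<epsilon> x
  obtain x0 where x0: "x0 \<in> T" using T by blast
  have "\<forall>i. \<exists>Y. E Y \<le> 0 \<and> (\<forall>\<epsilon>. \<forall>x\<in>T. X (Suc i) \<epsilon> x - X i \<epsilon> x \<le> B i + Y \<epsilon>)"
  proof
    fix i
    have "\<exists>Y. E Y \<le> 0 \<and> (\<forall>\<epsilon>. \<forall>(u, v)\<in>Q i. (\<Sum>j=1..M. \<epsilon> j * (N j v)\<^sup>2) - (\<Sum>j=1..M. \<epsilon> j * (N j u)\<^sup>2) \<le> B i + Y \<epsilon>)"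
      unfolding B_def
    proof (rule tail_step[of "V i" "V (Suc i)"])
      show "ln (real (card (V (Suc i)))) \<le> real n * (real i + 3)"
        using card[of "Suc i"] by (simp add: add.commute)
      show "(\<pi> i x0, \<pi> (Suc i) x0) \<in> Q i" by (rule Q[OF x0])
    qed (use V card in \<open>auto simp: Q_def\<close>)
    then show "\<exists>Y. E Y \<le> 0 \<and> (\<forall>\<epsilon>. \<forall>x\<in>T. X (Suc i) \<epsilon> x - X i \<epsilon> x \<le> B i + Y \<epsilon>)"
      unfolding X_def using Q by fast
  qed
  then have "\<exists>Y. \<forall>i. E (Y i) \<le> 0 \<and> (\<forall>\<epsilon>. \<forall>x\<in>T. X (Suc i) \<epsilon> x - X i \<epsilon> x \<le> B i + Y i \<epsilon>)"
    by (rule choice)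
  then obtain Y where Y: "\<And>i. E (Y i) \<le> 0"
    and step: "\<And>i \<epsilon> x. x \<in> T \<Longrightarrow> X (Suc i) \<epsilon> x - X i \<epsilon> x \<le> B i + Y i \<epsilon>"
    by blast
  have sumB: "(\<Sum>i<L. B i) \<le> 576 * a * \<kappa>\<^sup>2 * S\<^sup>2 + 14 / a"
  proof -
    have "(\<Sum>i<L. B i) = 288 * a * \<kappa>\<^sup>2 * S\<^sup>2 * (\<Sum>i<L. (1 / 2) ^ i) + (\<Sum>i<L. (2 * real i + 5) / 2 ^ i) / a"
      unfolding B_def by (simp only: sum.distrib sum_distrib_left sum_divide_distrib)
    also have "\<dots> \<le> 288 * a * \<kappa>\<^sup>2 * S\<^sup>2 * 2 + 14 / a"
      unfolding sum_linear_over_power2 using a_pos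
      by (intro add_mono mult_left_mono sum_geometric_le_2 divide_right_mono) auto
    finally show ?thesis by simp
  qed
  have "X L \<epsilon> x - X 0 \<epsilon> x \<le> 576 * a * \<kappa>\<^sup>2 * S\<^sup>2 + 14 / a + (\<Sum>i<L. Y i \<epsilon>)" if x: "x \<in> T" for \<epsilon> x
  proof -
    have "X L \<epsilon> x - X 0 \<epsilon> x = (\<Sum>i<L. X (Suc i) \<epsilon> x - X i \<epsilon> x)"
      by (rule sum_lessThan_telescope[of "\<lambda>i. X i \<epsilon> x" L, symmetric])
    also have "\<dots> \<le> (\<Sum>i<L. B i + Y i \<epsilon>)"
      by (intro sum_mono step x)
    finally show ?thesis using sumB by (simp add: sum.distrib)
  qed
  moreover have "E (\<lambda>\<epsilon>. \<Sum>i<L. Y i \<epsilon>) \<le> 0"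
    using Y by (simp add: Bochner_Integration.integral_sum sum_nonpos)
  ultimately show ?thesis
    unfolding X_def by (intro exI[of _ "\<lambda>\<epsilon>. \<Sum>i<L. Y i \<epsilon>"]) blast
qed

text \<open>The tree of paths needs a finite set, so it is built over the coarsest net
  \<open>P = V 0\<close>; the finer nets connect an arbitrary x in T to P. The residual beyond net L
  is deterministic and can be made smaller than any e. The costs add up to 40 = 24 + 2 + 14.\<close>

lemma expectation_Sup_le:
  assumes T: "T \<noteq> {}" and K: "real n \<le> 64 ^ K"
  shows "E (\<lambda>\<epsilon>. SUP x\<in>T. \<Sum>j=1..M. \<epsilon> j * (N j x)\<^sup>2)
    \<le> a * (3 * 10^6) * S\<^sup>2 * (\<Lambda>\<^sup>2 * (real K + 1) + \<kappa>\<^sup>2) + 40 / a"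
proof (rule field_le_epsilon)
  fix e :: real assume e: "e > 0"
  have "\<exists>V. \<forall>i. finite (V i) \<and> V i \<subseteq> T \<and> ln (real (card (V i))) \<le> real n * (real i + 2)
    \<and> (\<forall>x\<in>T. \<exists>v\<in>V i. \<forall>j\<in>{1..M}. N j (x - v) \<le> 8 * \<kappa> * ((1 / 2) ^ i / sqrt (real n)))"
    using exists_scaled_net[OF T] by (intro choice allI)
  then obtain V where V: "\<And>i. finite (V i)" "\<And>i. V i \<subseteq> T" "\<And>i. ln (real (card (V i))) \<le> real n * (real i + 2)"
    and Vx: "\<And>i x. x \<in> T \<Longrightarrow> \<exists>v\<in>V i. \<forall>j\<in>{1..M}. N j (x - v) \<le> 8 * \<kappa> * ((1 / 2) ^ i / sqrt (real n))"
    by blast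
  define \<pi> where "\<pi> i x = (SOME v. v \<in> V i \<and> (\<forall>j\<in>{1..M}. N j (x - v) \<le> 8 * \<kappa> * ((1 / 2) ^ i / sqrt (real n))))" for i x
  have \<pi>: "\<pi> i x \<in> V i \<and> (\<forall>j\<in>{1..M}. N j (x - \<pi> i x) \<le> 8 * \<kappa> * ((1 / 2) ^ i / sqrt (real n)))" if "x \<in> T" for i x
    unfolding \<pi>_def using Vx[OF that, of i] unfolding Bex_def by (rule someI_ex)
  \<comment> \<open>On the last net the norms differ by at most 8 \<kappa> 2^(-L) and their sums are
    at most 16 \<kappa>, whence 128. The factor M does no harm, since L appears in no other
    bound.\<close>
  obtain L where L: "real M * (128 * \<kappa>\<^sup>2) * (1 / 2) ^ L \<le> e"
  proof -
    have "(\<lambda>L. real M * (128 * \<kappa>\<^sup>2) * (1 / 2) ^ L) \<longlonglongrightarrow> real M * (128 * \<kappa>\<^sup>2) * 0"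
      by (intro tendsto_mult tendsto_const LIMSEQ_power_zero) auto
    then have "\<forall>\<^sub>F L in sequentially. real M * (128 * \<kappa>\<^sup>2) * (1 / 2) ^ L < e"
      using e by (intro order_tendstoD(2)[where a = e]) auto
    then show ?thesis using that by (auto simp: eventually_sequentially intro: less_imp_le)
  qed
  define P where "P = V 0"
  have P: "finite P" "P \<subseteq> T" "P \<noteq> {}"
  proof -
    obtain x where "x \<in> T" using T by blast
    then show "P \<noteq> {}" using \<pi>[of x 0] unfolding P_def by blast
  qed (use V in \<open>auto simp: P_def\<close>)
  have nK: "real n * (level K)\<^sup>2 \<le> 1"
    using K by (simp add: level_power2 power_one_over field_simps)
  obtain Y1 where Y1: "E Y1 \<le> 0" "\<And>\<epsilon> x. x \<in> P \<Longrightarrow>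
    (\<Sum>j=1..M. \<epsilon> j * truncated (level K) (hd (code_path P K x)) j) \<le> a * 10^6 * S\<^sup>2 * (\<Lambda>\<^sup>2 * K + \<kappa>\<^sup>2) + 24 / a + Y1 \<epsilon>"
    using chain_sum[OF P, of K] by blast
  obtain Y2 where Y2: "E Y2 \<le> 0" "\<And>\<epsilon> x. x \<in> P \<Longrightarrow>
    (\<Sum>j=1..M. \<epsilon> j * ((N j x)\<^sup>2 - truncated (level K) (hd (code_path P K x)) j)) \<le> a * 10^6 * S\<^sup>2 * (\<Lambda>\<^sup>2 + \<kappa>\<^sup>2) + 2 / a + Y2 \<epsilon>"
    using final_step[OF P nK] V(3)[of 0] by (auto simp: P_def mult.commute)
  obtain Y3 where Y3: "E Y3 \<le> 0" "\<And>\<epsilon> x. x \<in> T \<Longrightarrow>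
    (\<Sum>j=1..M. \<epsilon> j * (N j (\<pi> L x))\<^sup>2) - (\<Sum>j=1..M. \<epsilon> j * (N j (\<pi> 0 x))\<^sup>2) \<le> 576 * a * \<kappa>\<^sup>2 * S\<^sup>2 + 14 / a + Y3 \<epsilon>"
    using tail_sum[OF T V, of \<pi> L] \<pi> by blast
  define B where "B = a * (3 * 10^6) * S\<^sup>2 * (\<Lambda>\<^sup>2 * (real K + 1) + \<kappa>\<^sup>2) + 40 / a"
  have bound: "(\<Sum>j=1..M. \<epsilon> j * (N j x)\<^sup>2) \<le> B + e + (Y1 \<epsilon> + Y2 \<epsilon> + Y3 \<epsilon>)"
    if \<epsilon>: "\<epsilon> \<in> set_pmf (rademacher M)" and x: "x \<in> T" for \<epsilon> x
  proof -
    have \<epsilon>_le: "\<bar>\<epsilon> j\<bar> \<le> 1" if "j \<in> {1..M}" for j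
      using \<epsilon> that by (auto simp: rademacher_def set_Pi_pmf PiE_dflt_def)
    define z where "z = \<pi> L x"
    have z: "z \<in> T" using \<pi>[OF x, of L] V(2) by (auto simp: z_def)
    have "(\<Sum>j=1..M. \<epsilon> j * (N j x)\<^sup>2) - (\<Sum>j=1..M. \<epsilon> j * (N j z)\<^sup>2) = (\<Sum>j=1..M. \<epsilon> j * ((N j x)\<^sup>2 - (N j z)\<^sup>2))"
      by (simp add: sum_subtractf right_diff_distrib)
    also have "\<dots> \<le> (\<Sum>j=1..M. 128 * \<kappa>\<^sup>2 * (1 / 2) ^ L)"
    proof (rule sum_mono)
      fix j assume j: "j \<in> {1..M}"
      have "\<epsilon> j * ((N j x)\<^sup>2 - (N j z)\<^sup>2) \<le> \<bar>\<epsilon> j\<bar> * \<bar>(N j x)\<^sup>2 - (N j z)\<^sup>2\<bar>"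
        by (simp flip: abs_mult)
      also have "\<dots> \<le> 1 * \<bar>(N j x)\<^sup>2 - (N j z)\<^sup>2\<bar>"
        by (intro mult_right_mono \<epsilon>_le j) auto
      also have "\<dots> = \<bar>N j x - N j z\<bar> * \<bar>N j x + N j z\<bar>"
        by (simp add: power2_eq_square square_diff_square_factored abs_mult mult.commute)
      also have "\<dots> \<le> (8 * \<kappa> * ((1 / 2) ^ L / sqrt (real n))) * (16 * \<kappa>)"
      proof (intro mult_mono)
        show "\<bar>N j x - N j z\<bar> \<le> 8 * \<kappa> * ((1 / 2) ^ L / sqrt (real n))"
          using N_abs_diff[OF j, of x z] \<pi>[OF x, of L] j by (force simp: z_def)
        show "\<bar>N j x + N j z\<bar> \<le> 16 * \<kappa>"
          using N_le_\<kappa>[OF x j] N_le_\<kappa>[OF z j] N_nonneg[OF j, of x] N_nonneg[OF j, of z] by simp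
      qed (use \<kappa>_pos in auto)
      also have "\<dots> \<le> (8 * \<kappa> * ((1 / 2) ^ L / 1)) * (16 * \<kappa>)"
        using n_pos \<kappa>_pos by (intro mult_right_mono mult_left_mono divide_left_mono) auto
      also have "\<dots> = 128 * \<kappa>\<^sup>2 * (1 / 2) ^ L"
        by (simp add: power2_eq_square)
      finally show "\<epsilon> j * ((N j x)\<^sup>2 - (N j z)\<^sup>2) \<le> 128 * \<kappa>\<^sup>2 * (1 / 2) ^ L" .
    qed
    also have "\<dots> \<le> e" using L by (simp add: mult.assoc)
    finally have residual: "(\<Sum>j=1..M. \<epsilon> j * (N j x)\<^sup>2) - (\<Sum>j=1..M. \<epsilon> j * (N j z)\<^sup>2) \<le> e" .
    define p where "p = \<pi> 0 x"
    have p: "p \<in> P" using \<pi>[OF x, of 0] by (simp add: p_def P_def)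
    have split: "(\<Sum>j=1..M. \<epsilon> j * ((N j p)\<^sup>2 - truncated (level K) (hd (code_path P K p)) j))
        = (\<Sum>j=1..M. \<epsilon> j * (N j p)\<^sup>2) - (\<Sum>j=1..M. \<epsilon> j * truncated (level K) (hd (code_path P K p)) j)"
      by (simp only: right_diff_distrib sum_subtractf)
    have sum: "(\<Sum>j=1..M. \<epsilon> j * (N j x)\<^sup>2)
        \<le> (a * 10^6 * S\<^sup>2 * (\<Lambda>\<^sup>2 * K + \<kappa>\<^sup>2) + 24 / a) + (a * 10^6 * S\<^sup>2 * (\<Lambda>\<^sup>2 + \<kappa>\<^sup>2) + 2 / a)
          + (576 * a * \<kappa>\<^sup>2 * S\<^sup>2 + 14 / a) + e + (Y1 \<epsilon> + Y2 \<epsilon> + Y3 \<epsilon>)"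
      using residual Y1(2)[OF p, of \<epsilon>] Y2(2)[OF p, of \<epsilon>] Y3(2)[OF x, of \<epsilon>] split
      unfolding z_def[symmetric] p_def[symmetric] by linarith
    have "0 \<le> a * S\<^sup>2 * \<kappa>\<^sup>2" "0 \<le> a * S\<^sup>2 * \<Lambda>\<^sup>2 * (real K + 1)"
      using a_pos by auto
    then have "(a * 10^6 * S\<^sup>2 * (\<Lambda>\<^sup>2 * K + \<kappa>\<^sup>2) + 24 / a) + (a * 10^6 * S\<^sup>2 * (\<Lambda>\<^sup>2 + \<kappa>\<^sup>2) + 2 / a)
          + (576 * a * \<kappa>\<^sup>2 * S\<^sup>2 + 14 / a) \<le> B"
      by (simp add: B_def algebra_simps)
    then show ?thesis using sum by linarith
  qed
  have "E (\<lambda>\<epsilon>. SUP x\<in>T. \<Sum>j=1..M. \<epsilon> j * (N j x)\<^sup>2) \<le> E (\<lambda>\<epsilon>. B + e + (Y1 \<epsilon> + Y2 \<epsilon> + Y3 \<epsilon>))"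
    using T bound by (intro integral_mono_AE AE_pmfI cSUP_least) auto
  also have "\<dots> = B + e + (E Y1 + E Y2 + E Y3)"
    by simp
  also have "\<dots> \<le> B + e"
    using Y1 Y2 Y3 by linarith
  finally show "E (\<lambda>\<epsilon>. SUP x\<in>T. \<Sum>j=1..M. \<epsilon> j * (N j x)\<^sup>2)
    \<le> a * (3 * 10^6) * S\<^sup>2 * (\<Lambda>\<^sup>2 * (real K + 1) + \<kappa>\<^sup>2) + 40 / a + e"
    by (simp only: B_def)
qed

end

lemma rademacher_Sup_le:
  assumes family: "norm_family n {1..M} N \<kappa> \<Lambda> S T" and T: "T \<noteq> {}"
  shows "measure_pmf.expectation (rademacher M) (\<lambda>\<epsilon>. SUP x\<in>T. \<Sum>j=1..M. \<epsilon> j * (N j x)\<^sup>2)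
    \<le> 43000 * S * (\<Lambda> * sqrt (ln (real n) + 2) + \<kappa>)"
proof -
  note n_pos = norm_family.n_pos[OF family] and \<kappa>_pos = norm_family.\<kappa>_pos[OF family]
    and \<Lambda>_pos = norm_family.\<Lambda>_pos[OF family] and S_pos = norm_family.S_pos[OF family]
  \<comment> \<open>Enough scales to pass n^(-1/2): n \<le> e^K \<le> 64^K gives 8^(-K) \<le>
    n^(-1/2).\<close>
  define K where "K = nat \<lceil>ln (real n)\<rceil>"
  have ln_n: "0 \<le> ln (real n)" using n_pos by simp
  have K_le: "real K \<le> ln (real n) + 1" "ln (real n) \<le> real K"
    using ln_n unfolding K_def by linarith+
  have "real n = exp (ln (real n))" using n_pos by simp
  also have "\<dots> \<le> exp (real K)" using K_le by simp
  also have "\<dots> = exp 1 ^ K" by (simp add: exp_of_nat_mult[symmetric])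
  also have "\<dots> \<le> 64 ^ K" using exp_le by (intro power_mono) auto
  finally have nK: "real n \<le> 64 ^ K" .
  define D where "D = sqrt (\<Lambda>\<^sup>2 * (real K + 1) + \<kappa>\<^sup>2)"
  have D2: "D\<^sup>2 = \<Lambda>\<^sup>2 * (real K + 1) + \<kappa>\<^sup>2" by (simp add: D_def)
  have "D > 0" unfolding D_def using \<kappa>_pos by (intro real_sqrt_gt_zero add_nonneg_pos) auto
  \<comment> \<open>Of the optimal order for the two terms: they become 3000 S D and 40000 S
    D.\<close>
  define a where "a = 1 / (1000 * S * D)"
  have a: "a > 0" using S_pos \<open>D > 0\<close> by (simp add: a_def)
  interpret rademacher_norm_family n M N \<kappa> \<Lambda> S T a
    using family a by (intro rademacher_norm_family.intro rademacher_norm_family_axioms.intro)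
  have "measure_pmf.expectation (rademacher M) (\<lambda>\<epsilon>. SUP x\<in>T. \<Sum>j=1..M. \<epsilon> j * (N j x)\<^sup>2)
      \<le> a * (3 * 10^6) * S\<^sup>2 * D\<^sup>2 + 40 / a"
    unfolding D2 by (rule expectation_Sup_le[OF T nK])
  also have "\<dots> = 43000 * S * D"
    using S_pos \<open>D > 0\<close> by (simp add: a_def field_simps power2_eq_square)
  also have "D \<le> sqrt (\<Lambda>\<^sup>2 * (real K + 1)) + sqrt (\<kappa>\<^sup>2)"
    unfolding D_def by (intro sqrt_add_le_add_sqrt) auto
  also have "\<dots> \<le> \<Lambda> * sqrt (ln (real n) + 2) + \<kappa>"
    using \<Lambda>_pos \<kappa>_pos K_le by (simp add: real_sqrt_mult)
  finally show ?thesis using S_pos by simp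
qed

subsection \<open>Norms of Gaussian vectors\<close>

lemma has_bochner_integral_std_gaussian_component:
  assumes i: "i < n" and f: "f \<in> borel_measurable borel"
    and int: "has_bochner_integral lborel (\<lambda>t. std_normal_density t * f t) c"
  shows "has_bochner_integral (std_gaussian n) (\<lambda>x. f (x i)) (c::real)"
proof -
  let ?M = "density lborel std_normal_density"
  have "has_bochner_integral ?M f c"
    using int f by (intro has_bochner_integral_density[of f lborel std_normal_density c]) auto
  moreover have "distr (std_gaussian n) ?M (\<lambda>x. x i) = ?M"
    unfolding std_gaussian_def
    by (rule distr_PiM_component) (use i prob_space_normal_density[of 1 0] in auto)
  ultimately have "has_bochner_integral (distr (std_gaussian n) ?M (\<lambda>x. x i)) f c"
    by simp
  moreover have "(\<lambda>x. x i) \<in> measurable (std_gaussian n) ?M"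
    unfolding std_gaussian_def using i by (intro measurable_component_singleton) simp
  ultimately show ?thesis
    using f by (auto simp: has_bochner_integral_iff integrable_distr_eq integral_distr)
qed

lemma has_bochner_integral_std_gaussian_square:
  assumes "i < n"
  shows "has_bochner_integral (std_gaussian n) (\<lambda>x. (x i)\<^sup>2) 1"
  using std_normal_moment_even[of 1] assms
  by (intro has_bochner_integral_std_gaussian_component) (auto simp: power2_eq_square)

lemma has_bochner_integral_std_gaussian_abs:
  assumes "i < n"
  shows "has_bochner_integral (std_gaussian n) (\<lambda>x. \<bar>x i\<bar>) (sqrt (2 / pi))"
  using std_normal_moment_abs_odd[of 0] assms
  by (intro has_bochner_integral_std_gaussian_component) auto

definition unit_fun :: "nat \<Rightarrow> nat \<Rightarrow> real" where
  "unit_fun i = (\<lambda>k. if k = i then 1 else 0)"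

text \<open>A norm on \<open>carrier_vec n\<close> composed with \<open>vec n\<close>, hence defined
  on all functions.\<close>

locale fun_norm =
  fixes n :: nat and f :: "(nat \<Rightarrow> real) \<Rightarrow> real"
  assumes nonneg: "0 \<le> f x" and add: "f (x + y) \<le> f x + f y"
    and scale: "f (\<lambda>i. c * x i) = \<bar>c\<bar> * f x" and restrict: "f (restrict x {..<n}) = f x"
begin

lemma minus: "f (- x) = f x"
  using scale[of "-1" x] by (simp add: fun_Compl_def)

lemma cong_less: "(\<And>i. i < n \<Longrightarrow> x i = y i) \<Longrightarrow> f x = f y"
  using restrict[of x] restrict[of y] by (metis lessThan_iff restrict_ext)

lemma le_sum: "f x \<le> (\<Sum>i<n. \<bar>x i\<bar> * f (unit_fun i))"
proof -
  have "f (\<lambda>i. if i < k then x i else 0) \<le> (\<Sum>i<k. \<bar>x i\<bar> * f (unit_fun i))" for k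
  proof (induction k)
    case 0
    then show ?case using scale[of 0 x] by simp
  next
    case (Suc k)
    have "(\<lambda>i. if i < Suc k then x i else 0) = (\<lambda>i. if i < k then x i else 0) + (\<lambda>i. x k * unit_fun k i)"
      by (auto simp: unit_fun_def fun_eq_iff less_Suc_eq)
    then have "f (\<lambda>i. if i < Suc k then x i else 0) \<le> f (\<lambda>i. if i < k then x i else 0) + \<bar>x k\<bar> * f (unit_fun k)"
      using add[of "\<lambda>i. if i < k then x i else 0" "\<lambda>i. x k * unit_fun k i"] scale[of "x k" "unit_fun k"] by simp
    then show ?case using Suc by simp
  qed
  from this[of n] show ?thesis
    using cong_less[of x "\<lambda>i. if i < n then x i else 0"] by simp
qed

lemma square_le: "(f x)\<^sup>2 \<le> nsq n x * nsq n (\<lambda>i. f (unit_fun i))"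
proof -
  have "f x \<le> L2_set x {..<n} * L2_set (\<lambda>i. f (unit_fun i)) {..<n}"
    using le_sum[of x] L2_set_mult_ineq[of x "\<lambda>i. f (unit_fun i)" "{..<n}"] nonneg by simp
  then have "(f x)\<^sup>2 \<le> (L2_set x {..<n} * L2_set (\<lambda>i. f (unit_fun i)) {..<n})\<^sup>2"
    using nonneg by (intro power_mono)
  then show ?thesis by (simp add: L2_set_def nsq_def power_mult_distrib sum_nonneg)
qed

text \<open>f is Lipschitz for a weighted l1 distance, hence equals the infimum of the functions h
  q, a cone with apex at each rational point q. Every h q is visibly measurable for the product
  sigma-algebra, and countably many suffice.\<close>

lemma measurable [measurable]: "f \<in> borel_measurable (std_gaussian n)"
proof -
  define Q where "Q = ({..<n} \<rightarrow>\<^sub>E \<rat> :: (nat \<Rightarrow> real) set)"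
  define h where "h q x = f q + (\<Sum>i<n. \<bar>x i - q i\<bar> * f (unit_fun i))" for q x
  have "f x = (INF q\<in>Q. h q x)" for x
  proof (rule antisym)
    have lower: "f x \<le> h q x" for q
      using add[of q "x - q"] le_sum[of "x - q"] by (simp add: h_def)
    have "Q \<noteq> {}" by (auto simp: Q_def PiE_eq_empty_iff)
    then show "f x \<le> (INF q\<in>Q. h q x)" using lower by (intro cINF_greatest)
    show "(INF q\<in>Q. h q x) \<le> f x"
    proof (rule field_le_epsilon)
      fix e :: real assume e: "e > 0"
      define c where "c = (\<Sum>i<n. f (unit_fun i))"
      have c: "c \<ge> 0" unfolding c_def by (intro sum_nonneg nonneg)
      \<comment> \<open>The factor 2 is there because the distance from q to x is paid twice, in f q
        and in the cone; the + 1 guards against c = 0.\<close>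
      define \<delta> where "\<delta> = e / (2 * (c + 1))"
      have \<delta>: "\<delta> > 0" using e c by (simp add: \<delta>_def)
      have "\<forall>i. \<exists>r\<in>\<rat>. \<bar>x i - r\<bar> < \<delta>"
      proof
        fix i
        obtain r where "r \<in> \<rat>" "x i < r" "r < x i + \<delta>"
          using Rats_dense_in_real[of "x i" "x i + \<delta>"] \<delta> by auto
        then show "\<exists>r\<in>\<rat>. \<bar>x i - r\<bar> < \<delta>" by (intro bexI[of _ r]) auto
      qed
      then obtain r where r: "\<And>i. r i \<in> \<rat>" "\<And>i. \<bar>x i - r i\<bar> < \<delta>" by metis
      define q where "q = restrict r {..<n}"
      have q: "q \<in> Q" using r by (auto simp: q_def Q_def)
      have dist: "(\<Sum>i<n. \<bar>x i - q i\<bar> * f (unit_fun i)) \<le> \<delta> * c"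
        unfolding c_def sum_distrib_left using r nonneg
        by (intro sum_mono mult_right_mono) (auto simp: q_def intro: less_imp_le)
      have "f q \<le> f x + f (q - x)" using add[of x "q - x"] by simp
      also have "f (q - x) = f (x - q)" using minus[of "x - q"] by simp
      also have "f (x - q) \<le> (\<Sum>i<n. \<bar>x i - q i\<bar> * f (unit_fun i))" using le_sum[of "x - q"] by simp
      finally have "h q x \<le> f x + 2 * (\<delta> * c)" using dist by (simp add: h_def)
      also have "2 * (\<delta> * c) \<le> e"
        using e c by (simp add: \<delta>_def field_simps)
      finally have "h q x \<le> f x + e" by simp
      moreover have "(INF q\<in>Q. h q x) \<le> h q x"
        using q lower by (intro cINF_lower bdd_belowI2[of _ "f x"]) auto
      ultimately show "(INF q\<in>Q. h q x) \<le> f x + e" by linarith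
    qed
  qed
  moreover have "(\<lambda>x. INF q\<in>Q. h q x) \<in> borel_measurable (std_gaussian n)"
  proof (rule borel_measurable_cINF_real)
    show "countable Q" unfolding Q_def by (intro countable_PiE countable_rat) auto
    show "h q \<in> borel_measurable (std_gaussian n)" for q
      unfolding h_def std_gaussian_def by measurable
  qed
  ultimately show ?thesis by (simp cong: measurable_cong)
qed

lemma integrable_square: "integrable (std_gaussian n) (\<lambda>x. (f x)\<^sup>2)"
proof (rule Bochner_Integration.integrable_bound)
  have "integrable (std_gaussian n) (nsq n)"
    unfolding nsq_def using has_bochner_integral_std_gaussian_square
    by (intro Bochner_Integration.integrable_sum) (auto simp: has_bochner_integral_iff)
  then show "integrable (std_gaussian n) (\<lambda>x. nsq n x * nsq n (\<lambda>i. f (unit_fun i)))"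
    by simp
qed (use square_le in auto)

lemma integrable: "integrable (std_gaussian n) f"
proof (rule Bochner_Integration.integrable_bound)
  interpret prob_space "std_gaussian n"
    unfolding std_gaussian_eq by (rule prob_space_gauss_measure) simp
  show "integrable (std_gaussian n) (\<lambda>x. 1 + (f x)\<^sup>2)"
    using integrable_square by simp
  show "AE x in std_gaussian n. norm (f x) \<le> norm (1 + (f x)\<^sup>2)"
  proof (rule AE_I2)
    fix x
    have "0 \<le> (f x - 1)\<^sup>2" by simp
    then have "2 * f x \<le> 1 + (f x)\<^sup>2" by (simp add: power2_eq_square algebra_simps)
    then show "norm (f x) \<le> norm (1 + (f x)\<^sup>2)" using nonneg[of x] by simp
  qed
qed measurable

end

lemma fun_norm_of_is_norm_on:
  assumes "is_norm_on n N"
  shows "fun_norm n (\<lambda>x. N (vec n x))"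
proof
  have vec_add: "vec n (x + y) = vec n x + vec n y" for x y :: "nat \<Rightarrow> real"
    by auto
  have vec_scale: "vec n (\<lambda>i. c * x i) = c \<cdot>\<^sub>v vec n x" for c and x :: "nat \<Rightarrow> real"
    by auto
  fix x y c
  show "0 \<le> N (vec n x)" "N (vec n (x + y)) \<le> N (vec n x) + N (vec n y)" "N (vec n (\<lambda>i. c * x i)) = \<bar>c\<bar> * N (vec n x)"
    using assms vec_carrier unfolding is_norm_on_def vec_add vec_scale by blast+
  have "vec n (restrict x {..<n}) = vec n x" by auto
  then show "N (vec n (restrict x {..<n})) = N (vec n x)" by simp
qed

lemma prob_space_std_gaussian: "prob_space (std_gaussian n)"
  unfolding std_gaussian_eq by (rule prob_space_gauss_measure) simp

text \<open>Markov's inequality at four times the mean, applied to the maximum and to the weighted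
  sum of squares; each fails with probability at most 1/4. The second mean is at most \<Lambda>^2
  S^2 because the second moments are bounded index by index, which is why \<lambda> has its maximum
  outside the expectation.\<close>

lemma noise_set_prob:
  fixes f :: "nat \<Rightarrow> (nat \<Rightarrow> real) \<Rightarrow> real"
  assumes J: "finite J" "J \<noteq> {}" and f: "\<And>j. j \<in> J \<Longrightarrow> fun_norm n (f j)"
    and \<kappa>: "(\<integral>g. Max ((\<lambda>j. f j g) ` J) \<partial>std_gaussian n) < \<kappa>"
    and \<Lambda>: "\<And>j. j \<in> J \<Longrightarrow> (\<integral>g. (f j g)\<^sup>2 \<partial>std_gaussian n) \<le> \<Lambda>\<^sup>2" "\<Lambda> > 0"
    and S: "L2_set (\<lambda>j. f j x) J \<le> S" "S > 0"
  shows "1/2 \<le> measure (std_gaussian n)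
    ({u. (\<forall>j\<in>J. f j u \<le> 4 * \<kappa>) \<and> L2_set (\<lambda>j. f j u * f j x) J \<le> 2 * \<Lambda> * S} \<inter> extensional {..<n})"
proof -
  let ?\<gamma> = "std_gaussian n"
  interpret prob_space ?\<gamma> by (rule prob_space_std_gaussian)
  have nonneg: "0 \<le> f j u" if "j \<in> J" for j u
    using fun_norm.nonneg[OF f[OF that]] .
  have meas[measurable]: "f j \<in> borel_measurable ?\<gamma>" if "j \<in> J" for j
    using fun_norm.measurable[OF f[OF that]] .
  define F where "F u = Max ((\<lambda>j. f j u) ` J)" for u
  have F_ge: "f j u \<le> F u" if "j \<in> J" for j u
    unfolding F_def using J that by (intro Max_ge) auto
  have F_nonneg: "0 \<le> F u" for u
    using J(2) F_ge nonneg by (meson equals0I order_trans)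
  have F_meas[measurable]: "F \<in> borel_measurable ?\<gamma>"
    unfolding F_def using J meas by (intro borel_measurable_Max) auto
  have F_int: "integrable ?\<gamma> F"
  proof (rule Bochner_Integration.integrable_bound[OF _ F_meas AE_I2])
    show "integrable ?\<gamma> (\<lambda>u. \<Sum>j\<in>J. f j u)"
      using fun_norm.integrable[OF f] by (intro Bochner_Integration.integrable_sum) auto
    fix u
    have "F u \<in> (\<lambda>j. f j u) ` J" unfolding F_def using J by (intro Max_in) auto
    then have "F u \<le> (\<Sum>j\<in>J. f j u)"
      using J nonneg by (auto intro!: member_le_sum)
    then show "norm (F u) \<le> norm (\<Sum>j\<in>J. f j u)" using F_nonneg[of u] by simp
  qed
  have \<kappa>_pos: "\<kappa> > 0"
  proof -
    have "0 \<le> (\<integral>g. F g \<partial>?\<gamma>)" using F_nonneg by simp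
    then show ?thesis using \<kappa> by (simp add: F_def)
  qed
  define H where "H u = (\<Sum>j\<in>J. (f j u * f j x)\<^sup>2)" for u
  have H_nonneg: "0 \<le> H u" for u unfolding H_def by (intro sum_nonneg) auto
  have sq_int: "integrable ?\<gamma> (\<lambda>u. (f j u * f j x)\<^sup>2)" if "j \<in> J" for j
    unfolding power_mult_distrib using fun_norm.integrable_square[OF f[OF that]] by simp
  have H_int: "integrable ?\<gamma> H"
    unfolding H_def using sq_int by (intro Bochner_Integration.integrable_sum) auto
  have "(\<integral>u. H u \<partial>?\<gamma>) = (\<Sum>j\<in>J. (\<integral>u. (f j u)\<^sup>2 \<partial>?\<gamma>) * (f j x)\<^sup>2)"
    unfolding H_def using sq_int by (subst Bochner_Integration.integral_sum) (auto simp: power_mult_distrib)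
  also have "\<dots> \<le> (\<Sum>j\<in>J. \<Lambda>\<^sup>2 * (f j x)\<^sup>2)"
    using \<Lambda> by (intro sum_mono mult_right_mono) auto
  also have "\<dots> = \<Lambda>\<^sup>2 * (L2_set (\<lambda>j. f j x) J)\<^sup>2"
    by (simp add: L2_set_def sum_nonneg sum_distrib_left)
  also have "\<dots> \<le> \<Lambda>\<^sup>2 * S\<^sup>2"
    using S by (intro mult_left_mono power_mono) auto
  finally have H_le: "(\<integral>u. H u \<partial>?\<gamma>) \<le> \<Lambda>\<^sup>2 * S\<^sup>2" .
  define A where "A = {u \<in> space ?\<gamma>. F u \<ge> 4 * \<kappa>}"
  define B where "B = {u \<in> space ?\<gamma>. H u \<ge> 4 * (\<Lambda>\<^sup>2 * S\<^sup>2)}"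
  have [measurable]: "H \<in> borel_measurable ?\<gamma>" using H_int by simp
  have AB: "A \<in> sets ?\<gamma>" "B \<in> sets ?\<gamma>"
    unfolding A_def B_def by measurable
  have "prob A \<le> (\<integral>u. F u \<partial>?\<gamma>) / (4 * \<kappa>)"
    unfolding A_def using F_int F_nonneg \<kappa>_pos
    by (intro integral_Markov_inequality_measure[where A = "{}"]) auto
  also have "\<dots> \<le> 1 / 4"
    using \<kappa> \<kappa>_pos by (simp add: F_def field_simps)
  finally have PA: "prob A \<le> 1 / 4" .
  have "prob B \<le> (\<integral>u. H u \<partial>?\<gamma>) / (4 * (\<Lambda>\<^sup>2 * S\<^sup>2))"
    unfolding B_def using H_int H_nonneg \<Lambda> S
    by (intro integral_Markov_inequality_measure[where A = "{}"]) auto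
  also have "\<dots> \<le> 1 / 4"
    using H_le \<Lambda> S by (simp add: field_simps)
  finally have PB: "prob B \<le> 1 / 4" .
  let ?G = "{u. (\<forall>j\<in>J. f j u \<le> 4 * \<kappa>) \<and> L2_set (\<lambda>j. f j u * f j x) J \<le> 2 * \<Lambda> * S} \<inter> extensional {..<n}"
  have "?G = {u \<in> space ?\<gamma>. (\<forall>j\<in>J. f j u \<le> 4 * \<kappa>) \<and> L2_set (\<lambda>j. f j u * f j x) J \<le> 2 * \<Lambda> * S}"
    by (auto simp: space_std_gaussian)
  also have "\<dots> \<in> sets ?\<gamma>"
    unfolding L2_set_def using J by measurable
  finally have G: "?G \<in> sets ?\<gamma>" .
  have "space ?\<gamma> - (A \<union> B) \<subseteq> ?G"
  proof
    fix u assume u: "u \<in> space ?\<gamma> - (A \<union> B)"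
    then have "F u < 4 * \<kappa>" "H u < (2 * \<Lambda> * S)\<^sup>2"
      by (auto simp: A_def B_def power_mult_distrib)
    then have "f j u \<le> 4 * \<kappa>" if "j \<in> J" for j
      using F_ge[OF that, of u] by simp
    moreover have "L2_set (\<lambda>j. f j u * f j x) J \<le> 2 * \<Lambda> * S"
      using \<open>H u < _\<close> \<Lambda>(2) S(2) unfolding L2_set_def H_def
      by (intro real_le_lsqrt) (auto intro: less_imp_le sum_nonneg)
    ultimately show "u \<in> ?G" using u by (simp add: space_std_gaussian)
  qed
  then have "prob (space ?\<gamma> - (A \<union> B)) \<le> prob ?G"
    using G by (intro finite_measure_mono)
  moreover have "prob (space ?\<gamma> - (A \<union> B)) = 1 - prob (A \<union> B)"
    using AB by (intro prob_compl) auto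
  moreover have "prob (A \<union> B) \<le> prob A + prob B"
    using AB by (intro measure_Un_le)
  ultimately show ?thesis using PA PB by linarith
qed

text \<open>For n = 1 the factor sqrt (log n) vanishes, so \<lambda> has to be absorbed by \<kappa>.
  Every norm is then a multiple c_j of the absolute value, and both quantities are comparable to the
  largest c_j.\<close>

lemma lambda_le_kappa_dim1:
  assumes M: "M \<ge> 1" and N: "\<forall>j\<in>{1..M}. is_norm_on 1 (N j)"
  shows "lambda 1 M N \<le> 2 * kappa 1 M N"
proof -
  define f where "f j x = N j (vec 1 x)" for j and x :: "nat \<Rightarrow> real"
  have f: "fun_norm 1 (f j)" if "j \<in> {1..M}" for j
    unfolding f_def using fun_norm_of_is_norm_on[of 1 "N j"] N that by blast
  define c where "c j = f j (\<lambda>_. 1)" for j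
  have c: "f j x = \<bar>x 0\<bar> * c j" if "j \<in> {1..M}" for j x
    using fun_norm.cong_less[OF f[OF that], of x "\<lambda>i. x 0 * 1"] fun_norm.scale[OF f[OF that], of "x 0" "\<lambda>_. 1"]
    by (simp add: c_def)
  have c_nonneg: "0 \<le> c j" if "j \<in> {1..M}" for j
    unfolding c_def using fun_norm.nonneg[OF f[OF that]] .
  define C where "C = Max (c ` {1..M})"
  have C: "c j \<le> C" if "j \<in> {1..M}" for j
    unfolding C_def using that by (intro Max_ge) auto
  have "C \<in> c ` {1..M}"
    unfolding C_def using M by (intro Max_in) auto
  then have C_nonneg: "0 \<le> C" using c_nonneg by auto
  have "sqrt (\<integral>g. (N j (vec 1 g))\<^sup>2 \<partial>std_gaussian 1) \<le> C" if j: "j \<in> {1..M}" for j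
  proof -
    have "(\<integral>g. (N j (vec 1 g))\<^sup>2 \<partial>std_gaussian 1) = (\<integral>g. (g 0)\<^sup>2 * (c j)\<^sup>2 \<partial>std_gaussian 1)"
      using c[OF j] by (simp add: f_def power_mult_distrib)
    also have "\<dots> = (c j)\<^sup>2"
      using has_bochner_integral_std_gaussian_square[of 0 1] by (simp add: has_bochner_integral_iff)
    finally show ?thesis using c_nonneg[OF j] C[OF j] by simp
  qed
  then have "lambda 1 M N \<le> C"
    unfolding lambda_def using M by (subst Max_le_iff) auto
  moreover have "kappa 1 M N = sqrt (2 / pi) * C"
  proof -
    have "Max ((\<lambda>j. N j (vec 1 g)) ` {1..M}) = \<bar>g 0\<bar> * C" for g
    proof (rule Max_eqI)
      show "y \<le> \<bar>g 0\<bar> * C" if "y \<in> (\<lambda>j. N j (vec 1 g)) ` {1..M}" for y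
        using that c C by (auto simp: f_def intro!: mult_left_mono)
      obtain j where "j \<in> {1..M}" "C = c j" using \<open>C \<in> c ` {1..M}\<close> by blast
      then show "\<bar>g 0\<bar> * C \<in> (\<lambda>j. N j (vec 1 g)) ` {1..M}"
        using c[of j g] by (intro image_eqI[of _ _ j]) (simp_all add: f_def)
    qed simp
    then have "kappa 1 M N = (\<integral>g. \<bar>g 0\<bar> * C \<partial>std_gaussian 1)"
      by (simp add: kappa_def)
    also have "\<dots> = sqrt (2 / pi) * C"
      using has_bochner_integral_std_gaussian_abs[of 0 1] by (simp add: has_bochner_integral_iff)
    finally show ?thesis .
  qed
  moreover have "1 / 2 \<le> sqrt (2 / pi)"
    using pi_less_4 by (intro real_le_rsqrt) (simp add: power2_eq_square field_simps)
  then have "1 / 2 * C \<le> sqrt (2 / pi) * C"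
    using C_nonneg by (rule mult_right_mono)
  ultimately show ?thesis by simp
qed

section \<open>From norms on \<open>real vec\<close> to the abstract family\<close>

lemma kappa_nonneg:
  assumes "M \<ge> 1" "\<forall>j\<in>{1..M}. is_norm_on n (N j)"
  shows "0 \<le> kappa n M N"
proof -
  have "0 \<le> Max ((\<lambda>j. N j (vec n g)) ` {1..M})" for g
  proof -
    have "0 \<le> N 1 (vec n g)"
      using assms by (intro fun_norm.nonneg[OF fun_norm_of_is_norm_on]) auto
    also have "\<dots> \<le> Max ((\<lambda>j. N j (vec n g)) ` {1..M})"
      using assms by (intro Max_ge) auto
    finally show ?thesis .
  qed
  then show ?thesis unfolding kappa_def by simp
qed

lemma lambda_ge:
  "j \<in> {1..M} \<Longrightarrow> sqrt (\<integral>g. (N j (vec n g))\<^sup>2 \<partial>std_gaussian n) \<le> lambda n M N"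
  unfolding lambda_def by (intro Max_ge) auto

lemma lambda_nonneg:
  assumes "M \<ge> 1"
  shows "0 \<le> lambda n M N"
proof -
  have "0 \<le> sqrt (\<integral>g. (N 1 (vec n g))\<^sup>2 \<partial>std_gaussian n)" by simp
  also have "\<dots> \<le> lambda n M N" using assms by (intro lambda_ge) simp
  finally show ?thesis .
qed

lemma vec_vec_index: "x \<in> carrier_vec n \<Longrightarrow> vec n (vec_index x) = x"
  by auto

lemma nsq_vec_index_le_1:
  assumes "x \<in> unit_ball n"
  shows "nsq n (vec_index x) \<le> 1"
proof -
  have "nsq n (vec_index x) = x \<bullet> x" "sqrt (x \<bullet> x) \<le> 1"
    using assms by (auto simp: unit_ball_def nsq_def scalar_prod_def power2_eq_square lessThan_atLeast0)
  then show ?thesis by simp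
qed

text \<open>The containment in the unit ball bounds the set, so the real-valued \<open>SUP\<close>
  is a genuine supremum.\<close>

lemma norm_family_Sup:
  assumes N: "\<forall>j\<in>{1..M}. is_norm_on n (N j)" and T: "T \<subseteq> unit_ball n" and x: "x \<in> T"
  shows "sqrt (\<Sum>j=1..M. (N j x)\<^sup>2) \<le> (SUP x\<in>T. sqrt (\<Sum>j=1..M. (N j x)\<^sup>2))"
    and "0 \<le> (SUP x\<in>T. sqrt (\<Sum>j=1..M. (N j x)\<^sup>2))"
proof -
  have "bdd_above ((\<lambda>x. sqrt (\<Sum>j=1..M. (N j x)\<^sup>2)) ` T)"
  proof (rule bdd_aboveI2)
    fix x assume "x \<in> T"
    then have x: "x \<in> unit_ball n" "x \<in> carrier_vec n" using T by (auto simp: unit_ball_def)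
    have "(N j x)\<^sup>2 \<le> nsq n (\<lambda>i. N j (vec n (unit_fun i)))" if j: "j \<in> {1..M}" for j
    proof -
      have "(N j x)\<^sup>2 \<le> nsq n (vec_index x) * nsq n (\<lambda>i. N j (vec n (unit_fun i)))"
        using fun_norm.square_le[OF fun_norm_of_is_norm_on, of n "N j" "vec_index x"] N j
        by (simp add: vec_vec_index[OF x(2)])
      also have "\<dots> \<le> 1 * nsq n (\<lambda>i. N j (vec n (unit_fun i)))"
        using nsq_vec_index_le_1[OF x(1)] by (intro mult_right_mono) auto
      finally show ?thesis by simp
    qed
    then show "sqrt (\<Sum>j=1..M. (N j x)\<^sup>2) \<le> sqrt (\<Sum>j=1..M. nsq n (\<lambda>i. N j (vec n (unit_fun i))))"
      by (intro real_sqrt_le_mono sum_mono)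
  qed
  then show le: "sqrt (\<Sum>j=1..M. (N j x)\<^sup>2) \<le> (SUP x\<in>T. sqrt (\<Sum>j=1..M. (N j x)\<^sup>2))"
    using x by (rule cSUP_upper2) simp
  have "0 \<le> sqrt (\<Sum>j=1..M. (N j x)\<^sup>2)" by (simp add: sum_nonneg)
  with le show "0 \<le> (SUP x\<in>T. sqrt (\<Sum>j=1..M. (N j x)\<^sup>2))" by linarith
qed

text \<open>\<open>norm_family\<close> demands strictly positive parameters, and
  \<open>noise_set_prob\<close> a strict bound on the mean of the maximum. All three are enlarged by
  e, and e tends to 0 at the end; this also covers T = {0}.\<close>

lemma rademacher_Sup_le_kappa_lambda:
  assumes n: "n \<ge> 1" and M: "M \<ge> 1" and N: "\<forall>j\<in>{1..M}. is_norm_on n (N j)"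
    and T: "T \<noteq> {}" "T \<subseteq> unit_ball n"
  shows "measure_pmf.expectation (rademacher M) (\<lambda>\<epsilon>. SUP x\<in>T. \<Sum>j=1..M. \<epsilon> j * (N j x)\<^sup>2)
    \<le> 43000 * (SUP x\<in>T. sqrt (\<Sum>j=1..M. (N j x)\<^sup>2)) * (lambda n M N * sqrt (ln (real n) + 2) + kappa n M N)"
    (is "?L \<le> 43000 * ?S * (?\<Lambda> * ?r + ?\<kappa>)")
proof -
  define f where "f j x = N j (vec n x)" for j and x :: "nat \<Rightarrow> real"
  have f: "fun_norm n (f j)" if "j \<in> {1..M}" for j
    unfolding f_def using fun_norm_of_is_norm_on[of n "N j"] N that by blast
  have f_emb: "f j (vec_index x) = N j x" if "x \<in> T" for j x
    using T that by (auto simp: f_def unit_ball_def vec_vec_index)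
  note lam_nonneg = lambda_nonneg[OF M, of n N] and kappa_nonneg = kappa_nonneg[OF M N]
  have S_nonneg: "0 \<le> ?S"
    using T(1) norm_family_Sup(2)[OF N T(2)] by blast
  have bound: "?L \<le> 43000 * (?S + e) * ((?\<Lambda> + e) * ?r + (?\<kappa> + e))" if e: "e > 0" for e
  proof -
    have noise: "1/2 \<le> measure (std_gaussian n) ({u. (\<forall>j\<in>{1..M}. f j u \<le> 4 * (?\<kappa> + e)) \<and>
        L2_set (\<lambda>j. f j u * f j x) {1..M} \<le> 2 * (?\<Lambda> + e) * (?S + e)} \<inter> extensional {..<n})"
      and Sx: "L2_set (\<lambda>j. f j x) {1..M} \<le> ?S + e" if x: "x \<in> vec_index ` T" for x
    proof -
      obtain y where y: "y \<in> T" "x = vec_index y" using x by blast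
      have "L2_set (\<lambda>j. f j x) {1..M} \<le> ?S"
        using norm_family_Sup(1)[OF N T(2) y(1)] f_emb[OF y(1)] y(2) by (simp add: L2_set_def)
      then show *: "L2_set (\<lambda>j. f j x) {1..M} \<le> ?S + e" using e by simp
      show "1/2 \<le> measure (std_gaussian n) ({u. (\<forall>j\<in>{1..M}. f j u \<le> 4 * (?\<kappa> + e)) \<and>
        L2_set (\<lambda>j. f j u * f j x) {1..M} \<le> 2 * (?\<Lambda> + e) * (?S + e)} \<inter> extensional {..<n})"
      proof (rule noise_set_prob[OF _ _ f])
        show "(\<integral>g. Max ((\<lambda>j. f j g) ` {1..M}) \<partial>std_gaussian n) < ?\<kappa> + e"
          using e by (simp add: kappa_def f_def)
        fix j assume j: "j \<in> {1..M}"
        show "(\<integral>g. (f j g)\<^sup>2 \<partial>std_gaussian n) \<le> (?\<Lambda> + e)\<^sup>2"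
          using lambda_ge[OF j, where n = n and N = N] e unfolding f_def by (intro sqrt_le_D) simp
      qed (use M * e S_nonneg lam_nonneg in auto)
    qed
    have "norm_family n {1..M} f (?\<kappa> + e) (?\<Lambda> + e) (?S + e) (vec_index ` T)"
    proof
      show "1 \<le> n" by (rule n)
      show "0 < ?\<kappa> + e" "0 < ?\<Lambda> + e" "0 < ?S + e"
        using e S_nonneg lam_nonneg kappa_nonneg by auto
      fix j x y c assume j: "j \<in> {1..M}"
      show "0 \<le> f j x" "f j (x + y) \<le> f j x + f j y" "f j (\<lambda>i. c * x i) = \<bar>c\<bar> * f j x"
        "f j (restrict x {..<n}) = f j x" "f j \<in> borel_measurable (std_gaussian n)"
        using fun_norm.nonneg[OF f[OF j]] fun_norm.add[OF f[OF j]] fun_norm.scale[OF f[OF j]]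
          fun_norm.restrict[OF f[OF j]] fun_norm.measurable[OF f[OF j]] by blast+
    next
      fix x assume "x \<in> vec_index ` T"
      then show "nsq n x \<le> 1" using T(2) nsq_vec_index_le_1 by blast
    qed (use noise Sx in simp_all)
    then have "measure_pmf.expectation (rademacher M) (\<lambda>\<epsilon>. SUP x\<in>vec_index ` T. \<Sum>j=1..M. \<epsilon> j * (f j x)\<^sup>2)
        \<le> 43000 * (?S + e) * ((?\<Lambda> + e) * ?r + (?\<kappa> + e))"
      by (rule rademacher_Sup_le) (use T in simp)
    moreover have "(SUP x\<in>vec_index ` T. \<Sum>j=1..M. \<epsilon> j * (f j x)\<^sup>2) = (SUP x\<in>T. \<Sum>j=1..M. \<epsilon> j * (N j x)\<^sup>2)" for \<epsilon>
      unfolding image_image by (intro SUP_cong) (auto simp: f_emb)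
    ultimately show ?thesis by simp
  qed
  show ?thesis
  proof (rule tendsto_lowerbound)
    have "((\<lambda>e. 43000 * (?S + e) * ((?\<Lambda> + e) * ?r + (?\<kappa> + e))) \<longlongrightarrow> 43000 * (?S + 0) * ((?\<Lambda> + 0) * ?r + (?\<kappa> + 0))) (at_right 0)"
      by (intro tendsto_intros)
    then show "((\<lambda>e. 43000 * (?S + e) * ((?\<Lambda> + e) * ?r + (?\<kappa> + e))) \<longlongrightarrow> 43000 * ?S * (?\<Lambda> * ?r + ?\<kappa>)) (at_right 0)"
      by simp
    show "\<forall>\<^sub>F e in at_right 0. ?L \<le> 43000 * (?S + e) * ((?\<Lambda> + e) * ?r + (?\<kappa> + e))"
      using bound by (auto simp: eventually_at_right_less eventually_at_filter intro!: always_eventually)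
  qed simp
qed

theorem lemma2p12:
  shows "\<exists>C::real. C > 0 \<and>
    (\<forall>(n::nat) (M::nat) (N :: nat \<Rightarrow> real vec \<Rightarrow> real) (T :: real vec set).
       n \<ge> 1 \<longrightarrow> M \<ge> 1 \<longrightarrow> (\<forall>j\<in>{1..M}. is_norm_on n (N j)) \<longrightarrow>
       T \<noteq> {} \<longrightarrow> T \<subseteq> unit_ball n \<longrightarrow>
       measure_pmf.expectation (rademacher M) (\<lambda>\<epsilon>. SUP x\<in>T. \<Sum>j=1..M. \<epsilon> j * (N j x)\<^sup>2)
         \<le> C * (lambda n M N * sqrt (ln (real n)) + kappa n M N)
             * (SUP x\<in>T. sqrt (\<Sum>j=1..M. (N j x)\<^sup>2)))"
proof (intro exI[of _ "215000::real"] conjI allI impI)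
  fix n M :: nat and N :: "nat \<Rightarrow> real vec \<Rightarrow> real" and T :: "real vec set"
  assume n: "n \<ge> 1" and M: "M \<ge> 1" and N: "\<forall>j\<in>{1..M}. is_norm_on n (N j)"
    and T: "T \<noteq> {}" "T \<subseteq> unit_ball n"
  let ?S = "SUP x\<in>T. sqrt (\<Sum>j=1..M. (N j x)\<^sup>2)"
  show "measure_pmf.expectation (rademacher M) (\<lambda>\<epsilon>. SUP x\<in>T. \<Sum>j=1..M. \<epsilon> j * (N j x)\<^sup>2)
         \<le> 215000 * (lambda n M N * sqrt (ln (real n)) + kappa n M N) * ?S"
  proof -
    let ?L = "lambda n M N" and ?K = "kappa n M N"
    have nonneg: "0 \<le> ?L" "0 \<le> ?K" "0 \<le> ?S"
      using lambda_nonneg[OF M] kappa_nonneg[OF M N] norm_family_Sup(2)[OF N T(2)] T(1) by auto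
    \<comment> \<open>The 2 under the root is absorbed at a factor 5: for n = 1 through \<lambda>
      \<le> 2 \<kappa>, and for n \<ge> 2 through ln n \<ge> 1/2, which gives ln n + 2 \<le> 5 ln n
      \<le> 25 ln n. Hence 215000 = 5 * 43000.\<close>
    have "?L * sqrt (ln (real n) + 2) + ?K \<le> 5 * (?L * sqrt (ln (real n)) + ?K)"
    proof (cases "n = 1")
      case True
      then have "?L \<le> 2 * ?K" using lambda_le_kappa_dim1[OF M] N by simp
      moreover have "sqrt 2 \<le> (2::real)" by (intro real_le_lsqrt) auto
      then have "?L * sqrt 2 \<le> ?L * 2" using nonneg by (intro mult_left_mono)
      ultimately show ?thesis using True by simp
    next
      case False
      then have "ln 2 \<le> ln (real n)" using n by simp
      moreover have "1 / 2 \<le> ln (2::real)"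
        using ln2_ge_two_thirds by linarith
      ultimately have "sqrt (ln (real n) + 2) \<le> sqrt (25 * ln (real n))"
        by (intro real_sqrt_le_mono) linarith
      then have "sqrt (ln (real n) + 2) \<le> 5 * sqrt (ln (real n))"
        by (simp add: real_sqrt_mult)
      then have "?L * sqrt (ln (real n) + 2) \<le> ?L * (5 * sqrt (ln (real n)))"
        using nonneg by (intro mult_left_mono)
      then show ?thesis using nonneg by simp
    qed
    then have "43000 * ?S * (?L * sqrt (ln (real n) + 2) + ?K) \<le> 43000 * ?S * (5 * (?L * sqrt (ln (real n)) + ?K))"
      using nonneg by (intro mult_left_mono) auto
    also have "\<dots> = 215000 * (?L * sqrt (ln (real n)) + ?K) * ?S"
      by (simp only: mult_ac)
    finally show ?thesis
      using rademacher_Sup_le_kappa_lambda[OF n M N T] by (rule order_trans[rotated])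
  qed
qed simp

end
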